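(* Suppose $\delta_2=\rho\delta_1+e$ with $\delta_1$ independent of $e$. Let $B_{CF}$ be the true value of $(\beta_{Y0},\theta_1,\dots,\theta_{K_1},\gamma_1,\dots,\gamma_{K_2},\rho)^T$ and $\hat B_{CF}$ its estimate by the control function method. Then, as $n\to\infty$, $$\hat B_{CF}\stackrel{p}{\rightarrow}B_{CF},\qquad \sqrt n\,(\hat B_{CF}-B_{CF})\stackrel{d}{\rightarrow}N(0,\Sigma_{CF}),$$ where $$\Sigma_{CF}=E(W^TW)^{-1}E(W^TDW)E(W^TW)^{-1},$$ $W=[1,f_1,\ldots,f_{K_1},g_1,\ldots,g_{K_2},\hat\delta_1]$ is the $n\times(K_1+K_2+2)$ regressor matrix of the second-stage regression, $D=Var(e)I+\rho^2VV_{\hat\beta}V^T$, $I$ is the $n\times n$ identity matrix, $V$ is the regressor matrix of the first-stage regression, and $V_{\hat\beta}=(V^TV)^{-1}Var(\delta_1)$ is the covariance matrix of the coefficient estimates in the first-stage regression.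
   Context: Setting. One observes $n$ i.i.d. copies of $(Z,C,X,Y)$: $Z$ an instrumental variable, $C$ an observed covariate (each possibly multi-dimensional), $X$ a continuous real exposure, $Y$ a continuous real outcome; $U$ is an unobserved confounder. The model is $$X=\beta_{X0}+\beta_Z Z+\beta_C C+\delta_1,\qquad Y=\beta_{Y0}+f(X)+g(C)+\delta_2,$$ $$\delta_1=\beta_U U+\epsilon_X,\qquad \delta_2=h(U)+\epsilon_Y,$$ with $f(X)=\sum_{j=1}^{K_1}\theta_j f_j(X)$, $g(C)=\sum_{j=1}^{K_2}\gamma_j g_j(C)$, $K_1,K_2\ge1$, known basis functions $f_j,g_j$, and $h$ unrestricted. The errors $\epsilon_X,\epsilon_Y$ have mean zero and are independent of each other and of $Z,C,U$. The instrument has a direct effect on $X$ ($\beta_Z\ne0$), $Z$ is independent of $U$, and $Z$ has no direct effect on $Y$. Also $C$ is independent of $Z$ and of $U$. The variables $1,f_1(X),\dots,f_{K_1}(X)$ are linearly independent, $1,g_1(C),\dots,g_{K_2}(C)$ are linearly independent, and the instruments (resp. the covariates), if several, are linearly independent. Control function method. First stage: fit the linear regression (with intercept) of $X$ on $Z$ and $C$ (regressor matrix $V=[1,Z,C]$), with residuals $\hat\delta_1$. Second stage: fit by least squares the linear regression of $Y$ on $1,f_1(X),\dots,f_{K_1}(X),g_1(C),\dots,g_{K_2}(C),\hat\delta_1$; its coefficient vector is $\hat B_{CF}$. It is based on $E(Y\mid f(X),g(C),\hat\delta_1)=\beta_{Y0}+f(X)+g(C)+\rho\hat\delta_1$. Notation.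 In the formula for $\Sigma_{CF}$ moments are normalized per observation: $E(W^TW)$ and $E(W^TDW)$ denote the probability limits, as $n\to\infty$, of $n^{-1}W^TW$ and $n^{-1}W^TDW$.
   Formalization: Adds: finite second moments of Z, C, f_j(X), g_j(C), δ1, δ2; E h(U)=0; joint linear independence of 1, f_j(X), g_j(C), δ1 (so E(W^TW) is invertible); C independent of the pair (Z,U), ε_X of (Z,C,U), ε_Y of (ε_X,Z,C,U) jointly. *)

theory Defs
  imports "HOL-Probability.Probability"
begin

text \<open>
  The library's \<open>indep_var\<close> forces both random variables to have the same value type;
  this is the same notion for two value types.
\<close>
definition indep_rv ::
  "'w measure \<Rightarrow> ('w \<Rightarrow> 'a::topological_space) \<Rightarrow> ('w \<Rightarrow> 'b::topological_space) \<Rightarrow> bool" where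
  "indep_rv P X Y \<longleftrightarrow>
     X \<in> borel_measurable P \<and> Y \<in> borel_measurable P \<and>
     prob_space.indep_set P {X -` A \<inter> space P | A. A \<in> sets borel}
                            {Y -` B \<inter> space P | B. B \<in> sets borel}"

definition iid_copies ::
  "'s measure \<Rightarrow> (nat \<Rightarrow> 's \<Rightarrow> 'a::topological_space) \<Rightarrow> 'w measure \<Rightarrow> ('w \<Rightarrow> 'a) \<Rightarrow> bool" where
  "iid_copies M S P T \<longleftrightarrow>
     prob_space.indep_vars M (\<lambda>_. borel) S UNIV \<and>
     (\<forall>i. distr M borel (S i) = distr P borel T)"

definition lin_indep_rv :: "'w measure \<Rightarrow> ('w \<Rightarrow> real ^ 'k) \<Rightarrow> bool" where
  "lin_indep_rv P R \<longleftrightarrow> (\<forall>a. (AE \<omega> in P. a \<bullet> R \<omega> = 0) \<longrightarrow> a = 0)"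

definition with_one :: "real ^ 'k \<Rightarrow> real ^ 'k option" where
  "with_one x = (\<chi> r. case r of None \<Rightarrow> 1 | Some j \<Rightarrow> x $ j)"

text \<open>
  In the next two definitions measurability is part of the notion, because \<open>measure\<close> and the
  Bochner integral are 0 on non-measurable arguments.
\<close>
definition conv_in_prob :: "'s measure \<Rightarrow> (nat \<Rightarrow> 's \<Rightarrow> 'a::metric_space) \<Rightarrow> 'a \<Rightarrow> bool" where
  "conv_in_prob M T c \<longleftrightarrow>
     (\<forall>n. T n \<in> borel_measurable M) \<and>
     (\<forall>\<epsilon>>0. (\<lambda>n. measure M {\<omega> \<in> space M. dist (T n \<omega>) c > \<epsilon>}) \<longlonglongrightarrow> 0)"

definition conv_in_distr ::
  "'s measure \<Rightarrow> (nat \<Rightarrow> 's \<Rightarrow> 'a::topological_space) \<Rightarrow> 'a measure \<Rightarrow> bool" where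
  "conv_in_distr M T N \<longleftrightarrow>
     (\<forall>n. T n \<in> borel_measurable M) \<and> prob_space N \<and> sets N = sets borel \<and>
     (\<forall>\<phi>::'a \<Rightarrow> real. continuous_on UNIV \<phi> \<and> bounded (range \<phi>) \<longrightarrow>
        (\<lambda>n. \<integral>\<omega>. \<phi> (T n \<omega>) \<partial>M) \<longlonglongrightarrow> (\<integral>x. \<phi> x \<partial>N))"

definition std_normal_vec :: "(real ^ 'k) measure" where
  "std_normal_vec = density lborel (\<lambda>x. ennreal (\<Prod>i\<in>UNIV. std_normal_density (x $ i)))"

text \<open>The law of \<open>m + A G\<close> with \<open>G\<close> standard normal; a singular \<open>\<Sigma>\<close> is allowed.\<close>
definition is_mv_normal :: "(real ^ 'k) measure \<Rightarrow> real ^ 'k \<Rightarrow> real ^ 'k ^ 'k \<Rightarrow> bool" where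
  "is_mv_normal N m \<Sigma> \<longleftrightarrow>
     (\<exists>A::real ^ 'k ^ 'k. A ** transpose A = \<Sigma> \<and>
        N = distr std_normal_vec borel (\<lambda>x. m + A *v x))"

text \<open>
  A matrix with \<open>n\<close> rows, \<open>n\<close> being the sample size, is a function \<open>R\<close> from row numbers to rows,
  of which the rows \<open>i < n\<close> matter; \<open>gram n R\<close> is \<open>R\<^sup>T R\<close> and \<open>sandwich n R D\<close> is \<open>R\<^sup>T D R\<close>.
\<close>
definition gram :: "nat \<Rightarrow> (nat \<Rightarrow> real ^ 'k) \<Rightarrow> real ^ 'k ^ 'k" where
  "gram n R = (\<chi> a b. \<Sum>i<n. R i $ a * R i $ b)"

definition sandwich ::
  "nat \<Rightarrow> (nat \<Rightarrow> real ^ 'k) \<Rightarrow> (nat \<Rightarrow> nat \<Rightarrow> real) \<Rightarrow> real ^ 'k ^ 'k" where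
  "sandwich n R D = (\<chi> a b. \<Sum>i<n. \<Sum>j<n. R i $ a * D i j * R j $ b)"

definition least_squares ::
  "nat \<Rightarrow> (nat \<Rightarrow> real ^ 'k) \<Rightarrow> (nat \<Rightarrow> real) \<Rightarrow> real ^ 'k \<Rightarrow> bool" where
  "least_squares n R y b \<longleftrightarrow>
     (\<forall>b'. (\<Sum>i<n. (y i - R i \<bullet> b)\<^sup>2) \<le> (\<Sum>i<n. (y i - R i \<bullet> b')\<^sup>2))"

datatype ('p, 'q) reg1 = Icpt1 | Instr 'p | Covar 'q

datatype ('k1, 'k2) reg2 = Icpt2 | BasisF 'k1 | BasisG 'k2 | Resid

lemma UNIV_reg1: "UNIV = insert Icpt1 (range Instr \<union> range Covar)"
proof -
  have "r \<in> insert Icpt1 (range Instr \<union> range Covar)" for r :: "('p, 'q) reg1"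
    by (cases r) auto
  then show ?thesis by blast
qed

lemma UNIV_reg2: "UNIV = insert Icpt2 (insert Resid (range BasisF \<union> range BasisG))"
proof -
  have "r \<in> insert Icpt2 (insert Resid (range BasisF \<union> range BasisG))" for r :: "('k1, 'k2) reg2"
    by (cases r) auto
  then show ?thesis by blast
qed

instance reg1 :: (finite, finite) finite
  by standard (simp add: UNIV_reg1)

instance reg2 :: (finite, finite) finite
  by standard (simp add: UNIV_reg2)

definition row1 :: "real ^ 'p \<Rightarrow> real ^ 'q \<Rightarrow> real ^ ('p, 'q) reg1" where
  "row1 z c = (\<chi> r. case r of Icpt1 \<Rightarrow> 1 | Instr j \<Rightarrow> z $ j | Covar j \<Rightarrow> c $ j)"

definition row2 ::
  "('k1::finite \<Rightarrow> real \<Rightarrow> real) \<Rightarrow> ('k2::finite \<Rightarrow> real ^ 'q \<Rightarrow> real) \<Rightarrow> real \<Rightarrow> real ^ 'q \<Rightarrow> real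
     \<Rightarrow> real ^ ('k1, 'k2) reg2" where
  "row2 f g x c d =
     (\<chi> r. case r of Icpt2 \<Rightarrow> 1 | BasisF j \<Rightarrow> f j x | BasisG j \<Rightarrow> g j c | Resid \<Rightarrow> d)"

definition coeffs2 ::
  "real \<Rightarrow> ('k1::finite \<Rightarrow> real) \<Rightarrow> ('k2::finite \<Rightarrow> real) \<Rightarrow> real \<Rightarrow> real ^ ('k1, 'k2) reg2" where
  "coeffs2 b \<theta> \<gamma> \<rho> =
     (\<chi> r. case r of Icpt2 \<Rightarrow> b | BasisF j \<Rightarrow> \<theta> j | BasisG j \<Rightarrow> \<gamma> j | Resid \<Rightarrow> \<rho>)"

text \<open>
  The regressor matrices computed from observations \<open>z\<close>, \<open>c\<close>, \<open>x\<close> of \<open>Z\<close>, \<open>C\<close>, \<open>X\<close>; \<open>b\<close> is the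
  first-stage coefficient vector, so that the last column of the second one holds the residuals.
\<close>
definition regressors1 ::
  "(nat \<Rightarrow> real ^ 'p) \<Rightarrow> (nat \<Rightarrow> real ^ 'q) \<Rightarrow> nat \<Rightarrow> real ^ ('p, 'q) reg1" where
  "regressors1 z c i = row1 (z i) (c i)"

definition regressors2 ::
  "('k1::finite \<Rightarrow> real \<Rightarrow> real) \<Rightarrow> ('k2::finite \<Rightarrow> real ^ 'q \<Rightarrow> real) \<Rightarrow>
   (nat \<Rightarrow> real ^ 'p) \<Rightarrow> (nat \<Rightarrow> real ^ 'q) \<Rightarrow> (nat \<Rightarrow> real) \<Rightarrow> real ^ ('p, 'q) reg1 \<Rightarrow>
   nat \<Rightarrow> real ^ ('k1, 'k2) reg2" where
  "regressors2 f g z c x b i = row2 f g (x i) (c i) (x i - regressors1 z c i \<bullet> b)"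

text \<open>
  Least squares fits are unique only for regressors of full rank.  A control function estimator
  is any choice of random vectors that solve the two least squares problems, \<open>bhat n\<close> in the
  first and \<open>Bhat n\<close> in the second stage, from the first \<open>n\<close> observations.
\<close>
definition control_function_estimator ::
  "'s measure \<Rightarrow> ('k1::finite \<Rightarrow> real \<Rightarrow> real) \<Rightarrow> ('k2::finite \<Rightarrow> real ^ 'q \<Rightarrow> real) \<Rightarrow>
   (nat \<Rightarrow> 's \<Rightarrow> real ^ 'p) \<Rightarrow> (nat \<Rightarrow> 's \<Rightarrow> real ^ 'q) \<Rightarrow> (nat \<Rightarrow> 's \<Rightarrow> real) \<Rightarrow> (nat \<Rightarrow> 's \<Rightarrow> real) \<Rightarrow>
   (nat \<Rightarrow> 's \<Rightarrow> real ^ ('p, 'q) reg1) \<Rightarrow> (nat \<Rightarrow> 's \<Rightarrow> real ^ ('k1, 'k2) reg2) \<Rightarrow> bool" where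
  "control_function_estimator M f g Zs Cs Xs Ys bhat Bhat \<longleftrightarrow>
     (\<forall>n. bhat n \<in> borel_measurable M \<and> Bhat n \<in> borel_measurable M \<and>
       (\<forall>\<omega>\<in>space M.
          least_squares n (regressors1 (\<lambda>i. Zs i \<omega>) (\<lambda>i. Cs i \<omega>)) (\<lambda>i. Xs i \<omega>) (bhat n \<omega>) \<and>
          least_squares n
            (regressors2 f g (\<lambda>i. Zs i \<omega>) (\<lambda>i. Cs i \<omega>) (\<lambda>i. Xs i \<omega>) (bhat n \<omega>))
            (\<lambda>i. Ys i \<omega>) (Bhat n \<omega>)))"

text \<open>
  The covariance matrix \<open>V\<^bsub>\<beta>\<^esub>\<close> of the first-stage coefficients for the regressor matrix \<open>V\<close> and
  error variance \<open>s1\<close>, and the matrix \<open>D = se I + \<rho>\<^sup>2 V V\<^bsub>\<beta>\<^esub> V\<^sup>T\<close>, where \<open>se\<close> stands for \<open>Var e\<close>.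
\<close>
definition cov1 :: "nat \<Rightarrow> (nat \<Rightarrow> real ^ 'k) \<Rightarrow> real \<Rightarrow> real ^ 'k ^ 'k" where
  "cov1 n V s1 = s1 *\<^sub>R matrix_inv (gram n V)"

definition Dmat :: "nat \<Rightarrow> (nat \<Rightarrow> real ^ 'k) \<Rightarrow> real \<Rightarrow> real \<Rightarrow> real \<Rightarrow> nat \<Rightarrow> nat \<Rightarrow> real" where
  "Dmat n V se \<rho> s1 i j = (if i = j then se else 0) + \<rho>\<^sup>2 * (V i \<bullet> (cov1 n V s1 *v V j))"

end

theory Submission
  imports Defs
begin

text \<open>
  With \<open>\<mu> = E \<delta>\<^sub>1\<close>, \<open>d = \<delta>\<^sub>1 - \<mu>\<close> and \<open>\<eta> = e + \<rho> \<mu>\<close> (which has mean 0), let \<open>v\<close> and \<open>w\<close> be the rows of the two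
  regressor matrices when the residual is replaced by \<open>d\<close>, and let \<open>D\<close> be the error of the first-stage
  coefficients.  The rows actually used in the second stage are \<open>w - (v \<bullet> D) u\<close>, \<open>u\<close> being the unit
  vector of the last coordinate, and their regression errors are \<open>\<eta> + \<rho> (v \<bullet> D)\<close>.  The normal
  equations of both stages therefore give, whenever the Gram matrices are invertible,
  \<open>\<surd>n (B\<^sub>n - B) = G\<^sub>w\<inverse> (b - (G\<^sub>v\<inverse> a \<bullet> m) u + \<rho> H G\<^sub>v\<inverse> a)\<close> with \<open>a = n\<^sup>-\<^sup>1\<^sup>/\<^sup>2 \<Sum> d v\<close>, \<open>b = n\<^sup>-\<^sup>1\<^sup>/\<^sup>2 \<Sum> \<eta> w\<close> and
  sample moments \<open>G\<^sub>v\<close>, \<open>G\<^sub>w\<close>, \<open>H\<close>, \<open>m\<close> of \<open>v v\<^sup>T\<close>, \<open>w w\<^sup>T\<close>, \<open>w v\<^sup>T\<close>, \<open>\<eta> v\<close>, which converge in probability, the last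
  one to 0.  By Slutsky's theorem only the linear part in \<open>(a, b)\<close> matters, and the central limit
  theorem applies to it.  The two parts of the score are uncorrelated because \<open>e\<close> is independent of
  \<open>(Z, C, \<delta>\<^sub>1)\<close> and \<open>\<delta>\<^sub>1\<close> of \<open>(Z, C)\<close>.

  The multivariate central limit theorem follows from the one-dimensional one: characteristic
  functions determine the limit of integrals of trigonometric polynomials, and these approximate
  bounded continuous functions well enough for a tight sequence.
\<close>

section \<open>Convergence in probability and Slutsky's theorem\<close>

text \<open>The model does not center U, so \<open>\<delta>1\<close> may have a mean
  \<open>\<mu>\<close> other than 0. The first-stage intercept then estimates
  \<open>\<beta>X0 + \<mu>\<close> and the residuals estimate \<open>\<delta>1 - \<mu>\<close>.
  Because \<open>\<delta>2\<close> has mean 0, \<open>e\<close> has mean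
  \<open>- \<rho> * \<mu>\<close>; the shift of the control variable compensates exactly this, and
  \<open>\<beta>Y0\<close> stays the second-stage intercept.

  The second-stage rows depend on the whole sample through \<open>bhat\<close>, so sums over them
  are not sums of i.i.d. terms. The residual is affine in the first-stage coefficients, however, so
  each such sum is an exact polynomial in the coefficient error and in moments of the unperturbed
  rows. The error term \<rho> (v \<bullet> D) contributes at the same order as the noise and yields
  the summand of the asymptotic covariance that carries \<rho> squared.

  The estimators are arbitrary minimizers, determined only where the Gram matrices are invertible.
  Formulas for them therefore hold outside events of vanishing probability. \<open>whp\<close> names
  such events explicitly, so that the predicate itself need not be measurable.\<close>

definition whp :: "'s measure \<Rightarrow> (nat \<Rightarrow> 's \<Rightarrow> bool) \<Rightarrow> bool" where
  "whp M Q \<longleftrightarrow> (\<exists>E. (\<forall>n. E n \<in> sets M) \<and> (\<lambda>n. measure M (E n)) \<longlonglongrightarrow> 0 \<and>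
     (\<forall>n. \<forall>\<omega>\<in>space M - E n. Q n \<omega>))"

lemma whp_mono:
  assumes "whp M Q" and "\<And>n \<omega>. \<omega> \<in> space M \<Longrightarrow> Q n \<omega> \<Longrightarrow> R n \<omega>"
  shows "whp M R"
  using assms unfolding whp_def by (metis DiffD1)

lemma whp_eventually:
  assumes "\<And>n \<omega>. n \<ge> N \<Longrightarrow> \<omega> \<in> space M \<Longrightarrow> Q n \<omega>"
  shows "whp M Q"
  unfolding whp_def
proof (intro exI[of _ "\<lambda>n. if n \<ge> N then {} else space M"] conjI allI ballI)
  show "(\<lambda>n. measure M (if n \<ge> N then {} else space M)) \<longlonglongrightarrow> 0"
    by (rule tendsto_eventually) (auto simp: eventually_sequentially)
qed (use assms in \<open>auto split: if_splits\<close>)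

lemma (in finite_measure) whp_conj:
  assumes "whp M Q" "whp M R"
  shows "whp M (\<lambda>n \<omega>. Q n \<omega> \<and> R n \<omega>)"
proof -
  obtain E where E: "\<And>n. E n \<in> sets M" "(\<lambda>n. measure M (E n)) \<longlonglongrightarrow> 0"
     "\<And>n \<omega>. \<omega>\<in>space M - E n \<Longrightarrow> Q n \<omega>" using assms(1) unfolding whp_def by blast
  obtain F where F: "\<And>n. F n \<in> sets M" "(\<lambda>n. measure M (F n)) \<longlonglongrightarrow> 0"
     "\<And>n \<omega>. \<omega>\<in>space M - F n \<Longrightarrow> R n \<omega>" using assms(2) unfolding whp_def by blast
  have "(\<lambda>n. measure M (E n \<union> F n)) \<longlonglongrightarrow> 0"
  proof (rule tendsto_sandwich[OF _ _ tendsto_const])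
    show "(\<lambda>n. measure M (E n) + measure M (F n)) \<longlonglongrightarrow> 0"
      using tendsto_add[OF E(2) F(2)] by simp
    show "\<forall>\<^sub>F n in sequentially. measure M (E n \<union> F n) \<le> measure M (E n) + measure M (F n)"
      by (intro always_eventually allI measure_Un_le E F)
  qed auto
  then show ?thesis unfolding whp_def
    using E F by (intro exI[of _ "\<lambda>n. E n \<union> F n"]) auto
qed

lemma (in finite_measure) whp_finite_ball:
  assumes "finite I" and "\<And>i. i \<in> I \<Longrightarrow> whp M (Q i)"
  shows "whp M (\<lambda>n \<omega>. \<forall>i\<in>I. Q i n \<omega>)"
  using assms
proof (induction I)
  case empty
  show ?case by (rule whp_eventually) auto
next
  case (insert i I)
  then show ?case by (auto intro: whp_mono[OF whp_conj[of "Q i" "\<lambda>n \<omega>. \<forall>i\<in>I. Q i n \<omega>"]])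
qed

lemma (in finite_measure) whp_measure:
  assumes "whp M Q" and "\<And>n. A n \<in> sets M" and "\<And>n \<omega>. \<omega> \<in> A n \<Longrightarrow> \<not> Q n \<omega>"
  shows "(\<lambda>n. measure M (A n)) \<longlonglongrightarrow> 0"
proof -
  obtain E where E: "\<And>n. E n \<in> sets M" "(\<lambda>n. measure M (E n)) \<longlonglongrightarrow> 0"
     "\<And>n \<omega>. \<omega>\<in>space M - E n \<Longrightarrow> Q n \<omega>" using assms(1) unfolding whp_def by blast
  have "A n \<subseteq> E n" for n using E(3) assms(2,3) sets.sets_into_space by blast
  then show ?thesis
    by (intro tendsto_sandwich[OF _ _ tendsto_const E(2)] always_eventually allI
         finite_measure_mono E(1)) auto
qed

lemma conv_in_prob_sets:
  fixes c :: "'a::metric_space"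
  assumes "T \<in> borel_measurable M"
  shows "{\<omega> \<in> space M. dist (T \<omega>) c > \<epsilon>} \<in> sets M"
proof -
  have "open {x. dist x c > \<epsilon>}"
    by (intro open_Collect_less continuous_intros)
  then have "T -` {x. dist x c > \<epsilon>} \<inter> space M \<in> sets M"
    using assms by (intro measurable_sets[OF assms]) auto
  also have "T -` {x. dist x c > \<epsilon>} \<inter> space M = {\<omega> \<in> space M. dist (T \<omega>) c > \<epsilon>}" by auto
  finally show ?thesis .
qed

lemma conv_in_prob_whp:
  assumes "conv_in_prob M T c" and "\<epsilon> > 0"
  shows "whp M (\<lambda>n \<omega>. dist (T n \<omega>) c \<le> \<epsilon>)"
  unfolding whp_def using assms
  by (intro exI[of _ "\<lambda>n. {\<omega> \<in> space M. dist (T n \<omega>) c > \<epsilon>}"])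
     (auto simp: conv_in_prob_def conv_in_prob_sets)

lemma (in finite_measure) conv_in_probI:
  assumes "\<And>n. T n \<in> borel_measurable M" and "\<And>\<epsilon>. \<epsilon> > 0 \<Longrightarrow> whp M (\<lambda>n \<omega>. dist (T n \<omega>) c \<le> \<epsilon>)"
  shows "conv_in_prob M T c"
  unfolding conv_in_prob_def using assms
  by (auto intro!: whp_measure[where Q="\<lambda>n \<omega>. dist (T n \<omega>) c \<le> _"] conv_in_prob_sets)

lemma conv_in_prob_measurable: "conv_in_prob M T c \<Longrightarrow> T n \<in> borel_measurable M"
  by (simp add: conv_in_prob_def)

text \<open>Transfers limits from a closed formula to an estimator that agrees with it only where a
  Gram matrix is invertible.\<close>

lemma (in finite_measure) conv_in_prob_modify:
  assumes "conv_in_prob M T c" and "whp M (\<lambda>n \<omega>. T n \<omega> = S n \<omega>)" and "\<And>n. S n \<in> borel_measurable M"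
  shows "conv_in_prob M S c"
proof (rule conv_in_probI[OF assms(3)])
  fix \<epsilon> :: real assume "\<epsilon> > 0"
  show "whp M (\<lambda>n \<omega>. dist (S n \<omega>) c \<le> \<epsilon>)"
    by (rule whp_mono[OF whp_conj[OF conv_in_prob_whp[OF assms(1) \<open>\<epsilon> > 0\<close>] assms(2)]]) auto
qed

lemma conv_in_prob_nhds:
  assumes "conv_in_prob M T c" and "open S" and "c \<in> S"
  shows "whp M (\<lambda>n \<omega>. T n \<omega> \<in> S)"
proof -
  obtain \<epsilon> where "\<epsilon> > 0" "\<And>y. dist y c < \<epsilon> \<Longrightarrow> y \<in> S" using assms(2,3) unfolding open_dist by blast
  then show ?thesis
    by (intro whp_mono[OF conv_in_prob_whp[OF assms(1), of "\<epsilon>/2"]]) auto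
qed

text \<open>The limit is a constant, so continuity at this single point suffices. Measurability is a
  separate hypothesis because \<open>F\<close> will involve \<open>matrix_inv\<close>, whose
  continuity is known only at invertible matrices.\<close>

lemma (in finite_measure) conv_in_prob_isCont:
  assumes "conv_in_prob M T c" and "isCont F c"
    and "\<And>n. (\<lambda>\<omega>. F (T n \<omega>)) \<in> borel_measurable M"
  shows "conv_in_prob M (\<lambda>n \<omega>. F (T n \<omega>)) (F c)"
proof (rule conv_in_probI[OF assms(3)])
  fix \<epsilon> :: real assume "\<epsilon> > 0"
  then obtain d where d: "d > 0" "\<And>x. dist x c < d \<Longrightarrow> dist (F x) (F c) < \<epsilon>"
    using assms(2) unfolding continuous_at_eps_delta by blast
  show "whp M (\<lambda>n \<omega>. dist (F (T n \<omega>)) (F c) \<le> \<epsilon>)"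
    by (rule whp_mono[OF conv_in_prob_whp[OF assms(1), of "d/2"]]) (use d in \<open>auto intro: less_imp_le\<close>)
qed

lemma (in finite_measure) conv_in_prob_Pair:
  fixes c :: "'c::{metric_space,second_countable_topology}" and d :: "'d::{metric_space,second_countable_topology}"
  assumes "conv_in_prob M T c" and "conv_in_prob M S d"
  shows "conv_in_prob M (\<lambda>n \<omega>. (T n \<omega>, S n \<omega>)) (c, d)"
proof (rule conv_in_probI)
  show "(\<lambda>\<omega>. (T n \<omega>, S n \<omega>)) \<in> borel_measurable M" for n
    using assms[THEN conv_in_prob_measurable] by simp
  fix \<epsilon> :: real assume "\<epsilon> > 0"
  then have e: "\<epsilon>/2 > 0" by simp
  show "whp M (\<lambda>n \<omega>. dist (T n \<omega>, S n \<omega>) (c, d) \<le> \<epsilon>)"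
  proof (rule whp_mono[OF whp_conj[OF assms[THEN conv_in_prob_whp, OF e]]])
    fix n \<omega> assume "dist (T n \<omega>) c \<le> \<epsilon> / 2 \<and> dist (S n \<omega>) d \<le> \<epsilon> / 2"
    moreover have "dist (T n \<omega>, S n \<omega>) (c, d) \<le> dist (T n \<omega>) c + dist (S n \<omega>) d"
      unfolding dist_Pair_Pair by (rule sqrt_sum_squares_le_sum) auto
    ultimately show "dist (T n \<omega>, S n \<omega>) (c, d) \<le> \<epsilon>" by simp
  qed
qed

lemma (in finite_measure) conv_in_prob_euclidean:
  fixes c :: "'c::euclidean_space"
  assumes "\<And>b. b \<in> Basis \<Longrightarrow> conv_in_prob M (\<lambda>n \<omega>. T n \<omega> \<bullet> b) (c \<bullet> b)"
  shows "conv_in_prob M T c"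
proof (rule conv_in_probI)
  show "T n \<in> borel_measurable M" for n
    using assms[THEN conv_in_prob_measurable] by (subst borel_measurable_euclidean_space) auto
  fix \<epsilon> :: real assume "\<epsilon> > 0"
  then have e: "\<epsilon>/DIM('c) > 0" by simp
  show "whp M (\<lambda>n \<omega>. dist (T n \<omega>) c \<le> \<epsilon>)"
  proof (rule whp_mono[OF whp_finite_ball[OF finite_Basis assms[THEN conv_in_prob_whp, OF _ e]]])
    fix n \<omega> assume *: "\<forall>i\<in>Basis. dist (T n \<omega> \<bullet> i) (c \<bullet> i) \<le> \<epsilon> / DIM('c)"
    have "dist (T n \<omega>) c \<le> (\<Sum>i\<in>Basis. \<bar>(T n \<omega> - c) \<bullet> i\<bar>)"
      unfolding dist_norm by (rule norm_le_l1)
    also have "\<dots> \<le> (\<Sum>i\<in>(Basis::'c set). \<epsilon> / DIM('c))"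
      using * by (intro sum_mono) (auto simp: dist_real_def inner_diff_left)
    finally show "dist (T n \<omega>) c \<le> \<epsilon>" by simp
  qed
qed

section \<open>Tightness and Slutsky's theorem\<close>

definition tight_seq :: "'s measure \<Rightarrow> (nat \<Rightarrow> 's \<Rightarrow> 'a::real_normed_vector) \<Rightarrow> bool" where
  "tight_seq M T \<longleftrightarrow> (\<forall>n. T n \<in> borel_measurable M) \<and>
     (\<forall>\<epsilon>>0. \<exists>K. \<forall>n. measure M {\<omega> \<in> space M. norm (T n \<omega>) > K} \<le> \<epsilon>)"

lemma (in finite_measure) tight_seq_second_moment:
  fixes T :: "nat \<Rightarrow> 'a \<Rightarrow> 'b::euclidean_space"
  assumes [measurable]: "\<And>n. T n \<in> borel_measurable M"
    and "\<And>n. integrable M (\<lambda>\<omega>. (norm (T n \<omega>))\<^sup>2)"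
    and "\<And>n. (\<integral>\<omega>. (norm (T n \<omega>))\<^sup>2 \<partial>M) \<le> v"
  shows "tight_seq M T"
  unfolding tight_seq_def
proof (intro conjI allI impI)
  fix \<epsilon> :: real assume e: "\<epsilon> > 0"
  \<comment> \<open>Chosen so that the Chebyshev bound, with v enlarged to |v| + 1, equals
    \<epsilon>; the 1 keeps \<open>K\<close> positive.\<close>
  define K where "K = sqrt ((\<bar>v\<bar> + 1) / \<epsilon>)"
  have K: "K > 0" "K\<^sup>2 = (\<bar>v\<bar> + 1) / \<epsilon>" using e by (auto simp: K_def)
  show "\<exists>K. \<forall>n. measure M {\<omega> \<in> space M. norm (T n \<omega>) > K} \<le> \<epsilon>"
  proof (intro exI allI)
    fix n
    have "measure M {\<omega> \<in> space M. norm (T n \<omega>) > K} \<le> measure M {\<omega> \<in> space M. (norm (T n \<omega>))\<^sup>2 \<ge> K\<^sup>2}"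
      using K(1) by (intro finite_measure_mono) (auto intro!: power_mono)
    also have "\<dots> \<le> (\<integral>\<omega>. (norm (T n \<omega>))\<^sup>2 \<partial>M) / K\<^sup>2"
      by (intro integral_Markov_inequality_measure[where A="{}"] assms(2) zero_less_power K(1)) auto
    also have "\<dots> \<le> (\<bar>v\<bar> + 1) / K\<^sup>2"
      using assms(3)[of n] by (intro divide_right_mono) auto
    also have "\<dots> = \<epsilon>" using K e by (simp add: field_simps)
    finally show "measure M {\<omega> \<in> space M. norm (T n \<omega>) > K} \<le> \<epsilon>" .
  qed
qed auto

text \<open>A tube around \<open>{q} \<times> cball 0 K\<close> makes the continuity of \<open>F\<close> at the points \<open>(q, x)\<close> uniform in \<open>x\<close>.\<close>

lemma (in finite_measure) conv_in_prob_tight: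
  fixes q :: "'q::{metric_space,second_countable_topology}" and A :: "nat \<Rightarrow> 'a \<Rightarrow> 'b::euclidean_space"
    and F :: "'q \<Rightarrow> 'b \<Rightarrow> real"
  assumes Q: "conv_in_prob M Q q" and A: "tight_seq M A"
    and cont: "\<And>x. isCont (\<lambda>p. F (fst p) (snd p)) (q, x)" and zero: "\<And>x. F q x = 0"
    and meas: "\<And>n. (\<lambda>\<omega>. F (Q n \<omega>) (A n \<omega>)) \<in> borel_measurable M"
  shows "conv_in_prob M (\<lambda>n \<omega>. F (Q n \<omega>) (A n \<omega>)) 0"
  unfolding conv_in_prob_def
proof (intro conjI allI impI)
  fix \<epsilon> :: real assume "\<epsilon> > 0"
  \<comment> \<open>The set itself need not be open, because \<open>F\<close> is continuous only at
    the points (q, x); the tube needs an open set.\<close>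
  define W where "W = interior {p. \<bar>F (fst p) (snd p)\<bar> < \<epsilon>}"
  have W: "(q, x) \<in> W" for x
  proof -
    obtain S where S: "open S" "(q, x) \<in> S" "\<And>p. p \<in> S \<Longrightarrow> F (fst p) (snd p) \<in> ball 0 \<epsilon>"
      using cont[of x] zero[of x] \<open>\<epsilon> > 0\<close> unfolding continuous_at_open
      by (metis centre_in_ball fst_conv open_ball snd_conv)
    have "S \<subseteq> W" unfolding W_def by (rule interior_maximal) (use S in auto)
    then show ?thesis using S by auto
  qed
  show "(\<lambda>n. measure M {\<omega> \<in> space M. dist (F (Q n \<omega>) (A n \<omega>)) 0 > \<epsilon>}) \<longlonglongrightarrow> 0"
  proof (rule LIMSEQ_I)
    fix r :: real assume "r > 0"
    then obtain K where K: "\<And>n. measure M {\<omega> \<in> space M. norm (A n \<omega>) > K} \<le> r / 2"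
      using A unfolding tight_seq_def by (meson half_gt_zero)
    obtain X where X: "q \<in> X" "open X" "X \<times> cball 0 K \<subseteq> W"
      using Elementary_Topology.tube_lemma[of "cball 0 K" W q] W unfolding W_def by auto
    obtain E where E: "\<And>n. E n \<in> sets M" "(\<lambda>n. measure M (E n)) \<longlonglongrightarrow> 0"
     "\<And>n \<omega>. \<omega>\<in>space M - E n \<Longrightarrow> Q n \<omega> \<in> X" using conv_in_prob_nhds[OF Q X(2,1)] unfolding whp_def by blast
    have [measurable]: "A n \<in> borel_measurable M" for n using A by (auto simp: tight_seq_def)
    \<comment> \<open>A large value of \<open>F\<close> requires \<open>Q n\<close> to leave the
      base of the tube or \<open>A n\<close> to leave the compact ball.\<close>
    have sub: "{\<omega> \<in> space M. dist (F (Q n \<omega>) (A n \<omega>)) 0 > \<epsilon>} \<subseteq> E n \<union> {\<omega> \<in> space M. norm (A n \<omega>) > K}" for n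
    proof
      fix \<omega> assume *: "\<omega> \<in> {\<omega> \<in> space M. dist (F (Q n \<omega>) (A n \<omega>)) 0 > \<epsilon>}"
      have False if "\<omega> \<notin> E n" "norm (A n \<omega>) \<le> K"
      proof -
        have "(Q n \<omega>, A n \<omega>) \<in> W" using X(3) E(3)[of \<omega> n] that * by auto
        then have "\<bar>F (Q n \<omega>) (A n \<omega>)\<bar> < \<epsilon>" unfolding W_def using interior_subset by fastforce
        then show False using * by simp
      qed
      then show "\<omega> \<in> E n \<union> {\<omega> \<in> space M. norm (A n \<omega>) > K}" using * by fastforce
    qed
    obtain N where N: "\<And>n. n \<ge> N \<Longrightarrow> measure M (E n) < r/2"
      using LIMSEQ_D[OF E(2), of "r/2"] \<open>r > 0\<close> by auto
    show "\<exists>N. \<forall>n\<ge>N. norm (measure M {\<omega> \<in> space M. dist (F (Q n \<omega>) (A n \<omega>)) 0 > \<epsilon>} - 0) < r"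
    proof (intro exI allI impI)
      fix n assume "n \<ge> N"
      have "measure M {\<omega> \<in> space M. dist (F (Q n \<omega>) (A n \<omega>)) 0 > \<epsilon>} \<le> measure M (E n \<union> {\<omega> \<in> space M. norm (A n \<omega>) > K})"
        by (rule finite_measure_mono[OF sub]) (use E in auto)
      also have "\<dots> \<le> measure M (E n) + measure M {\<omega> \<in> space M. norm (A n \<omega>) > K}"
        by (rule measure_Un_le) (use E in auto)
      also have "\<dots> < r" using N[OF \<open>n \<ge> N\<close>] K[of n] by simp
      finally show "norm (measure M {\<omega> \<in> space M. dist (F (Q n \<omega>) (A n \<omega>)) 0 > \<epsilon>} - 0) < r" by simp
    qed
  qed
qed (rule meas)

lemma (in prob_space) conv_in_prob_bounded_integral:
  fixes T :: "nat \<Rightarrow> 'a \<Rightarrow> real"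
  assumes T: "conv_in_prob M T 0" and B: "\<And>n \<omega>. \<bar>T n \<omega>\<bar> \<le> B"
  shows "(\<lambda>n. \<integral>\<omega>. T n \<omega> \<partial>M) \<longlonglongrightarrow> 0"
proof (rule LIMSEQ_I)
  fix r :: real assume "r > 0"
  have [measurable]: "T n \<in> borel_measurable M" for n using T by (rule conv_in_prob_measurable)
  have "B \<ge> 0" using B[of 0 undefined] by simp
  define A where "A n = {\<omega> \<in> space M. dist (T n \<omega>) 0 > r/3}" for n
  have Am [measurable]: "A n \<in> sets M" for n unfolding A_def by (rule conv_in_prob_sets) simp
  have int: "integrable M (T n)" for n by (rule integrable_const_bound[where B=B]) (use B in auto)
  have ind: "integrable M (indicator (A n) :: 'a \<Rightarrow> real)" for n
    by (rule integrable_real_indicator) (auto simp: less_top[symmetric])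
  have "(\<lambda>n. measure M (A n)) \<longlonglongrightarrow> 0"
    using T[unfolded conv_in_prob_def, THEN conjunct2, rule_format, of "r/3"] \<open>r > 0\<close>
    unfolding A_def by linarith
  \<comment> \<open>Off \<open>A n\<close> the integrand is at most r/3, and on it at most
    \<open>B\<close>, which contributes at most another r/3. Using B + 1 avoids dividing by
    zero.\<close>
  moreover have "r / (3 * (B + 1)) > 0" using \<open>r > 0\<close> \<open>B \<ge> 0\<close> by simp
  ultimately obtain N where N: "\<And>n. n \<ge> N \<Longrightarrow> measure M (A n) < r / (3 * (B + 1))"
    using LIMSEQ_D[of "\<lambda>n. measure M (A n)" 0 "r / (3 * (B + 1))"] by auto
  show "\<exists>N. \<forall>n\<ge>N. norm ((\<integral>\<omega>. T n \<omega> \<partial>M) - 0) < r"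
  proof (intro exI allI impI)
    fix n assume "n \<ge> N"
    have "norm (\<integral>\<omega>. T n \<omega> \<partial>M) \<le> (\<integral>\<omega>. norm (T n \<omega>) \<partial>M)" by (rule integral_norm_bound)
    also have "\<dots> \<le> (\<integral>\<omega>. r / 3 + B * indicator (A n) \<omega> \<partial>M)"
    proof (rule integral_mono)
      fix \<omega> assume "\<omega> \<in> space M"
      then show "norm (T n \<omega>) \<le> r / 3 + B * indicator (A n) \<omega>"
        using B[of n \<omega>] \<open>r > 0\<close> by (auto simp: A_def indicator_def)
    qed (use int ind in auto)
    also have "\<dots> = r / 3 + B * measure M (A n)"
      using ind by (subst Bochner_Integration.integral_add) (auto simp: prob_space)
    also have "B * measure M (A n) \<le> (B + 1) * (r / (3 * (B + 1)))"
      using N[OF \<open>n \<ge> N\<close>] \<open>B \<ge> 0\<close> by (intro mult_mono) auto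
    also have "\<dots> = r / 3" using \<open>B \<ge> 0\<close> by (simp add: field_simps)
    finally show "norm ((\<integral>\<omega>. T n \<omega> \<partial>M) - 0) < r" using \<open>r > 0\<close> by simp
  qed
qed

text \<open>For a bounded continuous test function the values at \<Psi> (Q n) (A n) and at \<Psi> q
  (A n) have a bounded difference that tends to 0 in probability, hence in mean. \<open>A\<close> is
  only asked to be tight, so no joint limit law of the scores is involved.\<close>

lemma (in prob_space) conv_in_distr_Slutsky:
  fixes q :: "'q::{metric_space,second_countable_topology}" and A :: "nat \<Rightarrow> 'a \<Rightarrow> 'b::euclidean_space"
    and \<Psi> :: "'q \<Rightarrow> 'b \<Rightarrow> 'c::{metric_space,second_countable_topology}"
  assumes Q: "conv_in_prob M Q q" and A: "tight_seq M A"
    and cont: "\<And>x. isCont (\<lambda>p. \<Psi> (fst p) (snd p)) (q, x)"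
    and meas: "\<And>n. (\<lambda>\<omega>. \<Psi> (Q n \<omega>) (A n \<omega>)) \<in> borel_measurable M"
    and conv: "conv_in_distr M (\<lambda>n \<omega>. \<Psi> q (A n \<omega>)) N"
    and T: "\<And>n. T n \<in> borel_measurable M" "whp M (\<lambda>n \<omega>. T n \<omega> = \<Psi> (Q n \<omega>) (A n \<omega>))"
  shows "conv_in_distr M T N"
  unfolding conv_in_distr_def
proof (intro conjI allI impI T(1))
  show "prob_space N" "sets N = sets borel" using conv by (auto simp: conv_in_distr_def)
next
  fix \<phi> :: "'c \<Rightarrow> real" assume phi: "continuous_on UNIV \<phi> \<and> bounded (range \<phi>)"
  then obtain B where B: "\<And>x. \<bar>\<phi> x\<bar> \<le> B" unfolding bounded_iff by auto
  have pm [measurable]: "\<phi> \<in> borel_measurable borel" using phi by (simp add: borel_measurable_continuous_onI)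
  have pc: "isCont \<phi> x" for x using phi by (simp add: continuous_on_eq_continuous_at)
  have qm [measurable]: "(\<lambda>\<omega>. \<Psi> q (A n \<omega>)) \<in> borel_measurable M" for n
    using conv by (simp add: conv_in_distr_def)
  note [measurable] = meas T(1)
  have Psi_q: "isCont (\<lambda>p. \<Psi> q (snd p)) (q, x)" for x
  proof -
    have "isCont (\<lambda>p. \<Psi> (fst (q, snd p)) (snd (q, snd p))) (q, x)" for x :: 'b
      by (rule isCont_o2[where g="\<lambda>p. \<Psi> (fst p) (snd p)"]) (auto intro!: continuous_intros cont)
    then show ?thesis by simp
  qed
  have "conv_in_prob M (\<lambda>n \<omega>. \<phi> (\<Psi> (Q n \<omega>) (A n \<omega>)) - \<phi> (\<Psi> q (A n \<omega>))) 0"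
  proof (rule conv_in_prob_tight[OF Q A])
    show "isCont (\<lambda>p. \<phi> (\<Psi> (fst p) (snd p)) - \<phi> (\<Psi> q (snd p))) (q, x)" for x
      by (intro continuous_diff isCont_o2[OF cont pc] isCont_o2[OF Psi_q pc])
  qed auto
  then have "conv_in_prob M (\<lambda>n \<omega>. \<phi> (T n \<omega>) - \<phi> (\<Psi> q (A n \<omega>))) 0"
    by (rule conv_in_prob_modify) (auto intro: whp_mono[OF T(2)])
  moreover have "\<bar>\<phi> (T n \<omega>) - \<phi> (\<Psi> q (A n \<omega>))\<bar> \<le> 2 * B" for n \<omega>
    using B[of "T n \<omega>"] B[of "\<Psi> q (A n \<omega>)"] by (auto simp: abs_le_iff)
  ultimately have "(\<lambda>n. \<integral>\<omega>. \<phi> (T n \<omega>) - \<phi> (\<Psi> q (A n \<omega>)) \<partial>M) \<longlonglongrightarrow> 0"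
    by (rule conv_in_prob_bounded_integral)
  moreover have "(\<integral>\<omega>. \<phi> (T n \<omega>) - \<phi> (\<Psi> q (A n \<omega>)) \<partial>M)
      = (\<integral>\<omega>. \<phi> (T n \<omega>) \<partial>M) - (\<integral>\<omega>. \<phi> (\<Psi> q (A n \<omega>)) \<partial>M)" for n
    by (intro Bochner_Integration.integral_diff integrable_const_bound[where B=B]) (auto simp: B)
  moreover have "(\<lambda>n. \<integral>\<omega>. \<phi> (\<Psi> q (A n \<omega>)) \<partial>M) \<longlonglongrightarrow> (\<integral>x. \<phi> x \<partial>N)"
    using conv phi by (simp add: conv_in_distr_def)
  ultimately show "(\<lambda>n. \<integral>\<omega>. \<phi> (T n \<omega>) \<partial>M) \<longlonglongrightarrow> (\<integral>x. \<phi> x \<partial>N)"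
    using tendsto_add by fastforce
qed

section \<open>Weak law of large numbers\<close>

lemma iid_copies_measurable:
  assumes "prob_space M" and "iid_copies M S P T"
  shows "S i \<in> borel_measurable M"
  using assms(2) unfolding iid_copies_def prob_space.indep_vars_def2[OF assms(1)] by blast

lemma iid_copies_integral:
  fixes \<psi> :: "_ \<Rightarrow> 'b::{banach,second_countable_topology}"
  assumes "prob_space M" and "iid_copies M S P T" and "T \<in> borel_measurable P" and "\<psi> \<in> borel_measurable borel"
  shows "(\<integral>\<omega>. \<psi> (S i \<omega>) \<partial>M) = (\<integral>\<omega>. \<psi> (T \<omega>) \<partial>P)"
    and "integrable M (\<lambda>\<omega>. \<psi> (S i \<omega>)) \<longleftrightarrow> integrable P (\<lambda>\<omega>. \<psi> (T \<omega>))"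
proof -
  note m = iid_copies_measurable[OF assms(1,2), of i]
  have d: "distr M borel (S i) = distr P borel T" using assms(2) by (simp add: iid_copies_def)
  have "(\<integral>\<omega>. \<psi> (S i \<omega>) \<partial>M) = (\<integral>x. \<psi> x \<partial>distr M borel (S i))"
    by (rule integral_distr[symmetric]) (use m assms in auto)
  also have "\<dots> = (\<integral>\<omega>. \<psi> (T \<omega>) \<partial>P)" unfolding d
    by (rule integral_distr) (use m assms in auto)
  finally show "(\<integral>\<omega>. \<psi> (S i \<omega>) \<partial>M) = (\<integral>\<omega>. \<psi> (T \<omega>) \<partial>P)" .
  show "integrable M (\<lambda>\<omega>. \<psi> (S i \<omega>)) \<longleftrightarrow> integrable P (\<lambda>\<omega>. \<psi> (T \<omega>))"
    using integrable_distr_eq[of "S i" M borel \<psi>] integrable_distr_eq[of T P borel \<psi>] m assms d by simp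
qed

lemma iid_copies_compose:
  assumes "prob_space M" and iid: "iid_copies M S P T" and "T \<in> borel_measurable P" and "\<psi> \<in> borel_measurable borel"
  shows "iid_copies M (\<lambda>i \<omega>. \<psi> (S i \<omega>)) P (\<lambda>\<omega>. \<psi> (T \<omega>))"
proof -
  have "distr M borel (\<lambda>\<omega>. \<psi> (S i \<omega>)) = distr P borel (\<lambda>\<omega>. \<psi> (T \<omega>))" for i
    using distr_distr[of \<psi> borel borel "S i" M] distr_distr[of \<psi> borel borel T P]
      iid_copies_measurable[OF assms(1,2)] assms by (simp add: iid_copies_def comp_def)
  moreover have "prob_space.indep_vars M (\<lambda>_. borel) (\<lambda>i \<omega>. \<psi> (S i \<omega>)) UNIV"
    using iid assms(4) by (auto simp: iid_copies_def intro: prob_space.indep_vars_compose2[OF assms(1)])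
  ultimately show ?thesis by (simp add: iid_copies_def)
qed

lemma square_integrable_mult:
  fixes f g :: "'a \<Rightarrow> real"
  assumes [measurable]: "f \<in> borel_measurable M" "g \<in> borel_measurable M"
    and "integrable M (\<lambda>x. (f x)\<^sup>2)" "integrable M (\<lambda>x. (g x)\<^sup>2)"
  shows "integrable M (\<lambda>x. f x * g x)"
proof (rule Bochner_Integration.integrable_bound[where f="\<lambda>x. (f x)\<^sup>2 + (g x)\<^sup>2"])
  show "AE x in M. norm (f x * g x) \<le> norm ((f x)\<^sup>2 + (g x)\<^sup>2)"
  proof (rule AE_I2)
    fix x
    have "2 * \<bar>f x\<bar> * \<bar>g x\<bar> \<le> (f x)\<^sup>2 + (g x)\<^sup>2" using sum_squares_bound[of "\<bar>f x\<bar>" "\<bar>g x\<bar>"] by simp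
    moreover have "0 \<le> \<bar>f x\<bar> * \<bar>g x\<bar>" by simp
    ultimately have "\<bar>f x\<bar> * \<bar>g x\<bar> \<le> (f x)\<^sup>2 + (g x)\<^sup>2" by linarith
    then show "norm (f x * g x) \<le> norm ((f x)\<^sup>2 + (g x)\<^sup>2)" by (simp add: abs_mult)
  qed
qed (use assms in auto)

lemma square_integrable_inner:
  fixes f :: "'a \<Rightarrow> 'b::euclidean_space"
  assumes [measurable]: "f \<in> borel_measurable M" and sq: "integrable M (\<lambda>x. (norm (f x))\<^sup>2)"
  shows "integrable M (\<lambda>x. (f x \<bullet> a)\<^sup>2)"
proof (rule Bochner_Integration.integrable_bound[OF integrable_mult_left[OF sq, of "(norm a)\<^sup>2"]])
  show "AE x in M. norm ((f x \<bullet> a)\<^sup>2) \<le> norm ((norm (f x))\<^sup>2 * (norm a)\<^sup>2)"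
    using power_mono[OF Cauchy_Schwarz_ineq2 abs_ge_zero, where n=2]
    by (intro AE_I2) (simp add: power_mult_distrib)
qed measurable

lemma (in prob_space) square_norm_integrable_imp_integrable:
  fixes f :: "'a \<Rightarrow> 'b::euclidean_space"
  assumes "f \<in> borel_measurable M" and "integrable M (\<lambda>x. (norm (f x))\<^sup>2)"
  shows "integrable M f"
  using square_integrable_imp_integrable[of "\<lambda>x. norm (f x)"] assms by (auto intro: integrable_norm_cancel)

lemma iid_copies_uncorrelated:
  fixes T :: "'w \<Rightarrow> real"
  assumes "prob_space M" and iid: "iid_copies M S P T" and "T \<in> borel_measurable P"
    and "integrable P T" and "(\<integral>\<omega>. T \<omega> \<partial>P) = 0" and "i \<noteq> j"
  shows "(\<integral>\<omega>. S i \<omega> * S j \<omega> \<partial>M) = 0"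
proof -
  interpret prob_space M by fact
  have int: "integrable M (S k)" "(\<integral>\<omega>. S k \<omega> \<partial>M) = 0" for k
    using iid_copies_integral[OF assms(1-3), of "\<lambda>x. x" k] assms by auto
  have "indep_vars (\<lambda>_. borel) S {i, j}"
    using iid unfolding iid_copies_def by (auto intro: indep_vars_subset)
  then have "(\<integral>\<omega>. (\<Prod>k\<in>{i, j}. S k \<omega>) \<partial>M) = (\<Prod>k\<in>{i, j}. \<integral>\<omega>. S k \<omega> \<partial>M)"
    by (intro indep_vars_lebesgue_integral) (auto simp: int)
  then show ?thesis using \<open>i \<noteq> j\<close> by (simp add: int)
qed

text \<open>The off-diagonal terms of the squared sum have mean 0. The resulting linear growth
  drives both the weak law and the tightness of normalized sums.\<close>

lemma iid_copies_sum_square: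
  fixes T :: "'w \<Rightarrow> real"
  assumes "prob_space M" and iid: "iid_copies M S P T" and T: "T \<in> borel_measurable P"
    and "prob_space P" and sq: "integrable P (\<lambda>\<omega>. (T \<omega>)\<^sup>2)" and mean: "(\<integral>\<omega>. T \<omega> \<partial>P) = 0"
  shows "integrable M (\<lambda>\<omega>. (\<Sum>i<n. S i \<omega>)\<^sup>2)"
    and "(\<integral>\<omega>. (\<Sum>i<n. S i \<omega>)\<^sup>2 \<partial>M) = real n * (\<integral>\<omega>. (T \<omega>)\<^sup>2 \<partial>P)"
proof -
  interpret P: prob_space P by fact
  interpret prob_space M by fact
  have intT: "integrable P T" by (rule P.square_integrable_imp_integrable[OF T sq])
  note m [measurable] = iid_copies_measurable[OF assms(1,2)]
  have sqS: "integrable M (\<lambda>\<omega>. (S i \<omega>)\<^sup>2)" "(\<integral>\<omega>. (S i \<omega>)\<^sup>2 \<partial>M) = (\<integral>\<omega>. (T \<omega>)\<^sup>2 \<partial>P)" for i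
    using iid_copies_integral[OF assms(1-3), of "\<lambda>x. x\<^sup>2" i] sq by auto
  have prod: "integrable M (\<lambda>\<omega>. S i \<omega> * S j \<omega>)" for i j
    by (rule square_integrable_mult[OF m m sqS(1) sqS(1)])
  have eq: "(\<Sum>i<n. S i \<omega>)\<^sup>2 = (\<Sum>i<n. \<Sum>j<n. S i \<omega> * S j \<omega>)" for \<omega>
    by (simp add: power2_eq_square sum_product)
  show "integrable M (\<lambda>\<omega>. (\<Sum>i<n. S i \<omega>)\<^sup>2)"
    unfolding eq by (intro Bochner_Integration.integrable_sum prod)
  have "(\<integral>\<omega>. (\<Sum>i<n. S i \<omega>)\<^sup>2 \<partial>M) = (\<Sum>i<n. \<Sum>j<n. \<integral>\<omega>. S i \<omega> * S j \<omega> \<partial>M)"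
    unfolding eq by (simp add: prod)
  also have "\<dots> = (\<Sum>i<n. \<Sum>j<n. if i = j then (\<integral>\<omega>. (T \<omega>)\<^sup>2 \<partial>P) else 0)"
    using iid_copies_uncorrelated[OF assms(1-3) intT mean] sqS(2)
    by (intro sum.cong refl) (auto simp: power2_eq_square)
  also have "\<dots> = real n * (\<integral>\<omega>. (T \<omega>)\<^sup>2 \<partial>P)"
    by (simp add: sum.delta)
  finally show "(\<integral>\<omega>. (\<Sum>i<n. S i \<omega>)\<^sup>2 \<partial>M) = real n * (\<integral>\<omega>. (T \<omega>)\<^sup>2 \<partial>P)" .
qed

text \<open>Khinchin's weak law: truncate the summands at a level \<open>K\<close> and use second moments for the bounded part.\<close>

lemma weak_law_of_large_numbers:
  fixes T :: "'w \<Rightarrow> real"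
  assumes M: "prob_space M" and iid: "iid_copies M S P T" and P: "prob_space P" and int: "integrable P T"
  shows "conv_in_prob M (\<lambda>n \<omega>. (1 / real n) * (\<Sum>i<n. S i \<omega>)) (\<integral>\<omega>. T \<omega> \<partial>P)"
proof -
  interpret P: prob_space P by fact
  interpret prob_space M by fact
  have T [measurable]: "T \<in> borel_measurable P" using int by auto
  note m [measurable] = iid_copies_measurable[OF M iid]
  define \<mu> where "\<mu> = (\<integral>\<omega>. T \<omega> \<partial>P)"
  define t where "t K x = (if \<bar>x\<bar> \<le> real K then x else 0)" for K x
  have tm [measurable]: "t K \<in> borel_measurable borel" for K unfolding t_def by measurable
  have tb: "\<bar>t K x\<bar> \<le> real K" for K x unfolding t_def by auto
  have tb': "\<bar>t K x\<bar> \<le> \<bar>x\<bar>" for K x unfolding t_def by auto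
  have intt: "integrable P (\<lambda>\<omega>. t K (T \<omega>))" for K
    by (rule P.integrable_const_bound[where B="real K"]) (use tb in auto)
  have lim: "(\<lambda>K. \<integral>\<omega>. \<bar>T \<omega> - t K (T \<omega>)\<bar> \<partial>P) \<longlonglongrightarrow> (\<integral>\<omega>. 0 \<partial>P)"
  proof (rule integral_dominated_convergence[where w="\<lambda>\<omega>. \<bar>T \<omega>\<bar>"])
    show "AE \<omega> in P. (\<lambda>K. \<bar>T \<omega> - t K (T \<omega>)\<bar>) \<longlonglongrightarrow> 0"
    proof (rule AE_I2, rule tendsto_eventually)
      fix \<omega>
      show "\<forall>\<^sub>F K in sequentially. \<bar>T \<omega> - t K (T \<omega>)\<bar> = 0"
        using eventually_ge_at_top[of "nat \<lceil>\<bar>T \<omega>\<bar>\<rceil>"]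
        by eventually_elim (auto simp: t_def)
    qed
    show "AE \<omega> in P. norm \<bar>T \<omega> - t K (T \<omega>)\<bar> \<le> \<bar>T \<omega>\<bar>" for K by (auto simp: t_def)
  qed (use int in auto)
  show ?thesis unfolding conv_in_prob_def \<mu>_def[symmetric]
  proof (intro conjI allI impI)
    fix \<epsilon> :: real assume e: "\<epsilon> > 0"
    let ?A = "\<lambda>n. {\<omega> \<in> space M. dist (1 / real n * (\<Sum>i<n. S i \<omega>)) \<mu> > \<epsilon>}"
    show "(\<lambda>n. measure M (?A n)) \<longlonglongrightarrow> 0"
    proof (rule LIMSEQ_I)
      fix r :: real assume r: "r > 0"
      \<comment> \<open>The first bound keeps the bias of the truncated mean below \<epsilon>/3; the
        second makes Markov's bound 3 \<tau> / \<epsilon> for the remainders at most r/2.\<close>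
      obtain K where K: "(\<integral>\<omega>. \<bar>T \<omega> - t K (T \<omega>)\<bar> \<partial>P) < min (\<epsilon> / 3) (\<epsilon> * r / 6)"
        using LIMSEQ_D[OF lim, of "min (\<epsilon> / 3) (\<epsilon> * r / 6)"] e r by auto
      define \<tau> where "\<tau> = (\<integral>\<omega>. \<bar>T \<omega> - t K (T \<omega>)\<bar> \<partial>P)"
      define c where "c = (\<integral>\<omega>. t K (T \<omega>) \<partial>P)"
      define L where "L \<omega> = t K (T \<omega>) - c" for \<omega>
      define Ls where "Ls i \<omega> = t K (S i \<omega>) - c" for i \<omega>
      define Rs where "Rs i \<omega> = \<bar>S i \<omega> - t K (S i \<omega>)\<bar>" for i \<omega>
      have Lm [measurable]: "L \<in> borel_measurable P" unfolding L_def by measurable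
      have iL: "iid_copies M Ls P L"
        using iid_copies_compose[OF M iid T, of "\<lambda>x. t K x - c"] by (simp add: Ls_def[abs_def] L_def[abs_def])
      have [measurable]: "Ls i \<in> borel_measurable M" "Rs i \<in> borel_measurable M" for i
        unfolding Ls_def Rs_def by measurable
      have Lint: "(\<integral>\<omega>. L \<omega> \<partial>P) = 0" unfolding L_def c_def using intt by (simp add: P.prob_space)
      have L2: "integrable P (\<lambda>\<omega>. (L \<omega>)\<^sup>2)"
      proof (rule P.integrable_const_bound[where B="(real K + \<bar>c\<bar>)\<^sup>2"], rule AE_I2)
        fix \<omega>
        have "\<bar>L \<omega>\<bar> \<le> real K + \<bar>c\<bar>" unfolding L_def using tb[of K "T \<omega>"] by linarith
        then show "norm ((L \<omega>)\<^sup>2) \<le> (real K + \<bar>c\<bar>)\<^sup>2"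
          using power_mono[of "\<bar>L \<omega>\<bar>" "real K + \<bar>c\<bar>" 2] by simp
      qed measurable
      define v where "v = (\<integral>\<omega>. (L \<omega>)\<^sup>2 \<partial>P)"
      note sumL = iid_copies_sum_square[OF M iL Lm P L2 Lint]
      have intR: "integrable M (Rs i)" "(\<integral>\<omega>. Rs i \<omega> \<partial>M) = \<tau>" for i
        using iid_copies_integral[OF M iid T, of "\<lambda>x. \<bar>x - t K x\<bar>" i] int intt
        unfolding Rs_def[abs_def] \<tau>_def by auto
      have "\<mu> - c = (\<integral>\<omega>. T \<omega> - t K (T \<omega>) \<partial>P)" unfolding \<mu>_def c_def using int intt by simp
      then have mc: "\<bar>\<mu> - c\<bar> \<le> \<tau>" unfolding \<tau>_def
        using integral_norm_bound[of P "\<lambda>\<omega>. T \<omega> - t K (T \<omega>)"] by simp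
      have tau: "\<tau> < \<epsilon> / 3" "\<tau> < \<epsilon> * r / 6" using K unfolding \<tau>_def by auto
      \<comment> \<open>Both sums are tested at the level n \<epsilon> / 3: Chebyshev for the
        centered truncated part gives the first summand, Markov for the remainders the
        second.\<close>
      have bound: "measure M (?A n)
          \<le> 9 * v / \<epsilon>\<^sup>2 / real n + r / 2" if n: "n > 0" for n
      proof -
        define A1 where "A1 = {\<omega> \<in> space M. (\<Sum>i<n. Ls i \<omega>)\<^sup>2 \<ge> (real n * \<epsilon> / 3)\<^sup>2}"
        define A2 where "A2 = {\<omega> \<in> space M. (\<Sum>i<n. Rs i \<omega>) \<ge> real n * \<epsilon> / 3}"
        have [measurable]: "A1 \<in> sets M" "A2 \<in> sets M" unfolding A1_def A2_def by measurable
        have "?A n \<subseteq> A1 \<union> A2"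
        proof (rule subsetI, rule ccontr)
          fix \<omega> assume 1: "\<omega> \<in> ?A n" and 2: "\<omega> \<notin> A1 \<union> A2"
          have a: "\<bar>\<Sum>i<n. Ls i \<omega>\<bar> < real n * \<epsilon> / 3"
          proof (rule ccontr)
            assume "\<not> \<bar>\<Sum>i<n. Ls i \<omega>\<bar> < real n * \<epsilon> / 3"
            then have "(real n * \<epsilon> / 3)\<^sup>2 \<le> \<bar>\<Sum>i<n. Ls i \<omega>\<bar>\<^sup>2" using e by (intro power_mono) auto
            then show False using 1 2 unfolding A1_def by simp
          qed
          have b: "(\<Sum>i<n. Rs i \<omega>) < real n * \<epsilon> / 3" using 1 2 unfolding A2_def by auto
          have "\<bar>\<Sum>i<n. S i \<omega> - t K (S i \<omega>)\<bar> \<le> (\<Sum>i<n. Rs i \<omega>)"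
            unfolding Rs_def by (rule sum_abs)
          \<comment> \<open>Truncated part, remainders and bias, each at most n \<epsilon> / 3 in
            absolute value.\<close>
          moreover have "(\<Sum>i<n. S i \<omega>) - real n * \<mu>
              = (\<Sum>i<n. Ls i \<omega>) + (\<Sum>i<n. S i \<omega> - t K (S i \<omega>)) + real n * (c - \<mu>)"
            unfolding Ls_def by (simp add: sum_subtractf algebra_simps)
          moreover have "\<bar>real n * (c - \<mu>)\<bar> \<le> real n * (\<epsilon> / 3)"
            unfolding abs_mult using mc tau(1) by (intro mult_mono) (auto simp: abs_minus_commute)
          ultimately have "\<bar>(\<Sum>i<n. S i \<omega>) - real n * \<mu>\<bar> \<le> real n * \<epsilon>" using a b by linarith
          moreover have "real n * (1 / real n * (\<Sum>i<n. S i \<omega>) - \<mu>) = (\<Sum>i<n. S i \<omega>) - real n * \<mu>"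
            using n by (simp add: field_simps)
          then have "real n * dist (1 / real n * (\<Sum>i<n. S i \<omega>)) \<mu> = \<bar>(\<Sum>i<n. S i \<omega>) - real n * \<mu>\<bar>"
            by (metis abs_mult abs_of_nat dist_real_def)
          ultimately have "real n * dist (1 / real n * (\<Sum>i<n. S i \<omega>)) \<mu> \<le> real n * \<epsilon>" by simp
          then have "dist (1 / real n * (\<Sum>i<n. S i \<omega>)) \<mu> \<le> \<epsilon>" by (rule mult_left_le_imp_le) (use n in simp)
          then show False using 1 by simp
        qed
        then have "measure M (?A n) \<le> measure M (A1 \<union> A2)"
          by (rule finite_measure_mono) measurable
        also have "\<dots> \<le> measure M A1 + measure M A2" by (rule measure_Un_le) measurable
        also have "measure M A1 \<le> (\<integral>\<omega>. (\<Sum>i<n. Ls i \<omega>)\<^sup>2 \<partial>M) / (real n * \<epsilon> / 3)\<^sup>2"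
          unfolding A1_def using n e
          by (intro integral_Markov_inequality_measure[where A="{}"] sumL(1) zero_less_power) auto
        also have "\<dots> = 9 * v / \<epsilon>\<^sup>2 / real n"
          unfolding sumL(2) v_def[symmetric] using n e by (simp add: field_simps power2_eq_square)
        also have "measure M A2 \<le> (\<integral>\<omega>. (\<Sum>i<n. Rs i \<omega>) \<partial>M) / (real n * \<epsilon> / 3)"
          unfolding A2_def using n e
          by (intro integral_Markov_inequality_measure[where A="{}"] Bochner_Integration.integrable_sum intR(1))
             (auto simp: Rs_def intro!: sum_nonneg)
        also have "\<dots> = 3 * \<tau> / \<epsilon>" using n intR by (simp add: field_simps)
        also have "\<dots> \<le> r / 2" using tau(2) e by (simp add: field_simps)
        finally show ?thesis by simp
      qed
      have "(\<lambda>n. 9 * v / \<epsilon>\<^sup>2 / real n) \<longlonglongrightarrow> 0" by (rule lim_const_over_n)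
      then obtain N where N: "\<And>n. n \<ge> N \<Longrightarrow> \<bar>9 * v / \<epsilon>\<^sup>2 / real n\<bar> < r / 2"
        using LIMSEQ_D[of "\<lambda>n. 9 * v / \<epsilon>\<^sup>2 / real n" 0 "r / 2"] r by auto
      show "\<exists>N. \<forall>n\<ge>N. norm (measure M (?A n) - 0) < r"
      \<comment> \<open>\<open>bound\<close> divides by \<open>n\<close>, so the empty sample is
        excluded.\<close>
      proof (intro exI[of _ "max 1 N"] allI impI)
        fix n assume n: "n \<ge> max 1 N"
        have "norm (measure M (?A n) - 0)
            = measure M (?A n)" by simp
        also have "\<dots> < r" using bound[of n] N[of n] n by linarith
        finally show "norm (measure M (?A n) - 0) < r" .
      qed
    qed
  qed measurable
qed

text \<open>Integrability is the right hypothesis here: \<psi> will be an outer product of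
  regressors, which are only square integrable, so a law of large numbers with second moments would
  ask for fourth moments of them.\<close>

lemma weak_law_euclidean:
  fixes T :: "'w \<Rightarrow> 'b::topological_space" and \<psi> :: "'b \<Rightarrow> 'c::euclidean_space"
  assumes "prob_space M" and "iid_copies M S P T" and "prob_space P" and "T \<in> borel_measurable P"
    and "\<psi> \<in> borel_measurable borel" and int: "integrable P (\<lambda>\<omega>. \<psi> (T \<omega>))"
  shows "conv_in_prob M (\<lambda>n \<omega>. (1 / real n) *\<^sub>R (\<Sum>i<n. \<psi> (S i \<omega>))) (\<integral>\<omega>. \<psi> (T \<omega>) \<partial>P)"
proof -
  interpret prob_space M by fact
  show ?thesis
  proof (rule conv_in_prob_euclidean)
    fix b :: 'c assume "b \<in> Basis"
    have "iid_copies M (\<lambda>i \<omega>. \<psi> (S i \<omega>) \<bullet> b) P (\<lambda>\<omega>. \<psi> (T \<omega>) \<bullet> b)"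
      by (rule iid_copies_compose[where \<psi>="\<lambda>x. \<psi> x \<bullet> b"]) (use assms in auto)
    from weak_law_of_large_numbers[OF assms(1) this assms(3)] int
    show "conv_in_prob M (\<lambda>n \<omega>. ((1 / real n) *\<^sub>R (\<Sum>i<n. \<psi> (S i \<omega>))) \<bullet> b) ((\<integral>\<omega>. \<psi> (T \<omega>) \<partial>P) \<bullet> b)"
      by (simp add: inner_sum_left)
  qed
qed

text \<open>In each coordinate the factor 1/n of the squared normalization cancels the linear growth
  of the second moment of the sum, which leaves a bound independent of n.\<close>

lemma normalized_sum_tight:
  fixes T :: "'w \<Rightarrow> 'b::topological_space" and \<psi> :: "'b \<Rightarrow> 'c::euclidean_space"
  assumes M: "prob_space M" and iid: "iid_copies M S P T" and P: "prob_space P" and T: "T \<in> borel_measurable P"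
    and psi: "\<psi> \<in> borel_measurable borel" and sq: "integrable P (\<lambda>\<omega>. (norm (\<psi> (T \<omega>)))\<^sup>2)"
    and mean: "(\<integral>\<omega>. \<psi> (T \<omega>) \<partial>P) = 0"
  shows "tight_seq M (\<lambda>n \<omega>. (1 / sqrt (real n)) *\<^sub>R (\<Sum>i<n. \<psi> (S i \<omega>)))"
proof -
  interpret P: prob_space P by fact
  interpret prob_space M by fact
  note [measurable] = iid_copies_measurable[OF M iid] psi T
  let ?X = "\<lambda>n \<omega>. (1 / sqrt (real n)) *\<^sub>R (\<Sum>i<n. \<psi> (S i \<omega>))"
  have int: "integrable P (\<lambda>\<omega>. \<psi> (T \<omega>))"
    by (rule P.square_norm_integrable_imp_integrable[OF _ sq]) measurable
  have sqb: "integrable P (\<lambda>\<omega>. (\<psi> (T \<omega>) \<bullet> b)\<^sup>2)" for b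
    by (rule square_integrable_inner[OF _ sq]) measurable
  have comp: "integrable M (\<lambda>\<omega>. (\<Sum>i<n. \<psi> (S i \<omega>) \<bullet> b)\<^sup>2)"
    "(\<integral>\<omega>. (\<Sum>i<n. \<psi> (S i \<omega>) \<bullet> b)\<^sup>2 \<partial>M) = real n * (\<integral>\<omega>. (\<psi> (T \<omega>) \<bullet> b)\<^sup>2 \<partial>P)" if "b \<in> Basis" for b n
  proof -
    have "iid_copies M (\<lambda>i \<omega>. \<psi> (S i \<omega>) \<bullet> b) P (\<lambda>\<omega>. \<psi> (T \<omega>) \<bullet> b)"
      by (rule iid_copies_compose[where \<psi>="\<lambda>x. \<psi> x \<bullet> b"]) (use assms in auto)
    moreover have "(\<integral>\<omega>. \<psi> (T \<omega>) \<bullet> b \<partial>P) = 0" using mean int by simp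
    ultimately show "integrable M (\<lambda>\<omega>. (\<Sum>i<n. \<psi> (S i \<omega>) \<bullet> b)\<^sup>2)"
      "(\<integral>\<omega>. (\<Sum>i<n. \<psi> (S i \<omega>) \<bullet> b)\<^sup>2 \<partial>M) = real n * (\<integral>\<omega>. (\<psi> (T \<omega>) \<bullet> b)\<^sup>2 \<partial>P)"
      using iid_copies_sum_square[OF M _ _ P sqb] by auto
  qed
  have eq: "(norm (?X n \<omega>))\<^sup>2 = (\<Sum>b\<in>Basis. (1 / real n) * (\<Sum>i<n. \<psi> (S i \<omega>) \<bullet> b)\<^sup>2)" for n \<omega>
    unfolding power2_norm_eq_inner
    by (subst euclidean_inner) (auto simp: inner_sum_left power2_eq_square[symmetric] power_divide intro!: sum.cong)
  show ?thesis
  proof (rule tight_seq_second_moment)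
    show "integrable M (\<lambda>\<omega>. (norm (?X n \<omega>))\<^sup>2)" for n
      unfolding eq by (intro Bochner_Integration.integrable_sum integrable_mult_right comp)
    show "(\<integral>\<omega>. (norm (?X n \<omega>))\<^sup>2 \<partial>M) \<le> (\<Sum>b\<in>Basis. \<integral>\<omega>. (\<psi> (T \<omega>) \<bullet> b)\<^sup>2 \<partial>P)" for n
      unfolding eq
      by (subst Bochner_Integration.integral_sum) (auto intro!: sum_mono integral_nonneg simp: comp)
  qed measurable
qed

section \<open>Levy continuity for tight sequences\<close>

text \<open>The real span of the real and imaginary parts of characters. Characteristic functions
  determine expectations on it, and the product-to-sum formulas make it an algebra, as polynomial
  approximation requires.\<close>

inductive trig_poly :: "('a::real_inner \<Rightarrow> real) \<Rightarrow> bool" where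
  cos: "trig_poly (\<lambda>x. cos (t \<bullet> x))"
| sin: "trig_poly (\<lambda>x. sin (t \<bullet> x))"
| scale: "trig_poly f \<Longrightarrow> trig_poly (\<lambda>x. c * f x)"
| add: "trig_poly f \<Longrightarrow> trig_poly g \<Longrightarrow> trig_poly (\<lambda>x. f x + g x)"

lemma trig_poly_const: "trig_poly (\<lambda>x. c)"
  using trig_poly.scale[OF trig_poly.cos[of 0], of c] by simp

lemma trig_poly_sum: "finite I \<Longrightarrow> (\<And>i. i \<in> I \<Longrightarrow> trig_poly (f i)) \<Longrightarrow> trig_poly (\<lambda>x. \<Sum>i\<in>I. f i x)"
  by (induction I rule: finite_induct) (auto intro: trig_poly_const trig_poly.add)

lemma trig_poly_mult_basic:
  assumes "trig_poly g"
  shows "trig_poly (\<lambda>x. cos (t \<bullet> x) * g x) \<and> trig_poly (\<lambda>x. sin (t \<bullet> x) * g x)"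
  using assms
proof induction
  case (cos s)
  have "cos (t \<bullet> x) * cos (s \<bullet> x) = (1/2) * cos ((t - s) \<bullet> x) + (1/2) * cos ((t + s) \<bullet> x)"
    "sin (t \<bullet> x) * cos (s \<bullet> x) = (1/2) * sin ((t + s) \<bullet> x) + (1/2) * sin ((t - s) \<bullet> x)" for x
    by (simp_all add: cos_times_cos sin_times_cos inner_diff_left inner_add_left add_divide_distrib)
  then show ?case by (simp only:) (intro conjI trig_poly.intros)
next
  case (sin s)
  have "cos (t \<bullet> x) * sin (s \<bullet> x) = (1/2) * sin ((t + s) \<bullet> x) + (- 1/2) * sin ((t - s) \<bullet> x)"
    "sin (t \<bullet> x) * sin (s \<bullet> x) = (1/2) * cos ((t - s) \<bullet> x) + (- 1/2) * cos ((t + s) \<bullet> x)" for x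
    by (simp_all add: cos_times_sin sin_times_sin inner_diff_left inner_add_left diff_divide_distrib)
  then show ?case by (simp only:) (intro conjI trig_poly.intros)
next
  case (scale f c)
  then show ?case by (auto simp: mult.left_commute[of _ c] intro: trig_poly.intros)
next
  case (add f g)
  then show ?case by (auto simp: distrib_left intro: trig_poly.intros)
qed

lemma trig_poly_mult:
  assumes "trig_poly f" "trig_poly g"
  shows "trig_poly (\<lambda>x. f x * g x)"
  using assms(1)
proof induction
  case (scale f c)
  then show ?case by (auto simp: mult.assoc intro: trig_poly.intros)
next
  case (add f h)
  then show ?case by (auto simp: distrib_right intro: trig_poly.intros)
qed (use trig_poly_mult_basic[OF assms(2)] in auto)

lemma trig_poly_continuous: "trig_poly f \<Longrightarrow> continuous_on UNIV f"
  by (induction rule: trig_poly.induct) (auto intro!: continuous_intros)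

lemma trig_poly_bounded: "trig_poly f \<Longrightarrow> \<exists>B. \<forall>x. \<bar>f x\<bar> \<le> B"
proof (induction rule: trig_poly.induct)
  case (scale f c)
  then obtain B where "\<And>x. \<bar>f x\<bar> \<le> B" by blast
  then have "\<bar>c * f x\<bar> \<le> \<bar>c\<bar> * B" for x by (simp add: abs_mult mult_left_mono)
  then show ?case by blast
next
  case (add f g)
  then obtain B B' where B: "\<And>x. \<bar>f x\<bar> \<le> B" "\<And>x. \<bar>g x\<bar> \<le> B'" by blast
  have "\<bar>f x + g x\<bar> \<le> B + B'" for x using B[of x] by linarith
  then show ?case by blast
qed (auto intro: exI[of _ 1])

text \<open>The coordinates sin (c x\<bullet>b) lie in the algebra of trigonometric polynomials,
  hence so does every polynomial in them; only the linear case sees the substitution.\<close>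

lemma trig_poly_real_polynomial:
  fixes p :: "'a::euclidean_space \<Rightarrow> real"
  assumes "real_polynomial_function p"
  shows "trig_poly (\<lambda>x::'a. p (\<Sum>b\<in>Basis. sin (c * (x \<bullet> b)) *\<^sub>R b))"
  using assms
proof induction
  case (linear f)
  then interpret bounded_linear f .
  have "trig_poly (\<lambda>x::'a. \<Sum>b\<in>Basis. f b * sin ((c *\<^sub>R b) \<bullet> x))"
    by (intro trig_poly_sum trig_poly.scale trig_poly.sin) auto
  moreover have "f (\<Sum>b\<in>Basis. sin (c * (x \<bullet> b)) *\<^sub>R b) = (\<Sum>b\<in>Basis. f b * sin ((c *\<^sub>R b) \<bullet> x))" for x
    by (simp add: sum scale inner_commute mult.commute)
  ultimately show ?case by simp
qed (auto intro: trig_poly_const trig_poly.add trig_poly_mult)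

text \<open>The substitution \<open>y = sin (x / R)\<close>, applied to each coordinate, maps the ball of radius \<open>R\<close>
  injectively and all of the space into a compact cube, so a polynomial in \<open>y\<close> that is uniformly
  close on the cube stays bounded everywhere.\<close>

lemma trig_poly_approximation:
  fixes \<phi> :: "'a::euclidean_space \<Rightarrow> real"
  assumes cont: "continuous_on UNIV \<phi>" and B: "\<And>x. \<bar>\<phi> x\<bar> \<le> B" and "R > 0" and "e > 0"
  obtains \<psi> where "trig_poly \<psi>" "\<And>x. \<bar>\<psi> x\<bar> \<le> B + e" "\<And>x. norm x \<le> R \<Longrightarrow> \<bar>\<phi> x - \<psi> x\<bar> \<le> e"
proof -
  define S :: "'a set" where "S = cbox (- One) One"
  \<comment> \<open>\<phi> read through the inverse of the substitution. As arcsin is continuous on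
    [-1, 1], \<open>F\<close> is continuous on the whole cube, with the same bound
    \<open>B\<close>.\<close>
  define F where "F y = \<phi> (\<Sum>b\<in>Basis. (R * arcsin (y \<bullet> b)) *\<^sub>R b)" for y :: 'a
  have "continuous_on S F"
    unfolding F_def
    by (intro continuous_on_compose2[OF cont] continuous_intros) (auto simp: S_def mem_box)
  moreover have "compact S" unfolding S_def by (rule compact_cbox)
  ultimately obtain p where p: "real_polynomial_function p" "\<And>y. y \<in> S \<Longrightarrow> \<bar>F y - p y\<bar> < e"
    using Stone_Weierstrass_real_polynomial_function[of S F e] \<open>e > 0\<close> by metis
  define G where "G x = (\<Sum>b\<in>Basis. sin (1 / R * (x \<bullet> b)) *\<^sub>R b)" for x :: 'a
  have Gb: "G x \<bullet> b = sin (1 / R * (x \<bullet> b))" if "b \<in> Basis" for x b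
    unfolding G_def using that by simp
  have GS: "G x \<in> S" for x by (auto simp: S_def mem_box Gb)
  have FG: "F (G x) = \<phi> x" if "norm x \<le> R" for x
  proof -
    have "R * arcsin (G x \<bullet> b) = x \<bullet> b" if b: "b \<in> Basis" for b
    proof -
      have "\<bar>x \<bullet> b\<bar> \<le> R" using Basis_le_norm[OF b, of x] \<open>norm x \<le> R\<close> by simp
      then have 1: "- 1 \<le> 1 / R * (x \<bullet> b)" "1 / R * (x \<bullet> b) \<le> 1"
        using \<open>R > 0\<close> by (auto simp: field_simps abs_le_iff)
      \<comment> \<open>Inside the ball the scaled coordinates lie in [-1, 1], within [-pi/2, pi/2],
        where arcsin undoes sin.\<close>
      have "arcsin (G x \<bullet> b) = 1 / R * (x \<bullet> b)"
        unfolding Gb[OF b] by (rule arcsin_sin) (use 1 pi_ge_two in linarith)+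
      then show ?thesis using \<open>R > 0\<close> by simp
    qed
    then have "(\<Sum>b\<in>Basis. (R * arcsin (G x \<bullet> b)) *\<^sub>R b) = (\<Sum>b\<in>Basis. (x \<bullet> b) *\<^sub>R b)"
      by (intro sum.cong) auto
    then show ?thesis unfolding F_def by (simp add: euclidean_representation)
  qed
  show ?thesis
  proof (rule that[of "\<lambda>x. p (G x)"])
    show "trig_poly (\<lambda>x. p (G x))" unfolding G_def by (rule trig_poly_real_polynomial[OF p(1)])
    show "\<bar>p (G x)\<bar> \<le> B + e" for x
      using p(2)[OF GS[of x]] B[of "\<Sum>b\<in>Basis. (R * arcsin (G x \<bullet> b)) *\<^sub>R b"] unfolding F_def by linarith
    show "\<bar>\<phi> x - p (G x)\<bar> \<le> e" if "norm x \<le> R" for x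
      using p(2)[OF GS[of x]] FG[OF that] by linarith
  qed
qed

text \<open>On the ball the integrands differ by at most e; off it they differ by at most 2 B + e,
  on an event of probability at most e.\<close>

lemma (in prob_space) expectation_approx:
  fixes X :: "'a \<Rightarrow> 'b::euclidean_space" and \<phi> \<psi> :: "'b \<Rightarrow> real"
  assumes [measurable]: "X \<in> borel_measurable M" "\<phi> \<in> borel_measurable borel" "\<psi> \<in> borel_measurable borel"
    and B: "\<And>x. \<bar>\<phi> x\<bar> \<le> B" "\<And>x. \<bar>\<psi> x\<bar> \<le> B + e"
    and close: "\<And>x. norm x \<le> R \<Longrightarrow> \<bar>\<phi> x - \<psi> x\<bar> \<le> e" and "e \<ge> 0"
    and tail: "prob {\<omega> \<in> space M. norm (X \<omega>) > R} \<le> e"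
  shows "\<bar>(\<integral>\<omega>. \<phi> (X \<omega>) \<partial>M) - (\<integral>\<omega>. \<psi> (X \<omega>) \<partial>M)\<bar> \<le> e + (2 * B + e) * e"
proof -
  have "B \<ge> 0" using B(1)[of undefined] by simp
  define A where "A = {\<omega> \<in> space M. norm (X \<omega>) > R}"
  have Am [measurable]: "A \<in> sets M" unfolding A_def by measurable
  have ind: "integrable M (indicator A :: 'a \<Rightarrow> real)"
    by (rule integrable_real_indicator) (auto simp: less_top[symmetric])
  have int: "integrable M (\<lambda>\<omega>. \<phi> (X \<omega>))" "integrable M (\<lambda>\<omega>. \<psi> (X \<omega>))"
    by (rule integrable_const_bound[where B=B], use B in auto)
       (rule integrable_const_bound[where B="B + e"], use B in auto)
  have "\<bar>(\<integral>\<omega>. \<phi> (X \<omega>) \<partial>M) - (\<integral>\<omega>. \<psi> (X \<omega>) \<partial>M)\<bar> = \<bar>\<integral>\<omega>. \<phi> (X \<omega>) - \<psi> (X \<omega>) \<partial>M\<bar>"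
    using int by simp
  also have "\<dots> \<le> (\<integral>\<omega>. \<bar>\<phi> (X \<omega>) - \<psi> (X \<omega>)\<bar> \<partial>M)"
    using integral_norm_bound[of M "\<lambda>\<omega>. \<phi> (X \<omega>) - \<psi> (X \<omega>)"] by simp
  also have "\<dots> \<le> (\<integral>\<omega>. e + (2 * B + e) * indicator A \<omega> \<partial>M)"
  proof (rule integral_mono)
    fix \<omega> assume "\<omega> \<in> space M"
    then show "\<bar>\<phi> (X \<omega>) - \<psi> (X \<omega>)\<bar> \<le> e + (2 * B + e) * indicator A \<omega>"
      using close[of "X \<omega>"] B(1)[of "X \<omega>"] B(2)[of "X \<omega>"] \<open>e \<ge> 0\<close>
      by (cases "\<omega> \<in> A") (auto simp: A_def)
  qed (use int ind in auto)
  also have "\<dots> = e + (2 * B + e) * prob A"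
    using ind by (subst Bochner_Integration.integral_add) (auto simp: prob_space)
  also have "\<dots> \<le> e + (2 * B + e) * e"
    using tail \<open>B \<ge> 0\<close> \<open>e \<ge> 0\<close> unfolding A_def by (intro add_left_mono mult_left_mono) auto
  finally show ?thesis .
qed

text \<open>Continuity from above: the complements of growing balls decrease to the empty
  set.\<close>

lemma finite_measure_norm_tail:
  fixes N :: "'b::euclidean_space measure"
  assumes "finite_measure N" and [measurable_cong]: "sets N = sets borel" and "e > 0"
  obtains K where "measure N {x \<in> space N. norm x > K} \<le> e"
proof -
  interpret finite_measure N by fact
  have "(\<lambda>k. measure N {x \<in> space N. norm x > real k}) \<longlonglongrightarrow> measure N (\<Inter>k. {x \<in> space N. norm x > real k})"
    by (rule finite_Lim_measure_decseq) (auto simp: decseq_def)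
  moreover have "(\<Inter>k. {x \<in> space N. norm x > real k}) = {}"
  proof (rule equals0I)
    fix x assume "x \<in> (\<Inter>k. {x \<in> space N. norm x > real k})"
    then have "norm x > real k" for k by auto
    then show False using reals_Archimedean2[of "norm x"] by (meson less_asym)
  qed
  ultimately have "(\<lambda>k. measure N {x \<in> space N. norm x > real k}) \<longlonglongrightarrow> 0" by simp
  from LIMSEQ_D[OF this \<open>e > 0\<close>] obtain k where "measure N {x \<in> space N. norm x > real k} < e" by auto
  then show ?thesis by (intro that[of "real k"]) simp
qed

text \<open>Second moments will supply tightness directly, so it is a hypothesis here instead of
  being extracted from continuity of the limiting characteristic function at 0.\<close>

lemma levy_continuity_tight:
  fixes T :: "nat \<Rightarrow> 's \<Rightarrow> 'b::euclidean_space"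
  assumes M: "prob_space M" and tight: "tight_seq M T" and N: "prob_space N" and sets [measurable_cong]: "sets N = sets borel"
    and char: "\<And>t. (\<lambda>n. \<integral>\<omega>. iexp (t \<bullet> T n \<omega>) \<partial>M) \<longlonglongrightarrow> (\<integral>x. iexp (t \<bullet> x) \<partial>N)"
  shows "conv_in_distr M T N"
  unfolding conv_in_distr_def
proof (intro conjI allI impI N sets)
  interpret M: prob_space M by fact
  interpret N: prob_space N by fact
  show Tm [measurable]: "T n \<in> borel_measurable M" for n using tight by (simp add: tight_seq_def)
  \<comment> \<open>Cosines and sines are the real and imaginary parts of the convergent
    characteristic functions; the remaining cases are linearity, with boundedness for
    integrability.\<close>
  have trig: "(\<lambda>n. \<integral>\<omega>. \<psi> (T n \<omega>) \<partial>M) \<longlonglongrightarrow> (\<integral>x. \<psi> x \<partial>N)" if "trig_poly \<psi>" for \<psi>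
    using that
  proof induction
    case (cos t)
    have "(\<integral>\<omega>. Re (iexp (t \<bullet> T n \<omega>)) \<partial>M) = Re (\<integral>\<omega>. iexp (t \<bullet> T n \<omega>) \<partial>M)" for n
      by (rule integral_Re) (rule M.integrable_const_bound[where B=1], auto)
    moreover have "(\<integral>\<omega>. Re (iexp (t \<bullet> \<omega>)) \<partial>N) = Re (\<integral>\<omega>. iexp (t \<bullet> \<omega>) \<partial>N)"
      by (rule integral_Re) (rule N.integrable_const_bound[where B=1], auto)
    ultimately show ?case using tendsto_Re[OF char[of t]] by (simp add: cis_conv_exp[symmetric])
  next
    case (sin t)
    have "(\<integral>\<omega>. Im (iexp (t \<bullet> T n \<omega>)) \<partial>M) = Im (\<integral>\<omega>. iexp (t \<bullet> T n \<omega>) \<partial>M)" for n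
      by (rule integral_Im) (rule M.integrable_const_bound[where B=1], auto)
    moreover have "(\<integral>\<omega>. Im (iexp (t \<bullet> \<omega>)) \<partial>N) = Im (\<integral>\<omega>. iexp (t \<bullet> \<omega>) \<partial>N)"
      by (rule integral_Im) (rule N.integrable_const_bound[where B=1], auto)
    ultimately show ?case using tendsto_Im[OF char[of t]] by (simp add: cis_conv_exp[symmetric])
  next
    case (scale f c)
    then show ?case by (auto intro: tendsto_mult_left)
  next
    case (add f g)
    obtain B B' where B: "\<And>x. \<bar>f x\<bar> \<le> B" "\<And>x. \<bar>g x\<bar> \<le> B'" using add.hyps[THEN trig_poly_bounded] by blast
    have [measurable]: "f \<in> borel_measurable borel" "g \<in> borel_measurable borel"
      using add.hyps[THEN trig_poly_continuous] by (auto intro: borel_measurable_continuous_onI)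
    have "integrable M (\<lambda>\<omega>. f (T n \<omega>))" "integrable M (\<lambda>\<omega>. g (T n \<omega>))" for n
      by (rule M.integrable_const_bound[where B=B], use B in auto)
         (rule M.integrable_const_bound[where B=B'], use B in auto)
    moreover have "integrable N f" "integrable N g"
      by (rule N.integrable_const_bound[where B=B], use B in auto)
         (rule N.integrable_const_bound[where B=B'], use B in auto)
    ultimately show ?case using tendsto_add[OF add.IH] by simp
  qed
  fix \<phi> :: "'b \<Rightarrow> real" assume phi: "continuous_on UNIV \<phi> \<and> bounded (range \<phi>)"
  then obtain B where B: "\<And>x. \<bar>\<phi> x\<bar> \<le> B" unfolding bounded_iff by auto
  have "B \<ge> 0" using B[of undefined] by simp
  have pm [measurable]: "\<phi> \<in> borel_measurable borel" using phi by (simp add: borel_measurable_continuous_onI)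
  show "(\<lambda>n. \<integral>\<omega>. \<phi> (T n \<omega>) \<partial>M) \<longlonglongrightarrow> (\<integral>x. \<phi> x \<partial>N)"
  proof (rule LIMSEQ_I)
    fix r :: real assume "r > 0"
    \<comment> \<open>Since e \<le> 1, the approximation error e + (2 B + e) e is at most 2 e (1 +
      B), hence at most r/4. It occurs twice, once for the sequence and once for the limit.\<close>
    define e where "e = min 1 (r / (8 * (1 + B)))"
    have "e \<le> r / (8 * (1 + B))" unfolding e_def by simp
    then have "e * (1 + B) \<le> r / (8 * (1 + B)) * (1 + B)" using \<open>B \<ge> 0\<close> by (intro mult_right_mono) auto
    also have "\<dots> = r / 8" using \<open>B \<ge> 0\<close> by (simp add: field_simps)
    finally have e: "e > 0" "e \<le> 1" "e * (1 + B) \<le> r / 8"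
      using \<open>r > 0\<close> \<open>B \<ge> 0\<close> unfolding e_def by auto
    have err: "e + (2 * B + e) * e \<le> r / 4"
    proof -
      have "e * e \<le> e" using e mult_left_mono[of e 1 e] by simp
      then have "e + (2 * B + e) * e \<le> 2 * (e * (1 + B))" by (simp add: algebra_simps)
      then show ?thesis using e by simp
    qed
    obtain K where K: "\<And>n. measure M {\<omega> \<in> space M. norm (T n \<omega>) > K} \<le> e"
      using tight \<open>e > 0\<close> unfolding tight_seq_def by blast
    obtain K' where K': "measure N {x \<in> space N. norm x > K'} \<le> e"
      using finite_measure_norm_tail[OF N.finite_measure_axioms sets \<open>e > 0\<close>] by blast
    \<comment> \<open>One radius for all laws and the limit, so that a single trigonometric
      polynomial serves every n.\<close>
    define R where "R = max 1 (max K K')"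
    have R: "R > 0" "K \<le> R" "K' \<le> R" unfolding R_def by auto
    obtain \<psi> where psi: "trig_poly \<psi>" "\<And>x. \<bar>\<psi> x\<bar> \<le> B + e" "\<And>x. norm x \<le> R \<Longrightarrow> \<bar>\<phi> x - \<psi> x\<bar> \<le> e"
      using trig_poly_approximation[OF conjunct1[OF phi] B R(1) \<open>e > 0\<close>] by blast
    have [measurable]: "\<psi> \<in> borel_measurable borel"
      using psi(1) by (auto intro: borel_measurable_continuous_onI trig_poly_continuous)
    have "measure M {\<omega> \<in> space M. norm (T n \<omega>) > R} \<le> e" for n
      by (rule order_trans[OF M.finite_measure_mono K[of n]]) (use R in auto)
    then have 1: "\<bar>(\<integral>\<omega>. \<phi> (T n \<omega>) \<partial>M) - (\<integral>\<omega>. \<psi> (T n \<omega>) \<partial>M)\<bar> \<le> r / 4" for n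
      using e by (intro order_trans[OF M.expectation_approx[where R=R and B=B and e=e] err] B psi) auto
    have "measure N {x \<in> space N. norm x > R} \<le> e"
      by (rule order_trans[OF N.finite_measure_mono K']) (use R in auto)
    then have 2: "\<bar>(\<integral>x. \<phi> x \<partial>N) - (\<integral>x. \<psi> x \<partial>N)\<bar> \<le> r / 4"
      using e by (intro order_trans[OF N.expectation_approx[where R=R and B=B and e=e and X="\<lambda>x. x"] err] B psi) auto
    obtain n0 where n0: "\<And>n. n \<ge> n0 \<Longrightarrow> \<bar>(\<integral>\<omega>. \<psi> (T n \<omega>) \<partial>M) - (\<integral>x. \<psi> x \<partial>N)\<bar> < r / 4"
      using LIMSEQ_D[OF trig[OF psi(1)], of "r / 4"] \<open>r > 0\<close> by auto
    show "\<exists>n0. \<forall>n\<ge>n0. norm ((\<integral>\<omega>. \<phi> (T n \<omega>) \<partial>M) - (\<integral>x. \<phi> x \<partial>N)) < r"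
    proof (intro exI allI impI)
      fix n assume "n \<ge> n0"
      from n0[OF this] 1[of n] 2 show "norm ((\<integral>\<omega>. \<phi> (T n \<omega>) \<partial>M) - (\<integral>x. \<phi> x \<partial>N)) < r"
        unfolding real_norm_def using \<open>r > 0\<close> by arith
    qed
  qed
qed

section \<open>Multivariate central limit theorem\<close>

lemma borel_measurable_vec_nth [measurable (raw)]:
  fixes f :: "'a \<Rightarrow> 'b::topological_space ^ 'k"
  assumes "f \<in> borel_measurable M"
  shows "(\<lambda>x. f x $ i) \<in> borel_measurable M"
  using measurable_compose[OF assms borel_measurable_continuous_onI[of "\<lambda>x. x $ i"]]
  by (simp add: continuous_on_def tendsto_vec_nth)

lemma square_integrable_nth:
  fixes f :: "'a \<Rightarrow> real ^ 'k"
  assumes "f \<in> borel_measurable M" and "integrable M (\<lambda>x. (norm (f x))\<^sup>2)"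
  shows "integrable M (\<lambda>x. (f x $ i)\<^sup>2)"
  using square_integrable_inner[OF assms, of "axis i 1"] by (simp add: inner_axis)

text \<open>\<open>lborel\<close> is the image of the product of one-dimensional Lebesgue measures,
  so Fubini splits the integral. The values range over a normed field because the characteristic
  function needs complex factors.\<close>

lemma integral_lborel_prod:
  fixes f :: "'a::euclidean_space \<Rightarrow> real \<Rightarrow> 'b::{real_normed_field,banach,second_countable_topology}"
  assumes "\<And>b. b \<in> Basis \<Longrightarrow> integrable lborel (f b)"
  shows "(\<integral>x. (\<Prod>b\<in>Basis. f b (x \<bullet> b)) \<partial>lborel) = (\<Prod>b\<in>Basis. \<integral>y. f b y \<partial>lborel)"
proof -
  interpret product_sigma_finite "\<lambda>_. lborel :: real measure" by standard
  have [measurable]: "b \<in> Basis \<Longrightarrow> f b \<in> borel_measurable borel" for b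
    using assms[of b] by auto
  have "(\<integral>x. (\<Prod>b\<in>Basis. f b (x \<bullet> b)) \<partial>(lborel :: 'a measure)) =
     (\<integral>z. (\<Prod>b\<in>Basis. f b ((\<Sum>b\<in>Basis. z b *\<^sub>R b) \<bullet> b)) \<partial>(\<Pi>\<^sub>M b\<in>(Basis::'a set). lborel))"
    by (subst lborel_eq, rule integral_distr) measurable
  also have "\<dots> = (\<integral>z. (\<Prod>b\<in>Basis. f b (z b)) \<partial>(\<Pi>\<^sub>M b\<in>(Basis::'a set). lborel))"
    by simp
  also have "\<dots> = (\<Prod>b\<in>Basis. \<integral>y. f b y \<partial>lborel)"
    using assms by (intro product_integral_prod) auto
  finally show ?thesis .
qed

lemma prod_UNIV_eq_Basis:
  fixes x :: "real ^ 'k"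
  shows "(\<Prod>i\<in>UNIV. h (x $ i) :: real) = (\<Prod>b\<in>Basis. h (x \<bullet> b))"
proof -
  have "(Basis :: (real ^ 'k) set) = range (\<lambda>i. axis i 1)" by (auto simp: Basis_vec_def)
  moreover have "inj (\<lambda>i. axis i (1::real) :: real ^ 'k)" by (auto simp: inj_def axis_eq_axis)
  ultimately show ?thesis using prod.reindex[of "\<lambda>i. axis i (1::real) :: real ^ 'k" UNIV "\<lambda>b. h (x \<bullet> b)"]
    by (simp only:) (simp add: inner_axis)
qed

section \<open>The standard normal vector and characteristic functions of normal laws\<close>

lemma std_normal_vec_density_eq:
  "std_normal_vec = density lborel (\<lambda>x::real ^ 'k. ennreal (\<Prod>b\<in>Basis. std_normal_density (x \<bullet> b)))"
  unfolding std_normal_vec_def by (simp add: prod_UNIV_eq_Basis[of std_normal_density])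

lemma sets_std_normal_vec [simp, measurable_cong]: "sets std_normal_vec = sets borel"
  by (simp add: std_normal_vec_def)

lemma prob_space_std_normal_vec: "prob_space (std_normal_vec :: (real ^ 'k) measure)"
proof (rule prob_spaceI)
  have 1: "(\<integral>\<^sup>+ y. ennreal (std_normal_density y) \<partial>lborel) = 1"
    using prob_space.emeasure_space_1[OF prob_space_normal_density[of 1 0]]
    by (simp add: emeasure_density)
  have "emeasure std_normal_vec (space (std_normal_vec :: (real ^ 'k) measure)) =
     (\<integral>\<^sup>+ x. (\<Prod>b\<in>Basis. ennreal (std_normal_density (x \<bullet> b))) \<partial>(lborel :: (real ^ 'k) measure))"
    unfolding std_normal_vec_density_eq by (simp add: emeasure_density prod_ennreal)
  also have "\<dots> = (\<Prod>b\<in>(Basis::(real ^ 'k) set). \<integral>\<^sup>+ y. ennreal (std_normal_density y) \<partial>lborel)"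
    by (rule nn_integral_lborel_prod) auto
  finally show "emeasure std_normal_vec (space (std_normal_vec :: (real ^ 'k) measure)) = 1"
    by (simp add: 1)
qed

text \<open>Density and exponential both factor over the coordinates, which reduces the integral to
  the one-dimensional normal characteristic function.\<close>

lemma char_std_normal_vec:
  fixes t :: "real ^ 'k"
  shows "(\<integral>x. iexp (t \<bullet> x) \<partial>std_normal_vec) = exp (- (norm t)\<^sup>2 / 2)"
proof -
  have char1: "(\<integral>y. std_normal_density y *\<^sub>R iexp (s * y) \<partial>lborel) = complex_of_real (exp (- s\<^sup>2 / 2))" for s
    using fun_cong[OF char_std_normal_distribution, of s] unfolding char_def
    by (subst (asm) integral_density) auto
  have "(\<integral>x. iexp (t \<bullet> x) \<partial>std_normal_vec) =
     (\<integral>x. (\<Prod>b\<in>Basis. std_normal_density (x \<bullet> b)) *\<^sub>R iexp (t \<bullet> x) \<partial>lborel)"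
    unfolding std_normal_vec_density_eq
    by (subst integral_density) (auto intro!: prod_nonneg)
  also have "\<dots> = (\<integral>x. (\<Prod>b\<in>Basis. (\<lambda>y. std_normal_density y *\<^sub>R iexp ((t \<bullet> b) * y)) (x \<bullet> b)) \<partial>lborel)"
  proof (rule Bochner_Integration.integral_cong[OF refl])
    fix x :: "real ^ 'k"
    have "iexp (t \<bullet> x) = (\<Prod>b\<in>Basis. iexp ((t \<bullet> b) * (x \<bullet> b)))"
      by (subst euclidean_inner[of t x]) (simp add: exp_sum sum_distrib_left)
    then show "(\<Prod>b\<in>Basis. std_normal_density (x \<bullet> b)) *\<^sub>R iexp (t \<bullet> x) =
       (\<Prod>b\<in>Basis. (\<lambda>y. std_normal_density y *\<^sub>R iexp ((t \<bullet> b) * y)) (x \<bullet> b))"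
      by (simp add: scaleR_conv_of_real prod.distrib)
  qed
  also have "\<dots> = (\<Prod>b\<in>Basis. \<integral>y. std_normal_density y *\<^sub>R iexp ((t \<bullet> b) * y) \<partial>lborel)"
  proof (rule integral_lborel_prod)
    fix b
    have "integrable lborel std_normal_density" by simp
    then show "integrable lborel (\<lambda>y. std_normal_density y *\<^sub>R iexp ((t \<bullet> b) * y))"
      by (rule Bochner_Integration.integrable_bound) auto
  qed
  also have "\<dots> = (\<Prod>b\<in>Basis. complex_of_real (exp (- (t \<bullet> b)\<^sup>2 / 2)))"
    unfolding char1 ..
  also have "\<dots> = complex_of_real (exp (\<Sum>b\<in>Basis. - (t \<bullet> b)\<^sup>2 / 2))"
    by (simp add: exp_sum)
  also have "(\<Sum>b\<in>Basis. - (t \<bullet> b)\<^sup>2 / 2) = - (norm t)\<^sup>2 / 2"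
    unfolding power2_norm_eq_inner by (subst euclidean_inner[of t t])
      (simp add: power2_eq_square sum_negf sum_divide_distrib)
  finally show ?thesis by simp
qed

lemma is_mv_normal_prob_space:
  fixes \<Sigma> :: "real ^ 'k ^ 'k"
  assumes "is_mv_normal N m \<Sigma>"
  shows "prob_space N" and "sets N = sets borel"
proof -
  obtain A :: "real ^ 'k ^ 'k" where N: "N = distr std_normal_vec borel (\<lambda>x. m + A *v x)"
    using assms unfolding is_mv_normal_def by blast
  have "(\<lambda>x. m + A *v x) \<in> borel_measurable borel"
    by (intro borel_measurable_continuous_onI continuous_intros)
  then show "prob_space N" unfolding N
    by (intro prob_space.prob_space_distr prob_space_std_normal_vec) simp
  show "sets N = sets borel" unfolding N by simp
qed

text \<open>Moving A to the other side of the inner product evaluates the standard characteristic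
  function at the transpose of A applied to t. Its squared norm depends on A only through \<Sigma>,
  so the choice of the factor does not matter.\<close>

lemma char_mv_normal:
  fixes \<Sigma> :: "real ^ 'k ^ 'k"
  assumes "is_mv_normal N 0 \<Sigma>"
  shows "(\<integral>x. iexp (t \<bullet> x) \<partial>N) = exp (- (t \<bullet> (\<Sigma> *v t)) / 2)"
proof -
  obtain A :: "real ^ 'k ^ 'k" where A: "A ** transpose A = \<Sigma>" and N: "N = distr std_normal_vec borel (\<lambda>x. 0 + A *v x)"
    using assms unfolding is_mv_normal_def by blast
  have [measurable]: "(*v) A \<in> borel_measurable borel"
    by (intro borel_measurable_continuous_onI continuous_intros)
  have "(\<integral>x. iexp (t \<bullet> x) \<partial>N) = (\<integral>x. iexp (t \<bullet> (A *v x)) \<partial>std_normal_vec)"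
    unfolding N by (subst integral_distr) (auto simp: measurable_cong_sets[OF sets_std_normal_vec refl])
  also have "\<dots> = (\<integral>x. iexp ((t v* A) \<bullet> x) \<partial>std_normal_vec)"
    by (simp add: dot_lmul_matrix)
  also have "\<dots> = exp (- (norm (t v* A))\<^sup>2 / 2)" by (rule char_std_normal_vec)
  also have "(norm (t v* A))\<^sup>2 = t \<bullet> (\<Sigma> *v t)"
    unfolding A[symmetric] power2_norm_eq_inner
    by (simp add: dot_lmul_matrix matrix_vector_mul_assoc[symmetric] transpose_matrix_vector)
  finally show ?thesis .
qed

text \<open>The one-dimensional central limit theorem requires positive variance. Variance 0 is
  treated apart, since projections of a vector can be degenerate and t = 0 always is; there the sums
  vanish almost surely.\<close>

lemma char_normalized_sum:
  fixes T :: "'w \<Rightarrow> real"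
  assumes M: "prob_space M" and iid: "iid_copies M S P T" and P: "prob_space P" and T: "T \<in> borel_measurable P"
    and sq: "integrable P (\<lambda>\<omega>. (T \<omega>)\<^sup>2)" and mean: "(\<integral>\<omega>. T \<omega> \<partial>P) = 0"
  shows "(\<lambda>n. \<integral>\<omega>. iexp ((1 / sqrt (real n)) * (\<Sum>i<n. S i \<omega>)) \<partial>M)
     \<longlonglongrightarrow> exp (- (\<integral>\<omega>. (T \<omega>)\<^sup>2 \<partial>P) / 2)"
proof -
  interpret P: prob_space P by fact
  interpret prob_space M by fact
  note m [measurable] = iid_copies_measurable[OF M iid]
  define v where "v = (\<integral>\<omega>. (T \<omega>)\<^sup>2 \<partial>P)"
  have "v \<ge> 0" unfolding v_def by simp
  show ?thesis
  proof (cases "v = 0")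
    case True
    have "(\<integral>\<omega>. iexp ((1 / sqrt (real n)) * (\<Sum>i<n. S i \<omega>)) \<partial>M) = 1" for n
    proof -
      have s: "integrable M (\<lambda>\<omega>. (\<Sum>i<n. S i \<omega>)\<^sup>2)" "(\<integral>\<omega>. (\<Sum>i<n. S i \<omega>)\<^sup>2 \<partial>M) = 0"
        using iid_copies_sum_square[OF M iid T P sq mean, of n] True by (auto simp: v_def)
      have ae: "AE \<omega> in M. (\<Sum>i<n. S i \<omega>)\<^sup>2 = 0"
        using integral_nonneg_eq_0_iff_AE[OF s(1)] s(2) by simp
      have "(\<integral>\<omega>. iexp ((1 / sqrt (real n)) * (\<Sum>i<n. S i \<omega>)) \<partial>M) = (\<integral>\<omega>. 1 \<partial>M)"
        by (rule integral_cong_AE) (use ae in \<open>auto simp flip: of_real_sum\<close>)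
      then show ?thesis by (simp add: prob_space)
    qed
    then show ?thesis using True by (simp add: v_def)
  next
    case False
    define \<sigma> where "\<sigma> = sqrt v"
    have s: "\<sigma> > 0" "\<sigma>\<^sup>2 = v" using False \<open>v \<ge> 0\<close> by (auto simp: \<sigma>_def)
    note it = iid_copies_integral[OF M iid T]
    have "weak_conv_m (\<lambda>n. distr M borel (\<lambda>x. (\<Sum>i<n. S i x) / sqrt (n * \<sigma>\<^sup>2))) std_normal_distribution"
    proof (rule central_limit_theorem_zero_mean)
      show "indep_vars (\<lambda>i. borel) S UNIV" using iid by (simp add: iid_copies_def)
      show e0: "expectation (S n) = 0" for n using it[of "\<lambda>x. x" n] mean by simp
      show "integrable M (\<lambda>x. (S n x)\<^sup>2)" for n using it[of "\<lambda>x. x\<^sup>2" n] sq by simp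
      show "variance (S n) = \<sigma>\<^sup>2" for n using it[of "\<lambda>x. x\<^sup>2" n] by (simp add: e0 s v_def)
      show "distr M borel (S n) = distr P borel T" for n using iid by (simp add: iid_copies_def)
    qed (rule s)
    then have "(\<lambda>n. char (distr M borel (\<lambda>x. (\<Sum>i<n. S i x) / sqrt (n * \<sigma>\<^sup>2))) \<sigma>) \<longlonglongrightarrow> char std_normal_distribution \<sigma>"
      by (intro levy_continuity1 real_distribution_distr real_dist_normal_dist) auto
    \<comment> \<open>Evaluating the standardized sum at the frequency \<sigma> undoes the division
      by \<sigma>.\<close>
    moreover have "char (distr M borel (\<lambda>x. (\<Sum>i<n. S i x) / sqrt (n * \<sigma>\<^sup>2))) \<sigma> =
        (\<integral>\<omega>. iexp ((1 / sqrt (real n)) * (\<Sum>i<n. S i \<omega>)) \<partial>M)" for n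
      unfolding char_def using s
      by (subst integral_distr) (auto simp: real_sqrt_mult field_simps intro!: Bochner_Integration.integral_cong arg_cong[where f=exp])
    ultimately show ?thesis by (simp add: char_std_normal_distribution s v_def[symmetric])
  qed
qed

text \<open>The device of Cramer and Wold at the level of characteristic functions: the value at t
  concerns only the real i.i.d. variables t \<bullet> \<psi>, whose variance is the quadratic form
  of \<Sigma> at t.\<close>

theorem multivariate_central_limit_theorem:
  fixes T :: "'w \<Rightarrow> 'b::topological_space" and \<psi> :: "'b \<Rightarrow> real ^ 'k"
  assumes M: "prob_space M" and iid: "iid_copies M S P T" and P: "prob_space P" and T: "T \<in> borel_measurable P"
    and psi: "\<psi> \<in> borel_measurable borel" and sq: "integrable P (\<lambda>\<omega>. (norm (\<psi> (T \<omega>)))\<^sup>2)"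
    and mean: "(\<integral>\<omega>. \<psi> (T \<omega>) \<partial>P) = 0"
    and Sigma: "\<And>a b. \<Sigma> $ a $ b = (\<integral>\<omega>. \<psi> (T \<omega>) $ a * \<psi> (T \<omega>) $ b \<partial>P)"
    and N: "is_mv_normal N 0 \<Sigma>"
  shows "conv_in_distr M (\<lambda>n \<omega>. (1 / sqrt (real n)) *\<^sub>R (\<Sum>i<n. \<psi> (S i \<omega>))) N"
proof (rule levy_continuity_tight[OF M normalized_sum_tight[OF M iid P T psi sq mean] is_mv_normal_prob_space[OF N]])
  fix t :: "real ^ 'k"
  interpret P: prob_space P by fact
  note [measurable] = psi T
  have int: "integrable P (\<lambda>\<omega>. \<psi> (T \<omega>))"
    by (rule P.square_norm_integrable_imp_integrable[OF _ sq]) measurable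
  have sqc: "integrable P (\<lambda>\<omega>. (\<psi> (T \<omega>) $ a)\<^sup>2)" for a
    by (rule square_integrable_nth[OF _ sq]) measurable
  have prod: "integrable P (\<lambda>\<omega>. \<psi> (T \<omega>) $ a * \<psi> (T \<omega>) $ b)" for a b
    by (rule square_integrable_mult[OF _ _ sqc sqc]) measurable
  have eq: "(t \<bullet> x)\<^sup>2 = (\<Sum>a\<in>UNIV. \<Sum>b\<in>UNIV. t $ a * t $ b * (x $ a * x $ b))" for x
    by (simp add: inner_vec_def power2_eq_square sum_product mult_ac)
  have sqt: "integrable P (\<lambda>\<omega>. (t \<bullet> \<psi> (T \<omega>))\<^sup>2)"
    unfolding eq by (intro Bochner_Integration.integrable_sum integrable_mult_right prod)
  have "(\<integral>\<omega>. (t \<bullet> \<psi> (T \<omega>))\<^sup>2 \<partial>P) = (\<Sum>a\<in>UNIV. \<Sum>b\<in>UNIV. t $ a * t $ b * \<Sigma> $ a $ b)"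
    unfolding eq Sigma by (simp add: prod)
  also have "\<dots> = t \<bullet> (\<Sigma> *v t)"
    by (simp add: inner_vec_def matrix_vector_mult_def sum_distrib_left mult_ac)
  finally have var: "(\<integral>\<omega>. (t \<bullet> \<psi> (T \<omega>))\<^sup>2 \<partial>P) = t \<bullet> (\<Sigma> *v t)" .
  have "iid_copies M (\<lambda>i \<omega>. t \<bullet> \<psi> (S i \<omega>)) P (\<lambda>\<omega>. t \<bullet> \<psi> (T \<omega>))"
    by (rule iid_copies_compose[where \<psi>="\<lambda>x. t \<bullet> \<psi> x"]) (use M iid in auto)
  then have "(\<lambda>n. \<integral>\<omega>. iexp ((1 / sqrt (real n)) * (\<Sum>i<n. t \<bullet> \<psi> (S i \<omega>))) \<partial>M) \<longlonglongrightarrow> exp (- (t \<bullet> (\<Sigma> *v t)) / 2)"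
    unfolding var[symmetric]
    by (intro char_normalized_sum M P sqt) (use int mean in auto)
  then show "(\<lambda>n. \<integral>\<omega>. iexp (t \<bullet> ((1 / sqrt (real n)) *\<^sub>R (\<Sum>i<n. \<psi> (S i \<omega>)))) \<partial>M) \<longlonglongrightarrow> (\<integral>x. iexp (t \<bullet> x) \<partial>N)"
    by (simp add: char_mv_normal[OF N] inner_sum_right)
qed

section \<open>Existence of normal laws with a given covariance matrix\<close>

text \<open>Symmetric elimination: subtracting the outer product of the scaled column \<open>i\<close> clears row and
  column \<open>i\<close> and keeps the matrix positive semidefinite; the column becomes column \<open>i\<close> of the factor.\<close>

lemma psd_factorization_aux:
  fixes \<Sigma> :: "real ^ 'k ^ 'k"
  assumes "finite I" and "\<And>a b. \<Sigma> $ a $ b = \<Sigma> $ b $ a" and "\<And>x. 0 \<le> x \<bullet> (\<Sigma> *v x)"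
    and "\<And>a b. a \<notin> I \<Longrightarrow> \<Sigma> $ a $ b = 0"
  shows "\<exists>A::real ^ 'k ^ 'k. A ** transpose A = \<Sigma> \<and> (\<forall>a b. b \<notin> I \<longrightarrow> A $ a $ b = 0)"
  using assms
proof (induction I arbitrary: \<Sigma>)
  case empty
  then have "\<Sigma> = 0" by (simp add: vec_eq_iff)
  then show ?case by (intro exI[of _ 0]) (simp add: vec_eq_iff matrix_matrix_mult_def)
next
  case (insert i I)
  note sym = insert.prems(1) and psd = insert.prems(2) and supp = insert.prems(3)
  define s where "s = \<Sigma> $ i $ i"
  define w where "w x = (\<Sum>b\<in>UNIV. \<Sigma> $ i $ b * x $ b)" for x :: "real ^ 'k"
  have wx: "w x = (\<Sigma> *v x) $ i" for x by (simp add: w_def matrix_vector_mult_def)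
  \<comment> \<open>The quadratic form along a line in direction i, as a polynomial in c with the
    pivot \<open>s\<close> as leading coefficient.\<close>
  have shift: "(x + c *\<^sub>R axis i 1) \<bullet> (\<Sigma> *v (x + c *\<^sub>R axis i 1)) = x \<bullet> (\<Sigma> *v x) + 2 * c * w x + c\<^sup>2 * s" for x c
  proof -
    have 1: "\<Sigma> *v axis i 1 = (\<chi> a. \<Sigma> $ a $ i)" by (simp add: matrix_vector_mult_basis column_def)
    have 2: "x \<bullet> (\<Sigma> *v axis i 1) = w x" unfolding 1 w_def
      by (simp add: inner_vec_def sym[of i] mult.commute)
    have 3: "axis i 1 \<bullet> (\<Sigma> *v x) = w x" by (simp add: wx inner_axis' )
    have 4: "axis i 1 \<bullet> (\<Sigma> *v axis i 1) = s" by (simp add: inner_axis' 1 s_def)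
    show ?thesis
      by (simp add: matrix_vector_right_distrib inner_add_left inner_add_right matrix_vector_mult_scaleR 2 3 4 power2_eq_square algebra_simps)
  qed
  have "s \<ge> 0" using shift[of 0 1] psd[of "0 + 1 *\<^sub>R axis i 1"] by (simp add: w_def)
  show ?case
  proof (cases "s = 0")
    case True
    \<comment> \<open>With pivot 0 the form is affine in c, so nonnegativity forces its slope to
      vanish. The c used below would give the value -1.\<close>
    have row: "\<Sigma> $ i $ b = 0" for b
    proof (rule ccontr)
      assume "\<Sigma> $ i $ b \<noteq> 0"
      then have wn: "w (axis b 1) \<noteq> 0" by (simp add: wx matrix_vector_mult_basis column_def)
      define q where "q = axis b 1 \<bullet> (\<Sigma> *v axis b (1::real))"
      have "0 \<le> q + 2 * (- (q + 1) / (2 * w (axis b 1))) * w (axis b 1)"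
        using psd[of "axis b 1 + (- (q + 1) / (2 * w (axis b 1))) *\<^sub>R axis i 1"] unfolding shift q_def True by simp
      also have "\<dots> = - 1" using wn by (simp add: field_simps)
      finally show False by simp
    qed
    have "\<exists>A::real ^ 'k ^ 'k. A ** transpose A = \<Sigma> \<and> (\<forall>a b. b \<notin> I \<longrightarrow> A $ a $ b = 0)"
      by (rule insert.IH) (use sym psd supp row in \<open>metis insert_iff\<close>)+
    then show ?thesis by blast
  next
    case False
    then have "s > 0" using \<open>s \<ge> 0\<close> by simp
    define \<Sigma>' where "\<Sigma>' = (\<chi> a b. \<Sigma> $ a $ b - \<Sigma> $ a $ i * \<Sigma> $ i $ b / s)"
    have mv: "\<Sigma>' *v x = \<Sigma> *v x - (w x / s) *\<^sub>R (\<chi> a. \<Sigma> $ a $ i)" for x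
      unfolding \<Sigma>'_def w_def
      by (simp add: vec_eq_iff matrix_vector_mult_def algebra_simps sum_subtractf sum_distrib_left sum_divide_distrib)
    have xc: "x \<bullet> (\<chi> a. \<Sigma> $ a $ i) = w x" for x
      unfolding w_def by (simp add: inner_vec_def sym[of i] mult.commute)
    \<comment> \<open>\<Sigma>' is the Schur complement of the pivot: its form at x is the minimum
      over c of the polynomial in \<open>shift\<close>, attained at c = - w x / s.\<close>
    have "0 \<le> x \<bullet> (\<Sigma>' *v x)" for x
    proof -
      have "0 \<le> x \<bullet> (\<Sigma> *v x) + 2 * (- w x / s) * w x + (- w x / s)\<^sup>2 * s"
        using psd[of "x + (- w x / s) *\<^sub>R axis i 1"] unfolding shift .
      also have "\<dots> = x \<bullet> (\<Sigma>' *v x)" unfolding mv inner_diff_right inner_scaleR_right xc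
        using \<open>s > 0\<close> by (simp add: field_simps power2_eq_square)
      finally show ?thesis .
    qed
    moreover have "\<Sigma>' $ a $ b = \<Sigma>' $ b $ a" for a b
      unfolding \<Sigma>'_def by (simp add: sym[of b a] sym[of b i] sym[of i a])
    moreover have "\<Sigma>' $ a $ b = 0" if "a \<notin> I" for a b
    proof (cases "a = i")
      case True
      then show ?thesis using \<open>s > 0\<close> by (simp add: \<Sigma>'_def s_def)
    next
      case False
      then show ?thesis using supp[of a] that by (simp add: \<Sigma>'_def)
    qed
    ultimately obtain A :: "real ^ 'k ^ 'k" where A: "A ** transpose A = \<Sigma>'" "\<And>a b. b \<notin> I \<Longrightarrow> A $ a $ b = 0"
      using insert.IH by meson
    \<comment> \<open>The induction keeps the columns of \<open>A\<close> outside \<open>I\<close>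
      zero, so column i is free to carry the subtracted outer product.\<close>
    define A' where "A' = (\<chi> a b. if b = i then \<Sigma> $ a $ i / sqrt s else A $ a $ b)"
    have "(A' ** transpose A') $ a $ b = \<Sigma> $ a $ b" for a b
    proof -
      have "(A' ** transpose A') $ a $ b = (\<Sum>k\<in>UNIV. A' $ a $ k * A' $ b $ k)"
        by (simp add: matrix_matrix_mult_def transpose_def)
      also have "\<dots> = (\<Sum>k\<in>UNIV. A $ a $ k * A $ b $ k + (if k = i then \<Sigma> $ a $ i / sqrt s * (\<Sigma> $ b $ i / sqrt s) else 0))"
        using A(2)[OF insert.hyps(2)] by (intro sum.cong refl) (simp add: A'_def)
      also have "\<dots> = (A ** transpose A) $ a $ b + \<Sigma> $ a $ i * \<Sigma> $ b $ i / s"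
        using \<open>s > 0\<close> by (simp add: sum.distrib matrix_matrix_mult_def transpose_def)
      also have "\<dots> = \<Sigma> $ a $ b" unfolding A(1) by (simp add: \<Sigma>'_def sym[of b i])
      finally show ?thesis .
    qed
    moreover have "A' $ a $ b = 0" if "b \<notin> insert i I" for a b using that A(2) by (simp add: A'_def)
    ultimately show ?thesis by (intro exI[of _ A']) (auto simp: vec_eq_iff)
  qed
qed

lemma is_mv_normal_exists:
  fixes \<Sigma> :: "real ^ 'k ^ 'k"
  assumes "\<And>a b. \<Sigma> $ a $ b = \<Sigma> $ b $ a" and "\<And>x. 0 \<le> x \<bullet> (\<Sigma> *v x)"
  obtains N where "is_mv_normal N m \<Sigma>"
  using psd_factorization_aux[OF finite_class.finite_UNIV assms] unfolding is_mv_normal_def by blast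

section \<open>Independence\<close>

context prob_space
begin

lemma indep_rvD:
  assumes "indep_rv M X Y" and "A \<in> sets borel" and "B \<in> sets borel"
  shows "prob ((X -` A \<inter> space M) \<inter> (Y -` B \<inter> space M)) = prob (X -` A \<inter> space M) * prob (Y -` B \<inter> space M)"
  using assms unfolding indep_rv_def by (auto intro!: indep_setD)

lemma indep_rvI:
  assumes "X \<in> borel_measurable M" and "Y \<in> borel_measurable M"
    and "\<And>A B. A \<in> sets borel \<Longrightarrow> B \<in> sets borel \<Longrightarrow>
      prob ((X -` A \<inter> space M) \<inter> (Y -` B \<inter> space M)) = prob (X -` A \<inter> space M) * prob (Y -` B \<inter> space M)"
  shows "indep_rv M X Y"
  unfolding indep_rv_def using assms by (auto intro!: indep_setI)

lemma indep_rv_sym: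
  fixes X :: "'a \<Rightarrow> 'b::topological_space" and Y :: "'a \<Rightarrow> 'c::topological_space"
  assumes "indep_rv M X Y"
  shows "indep_rv M Y X"
proof (rule indep_rvI)
  fix A :: "'c set" and B :: "'b set" assume "A \<in> sets borel" "B \<in> sets borel"
  from indep_rvD[OF assms this(2,1)]
  show "prob ((Y -` A \<inter> space M) \<inter> (X -` B \<inter> space M)) = prob (Y -` A \<inter> space M) * prob (X -` B \<inter> space M)"
    by (subst Int_commute) simp
qed (use assms in \<open>auto simp: indep_rv_def\<close>)

text \<open>The images are identified on \<open>space M\<close> only, because the model equations
  are assumed only there.\<close>

lemma indep_rv_compose:
  assumes ind: "indep_rv M X Y" and F: "F \<in> borel_measurable borel" and G: "G \<in> borel_measurable borel"
    and X': "\<And>\<omega>. \<omega> \<in> space M \<Longrightarrow> X' \<omega> = F (X \<omega>)" and Y': "\<And>\<omega>. \<omega> \<in> space M \<Longrightarrow> Y' \<omega> = G (Y \<omega>)"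
  shows "indep_rv M X' Y'"
proof (rule indep_rvI)
  have m: "X \<in> borel_measurable M" "Y \<in> borel_measurable M" using ind by (auto simp: indep_rv_def)
  show "X' \<in> borel_measurable M"
    using measurable_compose[OF m(1) F] X' by (simp cong: measurable_cong)
  show "Y' \<in> borel_measurable M"
    using measurable_compose[OF m(2) G] Y' by (simp cong: measurable_cong)
  fix A :: "'d set" and B :: "'e set" assume AB: "A \<in> sets borel" "B \<in> sets borel"
  have "F -` A \<in> sets borel" "G -` B \<in> sets borel"
    using measurable_sets[OF F AB(1)] measurable_sets[OF G AB(2)] by auto
  note ind' = indep_rvD[OF ind this]
  have "X' -` A \<inter> space M = X -` (F -` A) \<inter> space M" using X' by auto
  moreover have "Y' -` B \<inter> space M = Y -` (G -` B) \<inter> space M" using Y' by auto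
  ultimately show "prob ((X' -` A \<inter> space M) \<inter> (Y' -` B \<inter> space M)) = prob (X' -` A \<inter> space M) * prob (Y' -` B \<inter> space M)"
    using ind' by simp
qed

text \<open>Regroups a chain of independences. On rectangles both sides become a product of three
  probabilities; rectangles are closed under intersection and generate the Borel sets of the
  product.\<close>

lemma indep_rv_Pair:
  fixes X :: "'a \<Rightarrow> 'b::second_countable_topology" and Y :: "'a \<Rightarrow> 'c::second_countable_topology"
    and W :: "'a \<Rightarrow> 'd::second_countable_topology"
  assumes X: "indep_rv M X (\<lambda>\<omega>. (Y \<omega>, W \<omega>))" and YW: "indep_rv M Y W"
  shows "indep_rv M (\<lambda>\<omega>. (X \<omega>, Y \<omega>)) W"
proof -
  have m [measurable]: "X \<in> borel_measurable M" "Y \<in> borel_measurable M" "W \<in> borel_measurable M"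
    using X YW by (auto simp: indep_rv_def)
  define \<R> where "\<R> = {A \<times> B | A B. A \<in> sets (borel :: 'b measure) \<and> B \<in> sets (borel :: 'c measure)}"
  define \<A> where "\<A> = {(\<lambda>\<omega>. (X \<omega>, Y \<omega>)) -` E \<inter> space M | E. E \<in> \<R>}"
  define \<B> where "\<B> = {W -` D \<inter> space M | D. D \<in> sets borel}"
  \<comment> \<open>Recombines the first two of the three factors into the probability of a
    rectangle.\<close>
  have XY: "indep_rv M X Y"
    by (rule indep_rv_compose[OF X, of "\<lambda>x. x" fst]) (auto simp: borel_prod[symmetric])
  have "indep_set \<A> \<B>"
  proof (rule indep_setI)
    show "\<A> \<subseteq> events"
    proof
      fix a assume "a \<in> \<A>"
      then obtain A B where AB: "A \<in> sets borel" "B \<in> sets borel"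
        and a: "a = (\<lambda>\<omega>. (X \<omega>, Y \<omega>)) -` (A \<times> B) \<inter> space M"
        unfolding \<A>_def \<R>_def by blast
      have "a = (X -` A \<inter> space M) \<inter> (Y -` B \<inter> space M)" unfolding a by auto
      then show "a \<in> events" using measurable_sets[OF m(1) AB(1)] measurable_sets[OF m(2) AB(2)] by auto
    qed
    show "\<B> \<subseteq> events" unfolding \<B>_def by auto
    fix a b assume "a \<in> \<A>" "b \<in> \<B>"
    then obtain A B D where ABD: "A \<in> sets borel" "B \<in> sets borel" "D \<in> sets borel"
      and a: "a = (\<lambda>\<omega>. (X \<omega>, Y \<omega>)) -` (A \<times> B) \<inter> space M" and b: "b = W -` D \<inter> space M"
      unfolding \<A>_def \<B>_def \<R>_def by blast
    have BD: "B \<times> D \<in> sets borel" using ABD unfolding borel_prod[symmetric] by auto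
    have a': "a = (X -` A \<inter> space M) \<inter> (Y -` B \<inter> space M)" unfolding a by auto
    have yw: "(\<lambda>\<omega>. (Y \<omega>, W \<omega>)) -` (B \<times> D) \<inter> space M = (Y -` B \<inter> space M) \<inter> (W -` D \<inter> space M)" by auto
    have ab: "a \<inter> b = (X -` A \<inter> space M) \<inter> ((\<lambda>\<omega>. (Y \<omega>, W \<omega>)) -` (B \<times> D) \<inter> space M)" unfolding a b by auto
    have "prob (a \<inter> b) = prob (X -` A \<inter> space M) * (prob (Y -` B \<inter> space M) * prob (W -` D \<inter> space M))"
      unfolding ab indep_rvD[OF X ABD(1) BD] by (simp only: yw indep_rvD[OF YW ABD(2,3)])
    then show "prob (a \<inter> b) = prob a * prob b"
      unfolding a' b indep_rvD[OF XY ABD(1,2)] by simp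
  qed
  moreover have "Int_stable \<A>"
  proof (rule Int_stableI)
    fix a b assume "a \<in> \<A>" "b \<in> \<A>"
    then obtain A B A' B' where s: "A \<in> sets borel" "B \<in> sets borel" "A' \<in> sets borel" "B' \<in> sets borel"
      and ab: "a = (\<lambda>\<omega>. (X \<omega>, Y \<omega>)) -` (A \<times> B) \<inter> space M" "b = (\<lambda>\<omega>. (X \<omega>, Y \<omega>)) -` (A' \<times> B') \<inter> space M"
      unfolding \<A>_def \<R>_def by blast
    have "a \<inter> b = (\<lambda>\<omega>. (X \<omega>, Y \<omega>)) -` ((A \<inter> A') \<times> (B \<inter> B')) \<inter> space M" unfolding ab by auto
    moreover have "(A \<inter> A') \<times> (B \<inter> B') \<in> \<R>" unfolding \<R>_def using s by auto
    ultimately show "a \<inter> b \<in> \<A>" unfolding \<A>_def by blast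
  qed
  moreover have "Int_stable \<B>"
  proof (rule Int_stableI)
    fix a b assume "a \<in> \<B>" "b \<in> \<B>"
    then obtain A B where "A \<in> sets borel" "B \<in> sets borel" "a = W -` A \<inter> space M" "b = W -` B \<inter> space M"
      unfolding \<B>_def by blast
    then show "a \<inter> b \<in> \<B>" unfolding \<B>_def by (intro CollectI exI[of _ "A \<inter> B"]) auto
  qed
  ultimately have ind: "indep_set (sigma_sets (space M) \<A>) (sigma_sets (space M) \<B>)"
    by (rule indep_set_sigma_sets)
  have sig: "sets (borel :: ('b \<times> 'c) measure) = sigma_sets UNIV \<R>"
    unfolding borel_prod[symmetric] sets_pair_measure \<R>_def by simp
  have \<A>_eq: "sigma_sets (space M) \<A> = {(\<lambda>\<omega>. (X \<omega>, Y \<omega>)) -` E \<inter> space M | E. E \<in> sets borel}"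
    unfolding \<A>_def sig by (rule sigma_sets_vimage_commute[symmetric]) auto
  show ?thesis
  proof (rule indep_rvI)
    fix A :: "('b \<times> 'c) set" and D :: "'d set" assume AD: "A \<in> sets borel" "D \<in> sets borel"
    show "prob ((\<lambda>\<omega>. (X \<omega>, Y \<omega>)) -` A \<inter> space M \<inter> (W -` D \<inter> space M)) =
       prob ((\<lambda>\<omega>. (X \<omega>, Y \<omega>)) -` A \<inter> space M) * prob (W -` D \<inter> space M)"
      by (rule indep_setD[OF ind]) (use AD in \<open>auto simp: \<A>_eq \<B>_def\<close>)
  qed measurable
qed

text \<open>Gives access to the product rule for expectations, and translates the independence of
  \<open>\<delta>1\<close> and \<open>e\<close>.\<close>

lemma indep_rv_real:
  fixes X Y :: "'a \<Rightarrow> real"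
  shows "indep_rv M X Y \<longleftrightarrow> indep_var borel X borel Y"
proof
  assume ind: "indep_rv M X Y"
  have st: "Int_stable {X -` A \<inter> space M | A. A \<in> sets borel}" for X :: "'a \<Rightarrow> real"
  proof (rule Int_stableI)
    fix a b assume "a \<in> {X -` A \<inter> space M | A. A \<in> sets borel}" "b \<in> {X -` A \<inter> space M | A. A \<in> sets borel}"
    then obtain A B where "A \<in> sets borel" "B \<in> sets borel" "a = X -` A \<inter> space M" "b = X -` B \<inter> space M"
      by blast
    then show "a \<inter> b \<in> {X -` A \<inter> space M | A. A \<in> sets borel}"
      by (intro CollectI exI[of _ "A \<inter> B"]) auto
  qed
  show "indep_var borel X borel Y"
    unfolding indep_var_eq using ind st by (auto simp: indep_rv_def intro!: indep_set_sigma_sets)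
next
  assume ind: "indep_var borel X borel Y"
  show "indep_rv M X Y"
  proof (rule indep_rvI)
    show "X \<in> borel_measurable M" "Y \<in> borel_measurable M" using ind unfolding indep_var_eq by auto
    fix A B :: "real set" assume "A \<in> sets borel" "B \<in> sets borel"
    from indep_varD[OF ind this]
    have "prob ((\<lambda>x. (X x, Y x)) -` (A \<times> B) \<inter> space M) = prob (X -` A \<inter> space M) * prob (Y -` B \<inter> space M)" .
    moreover have "(\<lambda>x. (X x, Y x)) -` (A \<times> B) \<inter> space M = (X -` A \<inter> space M) \<inter> (Y -` B \<inter> space M)" by auto
    ultimately show "prob ((X -` A \<inter> space M) \<inter> (Y -` B \<inter> space M)) = prob (X -` A \<inter> space M) * prob (Y -` B \<inter> space M)"
      by simp
  qed
qed

lemma indep_rv_integral_mult: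
  fixes F :: "'b::topological_space \<Rightarrow> real" and G :: "'c::topological_space \<Rightarrow> real"
  assumes "indep_rv M X Y" and "F \<in> borel_measurable borel" and "G \<in> borel_measurable borel"
    and "integrable M (\<lambda>\<omega>. F (X \<omega>))" and "integrable M (\<lambda>\<omega>. G (Y \<omega>))"
  shows "integrable M (\<lambda>\<omega>. F (X \<omega>) * G (Y \<omega>))"
    and "(\<integral>\<omega>. F (X \<omega>) * G (Y \<omega>) \<partial>M) = (\<integral>\<omega>. F (X \<omega>) \<partial>M) * (\<integral>\<omega>. G (Y \<omega>) \<partial>M)"
proof -
  have "indep_rv M (\<lambda>\<omega>. F (X \<omega>)) (\<lambda>\<omega>. G (Y \<omega>))"
    by (rule indep_rv_compose[OF assms(1-3)]) auto
  then have i: "indep_var borel (\<lambda>\<omega>. F (X \<omega>)) borel (\<lambda>\<omega>. G (Y \<omega>))" unfolding indep_rv_real .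
  show "integrable M (\<lambda>\<omega>. F (X \<omega>) * G (Y \<omega>))"
    by (rule indep_var_integrable[OF i assms(4,5)])
  show "(\<integral>\<omega>. F (X \<omega>) * G (Y \<omega>) \<partial>M) = (\<integral>\<omega>. F (X \<omega>) \<partial>M) * (\<integral>\<omega>. G (Y \<omega>) \<partial>M)"
    by (rule indep_var_lebesgue_integral[OF i assms(4,5)])
qed

end

section \<open>Matrices and least squares\<close>

lemma borel_measurable_vec:
  fixes f :: "'a \<Rightarrow> 'b::euclidean_space ^ 'k"
  assumes "\<And>i. (\<lambda>x. f x $ i) \<in> borel_measurable M"
  shows "f \<in> borel_measurable M"
  by (subst borel_measurable_euclidean_space) (use assms in \<open>auto simp: Basis_vec_def inner_axis\<close>)

lemma borel_measurable_fst [measurable (raw)]: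
  fixes f :: "'a \<Rightarrow> 'b::topological_space \<times> 'c::topological_space"
  shows "f \<in> borel_measurable M \<Longrightarrow> (\<lambda>x. fst (f x)) \<in> borel_measurable M"
  by (rule measurable_compose[OF _ borel_measurable_continuous_onI]) (auto intro: continuous_intros)

lemma borel_measurable_snd [measurable (raw)]:
  fixes f :: "'a \<Rightarrow> 'b::topological_space \<times> 'c::topological_space"
  shows "f \<in> borel_measurable M \<Longrightarrow> (\<lambda>x. snd (f x)) \<in> borel_measurable M"
  by (rule measurable_compose[OF _ borel_measurable_continuous_onI]) (auto intro: continuous_intros)

lemma matrix_inv_inverse:
  fixes A :: "real ^ 'k ^ 'k"
  assumes "invertible A"
  shows "A ** matrix_inv A = mat 1" and "matrix_inv A ** A = mat 1"
  using assms someI_ex[of "\<lambda>A'. A ** A' = mat 1 \<and> A' ** A = mat 1"] unfolding invertible_def matrix_inv_def by auto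

lemma matrix_inv_unique:
  fixes A :: "real ^ 'k ^ 'k"
  assumes "A ** B = mat 1"
  shows "matrix_inv A = B"
proof -
  have "invertible A" using assms invertible_right_inverse by blast
  then have "matrix_inv A = matrix_inv A ** (A ** B)" by (simp add: assms)
  also have "\<dots> = B" by (simp add: matrix_mul_assoc matrix_inv_inverse(2)[OF \<open>invertible A\<close>])
  finally show ?thesis .
qed

lemma matrix_inv_vector:
  fixes A :: "real ^ 'k ^ 'k"
  assumes "invertible A" "A *v x = y"
  shows "x = matrix_inv A *v y"
  unfolding assms(2)[symmetric] by (simp add: matrix_vector_mul_assoc matrix_inv_inverse[OF assms(1)])

interpretation matrix_mult: bounded_bilinear "(**) :: real ^ 'b ^ 'a \<Rightarrow> real ^ 'c ^ 'b \<Rightarrow> real ^ 'c ^ 'a"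
  unfolding bilinear_conv_bounded_bilinear[symmetric] bilinear_def
  by (auto intro!: linearI simp: vec_eq_iff matrix_matrix_mult_def algebra_simps sum.distrib sum_distrib_left)

lemma matrix_inv_scaleR:
  fixes A :: "real ^ 'k ^ 'k"
  assumes "invertible A" "c \<noteq> 0"
  shows "matrix_inv (c *\<^sub>R A) = (1 / c) *\<^sub>R matrix_inv A"
  by (rule matrix_inv_unique)
    (use assms in \<open>simp add: matrix_mult.scaleR_left
      matrix_mult.scaleR_right matrix_inv_inverse\<close>)

lemma matrix_inv_symmetric:
  fixes A :: "real ^ 'k ^ 'k"
  assumes "invertible A" "transpose A = A"
  shows "transpose (matrix_inv A) = matrix_inv A"
proof -
  have "A ** transpose (matrix_inv A) = transpose (matrix_inv A ** A)"
    by (simp add: matrix_transpose_mul assms(2))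
  also have "\<dots> = mat 1" by (simp add: matrix_inv_inverse[OF assms(1)])
  finally show ?thesis by (rule matrix_inv_unique[symmetric])
qed

text \<open>The entries of the inverse as quotients of determinants; continuity and measurability of
  the inverse are both read off from this formula.\<close>

lemma matrix_inv_cramer:
  fixes A :: "real ^ 'k ^ 'k"
  assumes "invertible A"
  shows "matrix_inv A $ k $ j = det (\<chi> i l. if l = k then (axis j 1 :: real ^ 'k) $ i else A $ i $ l) / det A"
proof -
  have "A *v (matrix_inv A *v axis j 1) = axis j 1"
    by (simp add: matrix_vector_mul_assoc matrix_inv_inverse[OF assms])
  moreover have "det A \<noteq> 0" using assms by (simp add: invertible_det_nz)
  ultimately have "matrix_inv A *v axis j 1 = (\<chi> k. det (\<chi> i l. if l = k then (axis j 1 :: real ^ 'k) $ i else A $ i $ l) / det A)"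
    using cramer by blast
  then show ?thesis by (simp add: matrix_vector_mult_basis column_def vec_eq_iff)
qed

lemma continuous_on_det [continuous_intros]:
  fixes f :: "'a::topological_space \<Rightarrow> real ^ 'k ^ 'k"
  shows "continuous_on S f \<Longrightarrow> continuous_on S (\<lambda>x. det (f x))"
  unfolding det_def by (intro continuous_intros)

lemma open_invertible: "open {A :: real ^ 'k ^ 'k. invertible A}"
  unfolding invertible_det_nz by (intro open_Collect_neq continuous_intros)

lemma continuous_on_cramer:
  "continuous_on UNIV (\<lambda>A::real ^ 'k ^ 'k. det (\<chi> i l. if l = k then (axis j 1 :: real ^ 'k) $ i else A $ i $ l))"
proof (intro continuous_on_det continuous_on_vec_lambda)
  show "continuous_on UNIV (\<lambda>A::real ^ 'k ^ 'k. if l = k then (axis j 1 :: real ^ 'k) $ i else A $ i $ l)" for i l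
    by (cases "l = k") (auto intro!: continuous_intros)
qed

text \<open>Cramer's formula describes \<open>matrix_inv\<close> on invertible matrices only, but
  these form an open set, so it holds near \<open>A\<close>.\<close>

lemma isCont_matrix_inv:
  fixes A :: "real ^ 'k ^ 'k"
  assumes "invertible A"
  shows "isCont matrix_inv A"
  unfolding isCont_def
proof (intro vec_tendstoI)
  fix k j :: 'k
  let ?c = "\<lambda>A. det (\<chi> i l. if l = k then (axis j 1 :: real ^ 'k) $ i else A $ i $ l) / det A"
  have "isCont ?c A"
  proof (intro isCont_divide)
    show "isCont det A" using continuous_on_det[OF continuous_on_id[of "UNIV :: (real ^ 'k ^ 'k) set"]] by (simp add: continuous_on_eq_continuous_at)
    show "isCont (\<lambda>A. det (\<chi> i l. if l = k then (axis j 1 :: real ^ 'k) $ i else A $ i $ l)) A"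
      using continuous_on_cramer[where k=k and j=j] unfolding continuous_on_eq_continuous_at[OF open_UNIV] by blast
  qed (use assms in \<open>simp add: invertible_det_nz\<close>)
  then have "?c \<midarrow>A\<rightarrow> matrix_inv A $ k $ j" by (simp add: isCont_def matrix_inv_cramer[OF assms])
  moreover have "\<forall>\<^sub>F B in at A. ?c B = matrix_inv B $ k $ j"
    using topological_tendstoD[OF tendsto_ident_at open_invertible, of A UNIV] assms
    by (auto elim!: eventually_mono simp: matrix_inv_cramer)
  ultimately show "(\<lambda>B. matrix_inv B $ k $ j) \<midarrow>A\<rightarrow> matrix_inv A $ k $ j"
    by (rule Lim_transform_eventually)
qed

text \<open>On singular matrices \<open>matrix_inv\<close> is the constant \<open>SOME A'. False\<close>.\<close>

lemma borel_measurable_matrix_inv [measurable]: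
  "(matrix_inv :: real ^ 'k ^ 'k \<Rightarrow> real ^ 'k ^ 'k) \<in> borel_measurable borel"
proof (intro borel_measurable_vec)
  fix k j :: 'k
  let ?c = "\<lambda>A :: real ^ 'k ^ 'k. det (\<chi> i l. if l = k then (axis j 1 :: real ^ 'k) $ i else A $ i $ l) / det A"
  have "matrix_inv A = (SOME A'. False)" if "\<not> invertible A" for A :: "real ^ 'k ^ 'k"
  proof -
    have "(A ** A' = mat 1 \<and> A' ** A = mat 1) = False" for A'
      using that unfolding invertible_def by blast
    then show ?thesis unfolding matrix_inv_def by (simp only:)
  qed
  then have eq: "(\<lambda>A. matrix_inv A $ k $ j) = (\<lambda>A. if det A \<noteq> 0 then ?c A else (SOME A'. False) $ k $ j)"
    using matrix_inv_cramer by (auto simp: fun_eq_iff invertible_det_nz)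
  have [measurable]: "(det :: real ^ 'k ^ 'k \<Rightarrow> real) \<in> borel_measurable borel"
    using continuous_on_det[OF continuous_on_id[of "UNIV :: (real ^ 'k ^ 'k) set"]] by (simp add: borel_measurable_continuous_onI)
  have [measurable]: "(\<lambda>A::real ^ 'k ^ 'k. det (\<chi> i l. if l = k then (axis j 1 :: real ^ 'k) $ i else A $ i $ l)) \<in> borel_measurable borel"
    by (rule borel_measurable_continuous_onI[OF continuous_on_cramer])
  have "(\<lambda>A. if det A \<noteq> 0 then ?c A else (SOME A'. False) $ k $ j) \<in> borel_measurable borel"
    by measurable
  then show "(\<lambda>A. (matrix_inv :: real ^ 'k ^ 'k \<Rightarrow> real ^ 'k ^ 'k) A $ k $ j) \<in> borel_measurable borel"
    by (rule back_subst[where P="\<lambda>h. h \<in> borel_measurable borel"]) (rule eq[symmetric])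
qed

section \<open>Outer products, Gram matrices and normal equations\<close>

definition outer :: "real ^ 'a \<Rightarrow> real ^ 'b \<Rightarrow> real ^ 'b ^ 'a" where
  "outer x y = (\<chi> a b. x $ a * y $ b)"

lemma outer_nth [simp]: "outer x y $ a $ b = x $ a * y $ b"
  by (simp add: outer_def)

interpretation outer: bounded_bilinear outer
  unfolding bilinear_conv_bounded_bilinear[symmetric] bilinear_def
  by (auto intro!: linearI simp: vec_eq_iff algebra_simps)

interpretation matrix_vector_mult: bounded_bilinear "(*v) :: real ^ 'b ^ 'a \<Rightarrow> real ^ 'b \<Rightarrow> real ^ 'a"
  unfolding bilinear_conv_bounded_bilinear[symmetric] bilinear_def
  by (auto intro!: linearI simp: vec_eq_iff matrix_vector_mult_def algebra_simps sum.distrib sum_distrib_left)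

lemma bounded_linear_transpose: "bounded_linear (transpose :: real ^ 'b ^ 'a \<Rightarrow> real ^ 'a ^ 'b)"
  unfolding linear_conv_bounded_linear[symmetric]
  by (auto intro!: linearI simp: vec_eq_iff transpose_def)

lemmas linear_transpose = bounded_linear.linear[OF bounded_linear_transpose]

lemma borel_measurable_bounded_bilinear:
  fixes h :: "'a::euclidean_space \<Rightarrow> 'b::euclidean_space \<Rightarrow> 'c::euclidean_space"
  assumes "bounded_bilinear h" "f \<in> borel_measurable M" "g \<in> borel_measurable M"
  shows "(\<lambda>x. h (f x) (g x)) \<in> borel_measurable M"
  by (rule borel_measurable_continuous_Pair[OF assms(2,3)])
    (intro bounded_bilinear.continuous_on[OF assms(1)] continuous_intros)

lemmas borel_measurable_outer [measurable (raw)] = borel_measurable_bounded_bilinear[OF outer.bounded_bilinear_axioms]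
lemmas borel_measurable_matrix_vector_mult [measurable (raw)] =
  borel_measurable_bounded_bilinear[OF matrix_vector_mult.bounded_bilinear_axioms]
lemmas borel_measurable_matrix_mult [measurable (raw)] =
  borel_measurable_bounded_bilinear[OF matrix_mult.bounded_bilinear_axioms]

lemma borel_measurable_transpose [measurable (raw)]:
  "f \<in> borel_measurable M \<Longrightarrow> (\<lambda>x. transpose (f x) :: real ^ 'a ^ 'b) \<in> borel_measurable M"
  by (rule measurable_compose[OF _ borel_measurable_continuous_onI])
     (auto intro: linear_continuous_on bounded_linear_transpose)

lemma outer_mult_vec: "outer x y *v z = (y \<bullet> z) *\<^sub>R x"
  by (simp add: vec_eq_iff matrix_vector_mult_def inner_vec_def sum_distrib_left mult_ac)

lemma matrix_mult_outer: "A ** outer x y = outer (A *v x) y"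
  by (simp add: vec_eq_iff matrix_vector_mult_def matrix_matrix_mult_def sum_distrib_left mult_ac)

lemma outer_mult_matrix: "outer x y ** transpose A = outer x (A *v y)"
  by (simp add: vec_eq_iff matrix_vector_mult_def matrix_matrix_mult_def transpose_def sum_distrib_left mult_ac)

lemma transpose_outer: "transpose (outer x y) = outer y x"
  by (simp add: vec_eq_iff transpose_def mult.commute)

lemma gram_eq_sum_outer: "gram n R = (\<Sum>i<n. outer (R i) (R i))"
  by (simp add: gram_def vec_eq_iff)

lemma gram_mult_vec: "gram n R *v x = (\<Sum>i<n. (R i \<bullet> x) *\<^sub>R R i)"
  unfolding gram_eq_sum_outer
  by (simp add: matrix_vector_mult.sum_left outer_mult_vec)

text \<open>Moving \<open>b\<close> by t in a direction d changes the sum of squares by - 2 t p +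
  t\<twosuperior> q, where p is the inner product of the residuals with the fitted direction. A
  minimizer therefore has p = 0 for every d, whatever the rank of the regressors.\<close>

lemma least_squares_normal_equations:
  assumes "least_squares n R y b"
  shows "gram n R *v b = (\<Sum>i<n. y i *\<^sub>R R i)"
proof -
  define r where "r i = y i - R i \<bullet> b" for i
  have orth: "(\<Sum>i<n. r i * (R i \<bullet> d)) = 0" for d
  proof (rule ccontr)
    define p where "p = (\<Sum>i<n. r i * (R i \<bullet> d))"
    define q where "q = (\<Sum>i<n. (R i \<bullet> d)\<^sup>2)"
    assume "(\<Sum>i<n. r i * (R i \<bullet> d)) \<noteq> 0"
    then have p: "p \<noteq> 0" by (simp add: p_def)
    have q: "q \<ge> 0" unfolding q_def by (intro sum_nonneg) simp
    have le: "0 \<le> - 2 * t * p + t\<^sup>2 * q" for t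
    proof -
      have "(\<Sum>i<n. (r i)\<^sup>2) \<le> (\<Sum>i<n. (y i - R i \<bullet> (b + t *\<^sub>R d))\<^sup>2)"
        using assms unfolding least_squares_def r_def by blast
      also have "\<dots> = (\<Sum>i<n. (r i)\<^sup>2 + (- 2 * t) * (r i * (R i \<bullet> d)) + t\<^sup>2 * (R i \<bullet> d)\<^sup>2)"
        by (intro sum.cong refl) (simp add: r_def inner_add_right power2_eq_square algebra_simps)
      also have "\<dots> = (\<Sum>i<n. (r i)\<^sup>2) + (- 2 * t) * p + t\<^sup>2 * q"
        by (simp add: sum.distrib sum_subtractf sum_negf sum_distrib_left p_def q_def)
      finally show ?thesis by simp
    qed
    \<comment> \<open>The optimal step is p / q; since q may be 0, q + 1 is used, which still makes
      the change negative.\<close>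
    define t where "t = p / (q + 1)"
    have t: "p = t * (q + 1)" "t \<noteq> 0" using p q by (auto simp: t_def)
    have "0 \<le> - 2 * t * p + t\<^sup>2 * q" by (rule le)
    also have "\<dots> = - (t\<^sup>2 * (q + 2))" unfolding t(1) by (simp add: algebra_simps power2_eq_square)
    also have "\<dots> < 0" using t q by simp
    finally show False by simp
  qed
  have "((\<Sum>i<n. y i *\<^sub>R R i) - gram n R *v b) \<bullet> d = 0" for d
    using orth[of d] by (simp add: gram_mult_vec inner_diff_left inner_sum_left r_def sum_subtractf[symmetric] left_diff_distrib)
  from this[of "(\<Sum>i<n. y i *\<^sub>R R i) - gram n R *v b"] show ?thesis by simp
qed

text \<open>Instantiated with the first-stage error as \<open>D\<close>, this separates the
  dependence on the estimated coefficients from moments of i.i.d. rows, so that limits follow by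
  continuity at D = 0.\<close>

lemma gram_shift:
  fixes v :: "nat \<Rightarrow> real ^ 'a" and w :: "nat \<Rightarrow> real ^ 'b"
  shows "gram n (\<lambda>i. w i - (v i \<bullet> D) *\<^sub>R u) = gram n w - outer ((\<Sum>i<n. outer (w i) (v i)) *v D) u
     - outer u ((\<Sum>i<n. outer (w i) (v i)) *v D) + (D \<bullet> (gram n v *v D)) *\<^sub>R outer u u"
  unfolding gram_mult_vec
  by (simp add: vec_eq_iff gram_def matrix_vector_mult.sum_left outer_mult_vec
    inner_sum_right inner_commute[of D] sum_distrib_right sum_distrib_left algebra_simps sum.distrib sum_subtractf)

lemma outer_shift:
  fixes v :: "nat \<Rightarrow> real ^ 'a" and w :: "nat \<Rightarrow> real ^ 'b"
  shows "(\<Sum>i<n. outer (w i - (v i \<bullet> D) *\<^sub>R u) (v i)) = (\<Sum>i<n. outer (w i) (v i)) - outer u (gram n v *v D)"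
  unfolding gram_mult_vec
  by (simp add: vec_eq_iff sum_distrib_left algebra_simps sum_subtractf)

text \<open>The first-stage part of \<open>Dmat\<close> factors through the cross moments of W and
  V, so the double sum over observations becomes a product of matrices whose size does not grow with
  n.\<close>

lemma sandwich_Dmat:
  fixes V :: "nat \<Rightarrow> real ^ 'a" and W :: "nat \<Rightarrow> real ^ 'b"
  shows "sandwich n W (Dmat n V se \<rho> s1) = se *\<^sub>R gram n W +
     (\<rho>\<^sup>2 * s1) *\<^sub>R ((\<Sum>i<n. outer (W i) (V i)) ** matrix_inv (gram n V) ** transpose (\<Sum>i<n. outer (W i) (V i)))"
proof -
  let ?C = "matrix_inv (gram n V)"
  have "(\<Sum>i<n. outer (W i) (V i)) ** ?C ** transpose (\<Sum>i<n. outer (W i) (V i)) =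
     (\<Sum>i<n. \<Sum>j<n. outer (W i) (V i) ** ?C ** outer (V j) (W j))"
    by (simp add: matrix_mult.sum_left matrix_mult.sum_right
       linear_sum[OF linear_transpose] transpose_outer) (rule sum.swap)
  also have "\<dots> = (\<Sum>i<n. \<Sum>j<n. (V i \<bullet> (?C *v V j)) *\<^sub>R outer (W i) (W j))"
  proof (intro sum.cong refl)
    fix i j
    have "outer (W i) (V i) ** ?C ** outer (V j) (W j) = outer (outer (W i) (V i) *v (?C *v V j)) (W j)"
      by (simp add: matrix_mult_outer matrix_vector_mul_assoc)
    also have "\<dots> = (V i \<bullet> (?C *v V j)) *\<^sub>R outer (W i) (W j)"
      by (simp add: outer_mult_vec vec_eq_iff)
    finally show "outer (W i) (V i) ** ?C ** outer (V j) (W j) = (V i \<bullet> (?C *v V j)) *\<^sub>R outer (W i) (W j)" .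
  qed
  finally have eq: "(\<Sum>i<n. outer (W i) (V i)) ** ?C ** transpose (\<Sum>i<n. outer (W i) (V i)) =
    (\<Sum>i<n. \<Sum>j<n. (V i \<bullet> (?C *v V j)) *\<^sub>R outer (W i) (W j))" .
  show ?thesis unfolding eq
  proof (intro vec_eq_iff[THEN iffD2] allI)
    fix a b
    have "sandwich n W (Dmat n V se \<rho> s1) $ a $ b =
       (\<Sum>i<n. \<Sum>j<n. (if i = j then se * (W i $ a * W j $ b) else 0) + \<rho>\<^sup>2 * s1 * ((V i \<bullet> (?C *v V j)) * (W i $ a * W j $ b)))"
      unfolding sandwich_def Dmat_def cov1_def
      by (auto simp: scaleR_matrix_vector_assoc[symmetric] algebra_simps intro!: sum.cong)
    also have "\<dots> = se * (\<Sum>i<n. W i $ a * W i $ b) + \<rho>\<^sup>2 * s1 * (\<Sum>i<n. \<Sum>j<n. (V i \<bullet> (?C *v V j)) * (W i $ a * W j $ b))"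
      by (simp add: sum.distrib sum_distrib_left)
    finally show "sandwich n W (Dmat n V se \<rho> s1) $ a $ b =
      (se *\<^sub>R gram n W + (\<rho>\<^sup>2 * s1) *\<^sub>R (\<Sum>i<n. \<Sum>j<n. (V i \<bullet> (?C *v V j)) *\<^sub>R outer (W i) (W j))) $ a $ b"
      by (simp add: gram_def)
  qed
qed

lemma second_moment_quadratic:
  fixes R :: "'w \<Rightarrow> real ^ 'k"
  assumes int: "integrable P (\<lambda>\<omega>. outer (R \<omega>) (R \<omega>))"
  shows "integrable P (\<lambda>\<omega>. (R \<omega> \<bullet> x)\<^sup>2)"
    and "(\<integral>\<omega>. (R \<omega> \<bullet> x)\<^sup>2 \<partial>P) = x \<bullet> ((\<integral>\<omega>. outer (R \<omega>) (R \<omega>) \<partial>P) *v x)"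
proof -
  have bl: "bounded_linear (\<lambda>A::real ^ 'k ^ 'k. x \<bullet> (A *v x))"
    by (intro bounded_linear_compose[OF bounded_linear_inner_right]
        matrix_vector_mult.bounded_linear_left)
  have eq: "x \<bullet> (outer (R \<omega>) (R \<omega>) *v x) = (R \<omega> \<bullet> x)\<^sup>2" for \<omega>
    by (simp add: outer_mult_vec inner_commute power2_eq_square)
  show "integrable P (\<lambda>\<omega>. (R \<omega> \<bullet> x)\<^sup>2)"
    and "(\<integral>\<omega>. (R \<omega> \<bullet> x)\<^sup>2 \<partial>P) = x \<bullet> ((\<integral>\<omega>. outer (R \<omega>) (R \<omega>) \<partial>P) *v x)"
    using integrable_bounded_linear[OF bl int] integral_bounded_linear[OF bl int] by (simp_all add: eq)
qed

text \<open>A kernel vector x makes the second moment of R \<bullet> x vanish, that is, gives an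
  almost sure linear relation.\<close>

lemma invertible_second_moment:
  fixes R :: "'w \<Rightarrow> real ^ 'k"
  assumes "lin_indep_rv P R" and int: "integrable P (\<lambda>\<omega>. outer (R \<omega>) (R \<omega>))"
  shows "invertible (\<integral>\<omega>. outer (R \<omega>) (R \<omega>) \<partial>P)"
proof -
  have "x = 0" if "(\<integral>\<omega>. outer (R \<omega>) (R \<omega>) \<partial>P) *v x = 0" for x
  proof -
    have "AE \<omega> in P. (R \<omega> \<bullet> x)\<^sup>2 = 0"
      using integral_nonneg_eq_0_iff_AE[of P "\<lambda>\<omega>. (R \<omega> \<bullet> x)\<^sup>2"] second_moment_quadratic[OF int, of x] that by simp
    then have "AE \<omega> in P. x \<bullet> R \<omega> = 0" by (simp add: inner_commute)
    then show "x = 0" using assms(1) unfolding lin_indep_rv_def by blast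
  qed
  then show ?thesis
    using matrix_left_invertible_ker invertible_left_inverse by blast
qed

lemma integrable_euclidean:
  fixes f :: "'a \<Rightarrow> 'b::euclidean_space"
  assumes "\<And>b. b \<in> Basis \<Longrightarrow> integrable M (\<lambda>x. f x \<bullet> b)"
  shows "integrable M f"
proof -
  have "integrable M (\<lambda>x. \<Sum>b\<in>Basis. (f x \<bullet> b) *\<^sub>R b)"
    using assms by (intro Bochner_Integration.integrable_sum integrable_scaleR_left) auto
  then show ?thesis by (simp add: euclidean_representation)
qed

lemma integrable_outer:
  fixes x :: "'w \<Rightarrow> real ^ 'a" and y :: "'w \<Rightarrow> real ^ 'b"
  assumes [measurable]: "x \<in> borel_measurable P" "y \<in> borel_measurable P"
    and "integrable P (\<lambda>\<omega>. (norm (x \<omega>))\<^sup>2)" "integrable P (\<lambda>\<omega>. (norm (y \<omega>))\<^sup>2)"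
  shows "integrable P (\<lambda>\<omega>. outer (x \<omega>) (y \<omega>))"
proof (rule integrable_euclidean)
  fix b :: "real ^ 'b ^ 'a" assume "b \<in> Basis"
  then obtain i j where b: "b = axis i (axis j 1)" by (auto simp: Basis_vec_def)
  have "integrable P (\<lambda>\<omega>. x \<omega> $ i * y \<omega> $ j)"
    by (intro square_integrable_mult square_integrable_nth assms) measurable
  then show "integrable P (\<lambda>\<omega>. outer (x \<omega>) (y \<omega>) \<bullet> b)" by (simp add: b inner_axis)
qed

section \<open>Regression with an estimated control variable\<close>

text \<open>Includes x = 0, where both sides are 0 by the convention for division, so the empty
  sample needs no separate treatment.\<close>

lemma sqrt_times_inverse:
  assumes "x \<ge> 0"
  shows "sqrt x * (1 / x) = 1 / sqrt x"
proof (cases "x = 0")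
  case False
  have "sqrt x * sqrt x = x" using assms by simp
  then show ?thesis using False by (simp add: frac_eq_eq)
qed simp

text \<open>The second stage in a form that no longer mentions the model: \<open>v\<close> and \<open>w\<close> are the regressors of
  the two stages with the true control variable \<open>d\<close> in place of the residual, \<open>\<eta>\<close> is the error of
  the second stage, and \<open>u\<close> is the direction in which the estimated control variable perturbs \<open>w\<close>.\<close>

locale control_function_sample = M: prob_space M + P: prob_space P
  for M :: "'s measure" and P :: "'w measure" +
  fixes S :: "nat \<Rightarrow> 's \<Rightarrow> 'o::topological_space" and T :: "'w \<Rightarrow> 'o"
    and v :: "'o \<Rightarrow> real ^ 'a" and w :: "'o \<Rightarrow> real ^ 'b" and d \<eta> :: "'o \<Rightarrow> real"
    and u B :: "real ^ 'b" and b0 :: "real ^ 'a" and \<rho> se s1 :: real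
    and bhat :: "nat \<Rightarrow> 's \<Rightarrow> real ^ 'a" and Bhat :: "nat \<Rightarrow> 's \<Rightarrow> real ^ 'b"
  assumes iid: "iid_copies M S P T" and T_measurable [measurable]: "T \<in> borel_measurable P"
    and measurable_functions [measurable]: "v \<in> borel_measurable borel" "w \<in> borel_measurable borel"
      "d \<in> borel_measurable borel" "\<eta> \<in> borel_measurable borel"
    and measurable_estimators [measurable]: "\<And>n. bhat n \<in> borel_measurable M" "\<And>n. Bhat n \<in> borel_measurable M"
    and sq_v: "integrable P (\<lambda>\<omega>. (norm (v (T \<omega>)))\<^sup>2)" and sq_w: "integrable P (\<lambda>\<omega>. (norm (w (T \<omega>)))\<^sup>2)"
    and sq_dv: "integrable P (\<lambda>\<omega>. (norm (d (T \<omega>) *\<^sub>R v (T \<omega>)))\<^sup>2)"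
    and sq_\<eta>w: "integrable P (\<lambda>\<omega>. (norm (\<eta> (T \<omega>) *\<^sub>R w (T \<omega>)))\<^sup>2)"
    and int_\<eta>v: "integrable P (\<lambda>\<omega>. \<eta> (T \<omega>) *\<^sub>R v (T \<omega>))" and mean_\<eta>v: "(\<integral>\<omega>. \<eta> (T \<omega>) *\<^sub>R v (T \<omega>) \<partial>P) = 0"
    and mean_dv: "(\<integral>\<omega>. d (T \<omega>) *\<^sub>R v (T \<omega>) \<partial>P) = 0" and mean_\<eta>w: "(\<integral>\<omega>. \<eta> (T \<omega>) *\<^sub>R w (T \<omega>) \<partial>P) = 0"
    and var_dv: "(\<integral>\<omega>. outer (d (T \<omega>) *\<^sub>R v (T \<omega>)) (d (T \<omega>) *\<^sub>R v (T \<omega>)) \<partial>P) = s1 *\<^sub>R (\<integral>\<omega>. outer (v (T \<omega>)) (v (T \<omega>)) \<partial>P)"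
    and var_\<eta>w: "(\<integral>\<omega>. outer (\<eta> (T \<omega>) *\<^sub>R w (T \<omega>)) (\<eta> (T \<omega>) *\<^sub>R w (T \<omega>)) \<partial>P) = se *\<^sub>R (\<integral>\<omega>. outer (w (T \<omega>)) (w (T \<omega>)) \<partial>P)"
    and cov_\<eta>w_dv: "(\<integral>\<omega>. outer (\<eta> (T \<omega>) *\<^sub>R w (T \<omega>)) (d (T \<omega>) *\<^sub>R v (T \<omega>)) \<partial>P) = 0"
    and inv_Gv: "invertible (\<integral>\<omega>. outer (v (T \<omega>)) (v (T \<omega>)) \<partial>P)"
    and inv_Gw: "invertible (\<integral>\<omega>. outer (w (T \<omega>)) (w (T \<omega>)) \<partial>P)"
    and \<rho>: "u \<bullet> B = \<rho>"
    and first_stage: "\<And>n \<omega>. \<omega> \<in> space M \<Longrightarrow>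
      least_squares n (\<lambda>i. v (S i \<omega>)) (\<lambda>i. d (S i \<omega>) + v (S i \<omega>) \<bullet> b0) (bhat n \<omega>)"
    and second_stage: "\<And>n \<omega>. \<omega> \<in> space M \<Longrightarrow>
      least_squares n (\<lambda>i. w (S i \<omega>) - (v (S i \<omega>) \<bullet> (bhat n \<omega> - b0)) *\<^sub>R u)
        (\<lambda>i. \<eta> (S i \<omega>) + w (S i \<omega>) \<bullet> B) (Bhat n \<omega>)"
begin

lemma S_measurable [measurable]: "S i \<in> borel_measurable M"
  by (rule iid_copies_measurable[OF M.prob_space_axioms iid])

definition "Gv = (\<integral>\<omega>. outer (v (T \<omega>)) (v (T \<omega>)) \<partial>P)"
definition "Gw = (\<integral>\<omega>. outer (w (T \<omega>)) (w (T \<omega>)) \<partial>P)"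
definition "H = (\<integral>\<omega>. outer (w (T \<omega>)) (v (T \<omega>)) \<partial>P)"
text \<open>This matrix has two roles: it is the limit of the normalized \<open>sandwich\<close> and
  the second moment of the influence function \<open>\<xi>\<close>.\<close>

definition "EWDW = se *\<^sub>R Gw + (\<rho>\<^sup>2 * s1) *\<^sub>R (H ** matrix_inv Gv ** transpose H)"

abbreviation "V \<omega> i \<equiv> v (S i \<omega>)"
definition "W n \<omega> i = w (S i \<omega>) - (V \<omega> i \<bullet> (bhat n \<omega> - b0)) *\<^sub>R u"
definition "Gv_n n \<omega> = (1 / real n) *\<^sub>R gram n (V \<omega>)"
definition "Gw_n n \<omega> = (1 / real n) *\<^sub>R gram n (W n \<omega>)"
definition "H_n n \<omega> = (1 / real n) *\<^sub>R (\<Sum>i<n. outer (W n \<omega> i) (V \<omega> i))"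
definition "m_n n \<omega> = (1 / real n) *\<^sub>R (\<Sum>i<n. \<eta> (S i \<omega>) *\<^sub>R V \<omega> i)"
text \<open>Built from the unperturbed rows, so its values along the sample are i.i.d.; the
  perturbation is left to \<open>Gw_n\<close> and \<open>H_n\<close>, of which only the limits
  matter.\<close>

definition "score x = (d x *\<^sub>R v x, \<eta> x *\<^sub>R w x)"
definition "score_n n \<omega> = (1 / real n) *\<^sub>R (\<Sum>i<n. score (S i \<omega>))"

lemma score_measurable [measurable]: "score \<in> borel_measurable borel"
  unfolding score_def[abs_def] by measurable

lemma sq_score: "integrable P (\<lambda>\<omega>. (norm (score (T \<omega>)))\<^sup>2)"
  using Bochner_Integration.integrable_add[OF sq_dv sq_\<eta>w] by (simp add: score_def norm_Pair)

lemma integrable_score: "integrable P (\<lambda>\<omega>. score (T \<omega>))"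
  by (rule P.square_norm_integrable_imp_integrable[OF _ sq_score]) measurable

lemma mean_score: "(\<integral>\<omega>. score (T \<omega>) \<partial>P) = 0"
  using integral_bounded_linear[OF bounded_linear_fst integrable_score]
    integral_bounded_linear[OF bounded_linear_snd integrable_score]
  by (intro prod_eqI) (auto simp: score_def mean_dv mean_\<eta>w)

lemma integrable_outer_products:
  "integrable P (\<lambda>\<omega>. outer (v (T \<omega>)) (v (T \<omega>)))"
  "integrable P (\<lambda>\<omega>. outer (w (T \<omega>)) (w (T \<omega>)))"
  "integrable P (\<lambda>\<omega>. outer (w (T \<omega>)) (v (T \<omega>)))"
  by (intro integrable_outer sq_v sq_w; measurable)+

lemma weak_law:
  fixes \<psi> :: "'o \<Rightarrow> 'c::euclidean_space"
  assumes "\<psi> \<in> borel_measurable borel" "integrable P (\<lambda>\<omega>. \<psi> (T \<omega>))"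
  shows "conv_in_prob M (\<lambda>n \<omega>. (1 / real n) *\<^sub>R (\<Sum>i<n. \<psi> (S i \<omega>))) (\<integral>\<omega>. \<psi> (T \<omega>) \<partial>P)"
  by (rule weak_law_euclidean[OF M.prob_space_axioms iid P.prob_space_axioms T_measurable assms])

section \<open>Limits of the sample moments and of the first stage\<close>

lemma conv_Gv: "conv_in_prob M Gv_n Gv"
  unfolding Gv_n_def[abs_def] Gv_def gram_eq_sum_outer
  by (rule weak_law[of "\<lambda>x. outer (v x) (v x)"]) (auto intro: integrable_outer_products)

lemma conv_m: "conv_in_prob M m_n 0"
  unfolding m_n_def[abs_def] mean_\<eta>v[symmetric]
  by (rule weak_law[of "\<lambda>x. \<eta> x *\<^sub>R v x"]) (auto intro: int_\<eta>v)

lemma conv_score: "conv_in_prob M score_n 0"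
  unfolding score_n_def[abs_def] mean_score[symmetric]
  by (rule weak_law) (auto intro: integrable_score)

lemma tight_score: "tight_seq M (\<lambda>n \<omega>. sqrt (real n) *\<^sub>R score_n n \<omega>)"
proof -
  have "sqrt (real n) *\<^sub>R score_n n \<omega> = (1 / sqrt (real n)) *\<^sub>R (\<Sum>i<n. score (S i \<omega>))" for n \<omega>
    unfolding score_n_def scaleR_scaleR sqrt_times_inverse[OF of_nat_0_le_iff] ..
  then show ?thesis
    using normalized_sum_tight[OF M.prob_space_axioms iid P.prob_space_axioms T_measurable score_measurable sq_score mean_score]
    by simp
qed

text \<open>Invertible matrices form an open neighborhood of the limit; n > 0 is added because the
  normalized moments divide by n.\<close>

lemma whp_invertible:
  assumes "conv_in_prob M A G" and "invertible (G :: real ^ 'c ^ 'c)"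
  shows "whp M (\<lambda>n \<omega>. n > 0 \<and> invertible (A n \<omega>))"
  using M.whp_conj[OF whp_eventually[of 1 M "\<lambda>n \<omega>. n > 0"] conv_in_prob_nhds[OF assms(1) open_invertible]] assms(2)
  by auto

lemma isCont_matrix_inv_mult:
  fixes A :: "real ^ 'c ^ 'c"
  assumes "invertible A"
  shows "isCont (\<lambda>p. matrix_inv (fst p) *v snd p) (A, x)"
  unfolding isCont_def
  by (intro matrix_vector_mult.tendsto isCont_tendsto_compose[OF isCont_matrix_inv]
     tendsto_eq_intros refl | simp add: assms)+

lemma first_stage_error:
  assumes "n > 0" "invertible (Gv_n n \<omega>)" "\<omega> \<in> space M"
  shows "bhat n \<omega> - b0 = matrix_inv (Gv_n n \<omega>) *v fst (score_n n \<omega>)"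
proof (rule matrix_inv_vector[OF assms(2)])
  have "gram n (V \<omega>) *v bhat n \<omega> = (\<Sum>i<n. d (S i \<omega>) *\<^sub>R V \<omega> i) + gram n (V \<omega>) *v b0"
    using least_squares_normal_equations[OF first_stage[OF assms(3)]]
    by (simp add: gram_mult_vec scaleR_add_left sum.distrib)
  then have "gram n (V \<omega>) *v (bhat n \<omega> - b0) = (\<Sum>i<n. d (S i \<omega>) *\<^sub>R V \<omega> i)"
    by (simp add: matrix_vector_mult_diff_distrib)
  then show "Gv_n n \<omega> *v (bhat n \<omega> - b0) = fst (score_n n \<omega>)"
    by (simp add: Gv_n_def score_n_def score_def fst_sum scaleR_matrix_vector_assoc[symmetric])
qed

lemma conv_bhat: "conv_in_prob M bhat b0"
proof -
  have [measurable]: "Gv_n n \<in> borel_measurable M" "score_n n \<in> borel_measurable M" for n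
    using conv_Gv conv_score by (auto intro: conv_in_prob_measurable)
  have "conv_in_prob M (\<lambda>n \<omega>. b0 + matrix_inv (Gv_n n \<omega>) *v fst (score_n n \<omega>))
      (b0 + matrix_inv Gv *v fst (0 :: (real ^ 'a) \<times> (real ^ 'b)))"
  proof (rule M.conv_in_prob_isCont[OF M.conv_in_prob_Pair[OF conv_Gv conv_score], of "\<lambda>p. b0 + matrix_inv (fst p) *v fst (snd p)", simplified fst_conv snd_conv])
    have "isCont (\<lambda>p. matrix_inv (fst (fst p, fst (snd p))) *v snd (fst p, fst (snd p))) (Gv, 0 :: (real ^ 'a) \<times> (real ^ 'b))"
      by (rule isCont_o2[where g="\<lambda>p. matrix_inv (fst p) *v snd p"])
         (auto intro!: continuous_intros isCont_matrix_inv_mult inv_Gv[folded Gv_def])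
    then show "isCont (\<lambda>p. b0 + matrix_inv (fst p) *v fst (snd p)) (Gv, 0 :: (real ^ 'a) \<times> (real ^ 'b))"
      by (intro continuous_intros) simp
    show "(\<lambda>\<omega>. b0 + matrix_inv (Gv_n n \<omega>) *v fst (score_n n \<omega>)) \<in> borel_measurable M" for n
      by measurable
  qed
  then have "conv_in_prob M (\<lambda>n \<omega>. b0 + matrix_inv (Gv_n n \<omega>) *v fst (score_n n \<omega>)) b0"
    by simp
  then show ?thesis
  proof (rule M.conv_in_prob_modify)
    show "whp M (\<lambda>n \<omega>. b0 + matrix_inv (Gv_n n \<omega>) *v fst (score_n n \<omega>) = bhat n \<omega>)"
      by (rule whp_mono[OF whp_invertible[OF conv_Gv inv_Gv[folded Gv_def]]])
         (simp add: first_stage_error[symmetric])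
  qed measurable
qed

lemma conv_first_stage_error: "conv_in_prob M (\<lambda>n \<omega>. bhat n \<omega> - b0) 0"
  using M.conv_in_prob_isCont[OF conv_bhat, of "\<lambda>x. x - b0"] by (simp add: continuous_intros)

lemma W_measurable [measurable]: "(\<lambda>\<omega>. W n \<omega> i) \<in> borel_measurable M"
  unfolding W_def by measurable

lemma conv_H: "conv_in_prob M H_n H"
proof -
  let ?H0 = "\<lambda>n \<omega>. (1 / real n) *\<^sub>R (\<Sum>i<n. outer (w (S i \<omega>)) (v (S i \<omega>)))"
  have "conv_in_prob M ?H0 H"
    unfolding H_def by (rule weak_law[of "\<lambda>x. outer (w x) (v x)"]) (auto intro: integrable_outer_products)
  note c = M.conv_in_prob_Pair[OF this M.conv_in_prob_Pair[OF conv_Gv conv_first_stage_error]]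
  have eq: "H_n n \<omega> = ?H0 n \<omega> - outer u (Gv_n n \<omega> *v (bhat n \<omega> - b0))" for n \<omega>
    unfolding H_n_def W_def outer_shift Gv_n_def
    by (simp add: scaleR_diff_right outer.scaleR_right scaleR_matrix_vector_assoc[symmetric])
  have "conv_in_prob M (\<lambda>n \<omega>. ?H0 n \<omega> - outer u (Gv_n n \<omega> *v (bhat n \<omega> - b0))) (H - outer u (Gv *v 0))"
  proof (rule M.conv_in_prob_isCont[OF c, of "\<lambda>p. fst p - outer u (fst (snd p) *v snd (snd p))", simplified fst_conv snd_conv])
    show "isCont (\<lambda>p. fst p - outer u (fst (snd p) *v snd (snd p))) (H, Gv, 0)"
      by (intro continuous_intros outer.continuous
         matrix_vector_mult.continuous)
    show "(\<lambda>\<omega>. ?H0 n \<omega> - outer u (Gv_n n \<omega> *v (bhat n \<omega> - b0))) \<in> borel_measurable M" for n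
      using conv_in_prob_measurable[OF conv_Gv, of n] by measurable
  qed
  then show ?thesis
    by (simp add: eq[abs_def] outer.zero_right)
qed

text \<open>At first-stage error 0 the polynomial of \<open>gram_shift\<close> reduces to the moment
  matrix of the unperturbed rows, so estimating the control variable leaves this limit
  unchanged.\<close>

lemma conv_Gw: "conv_in_prob M Gw_n Gw"
proof -
  let ?H0 = "\<lambda>n \<omega>. (1 / real n) *\<^sub>R (\<Sum>i<n. outer (w (S i \<omega>)) (v (S i \<omega>)))"
  let ?G0 = "\<lambda>n \<omega>. (1 / real n) *\<^sub>R (\<Sum>i<n. outer (w (S i \<omega>)) (w (S i \<omega>)))"
  let ?F = "\<lambda>G H A D. G - outer (H *v D) u - outer u (H *v D) + (D \<bullet> (A *v D)) *\<^sub>R outer u u"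
  have "conv_in_prob M ?H0 H"
    unfolding H_def by (rule weak_law[of "\<lambda>x. outer (w x) (v x)"]) (auto intro: integrable_outer_products)
  note c = M.conv_in_prob_Pair[OF this M.conv_in_prob_Pair[OF conv_Gv conv_first_stage_error]]
  have "conv_in_prob M ?G0 Gw"
    unfolding Gw_def by (rule weak_law[of "\<lambda>x. outer (w x) (w x)"]) (auto intro: integrable_outer_products)
  note c = M.conv_in_prob_Pair[OF this c]
  have eq: "Gw_n n \<omega> = ?F (?G0 n \<omega>) (?H0 n \<omega>) (Gv_n n \<omega>) (bhat n \<omega> - b0)" for n \<omega>
    unfolding Gw_n_def W_def gram_shift Gv_n_def gram_eq_sum_outer[of n "\<lambda>i. w (S i \<omega>)"]
    by (simp add: scaleR_diff_right scaleR_add_right outer.scaleR_right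
       outer.scaleR_left scaleR_matrix_vector_assoc[symmetric])
  have "conv_in_prob M (\<lambda>n \<omega>. ?F (?G0 n \<omega>) (?H0 n \<omega>) (Gv_n n \<omega>) (bhat n \<omega> - b0)) (?F Gw H Gv 0)"
  proof (rule M.conv_in_prob_isCont[OF c, of "\<lambda>p. ?F (fst p) (fst (snd p)) (fst (snd (snd p))) (snd (snd (snd p)))", simplified fst_conv snd_conv])
    show "isCont (\<lambda>p. ?F (fst p) (fst (snd p)) (fst (snd (snd p))) (snd (snd (snd p)))) (Gw, H, Gv, 0)"
      by (intro continuous_intros outer.continuous
         matrix_vector_mult.continuous)
    show "(\<lambda>\<omega>. ?F (?G0 n \<omega>) (?H0 n \<omega>) (Gv_n n \<omega>) (bhat n \<omega> - b0)) \<in> borel_measurable M" for n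
      using conv_in_prob_measurable[OF conv_Gv, of n] by measurable
  qed
  then show ?thesis
    by (simp add: eq[abs_def] outer.zero_right outer.zero_left)
qed

lemma conv_sandwich:
  "conv_in_prob M (\<lambda>n \<omega>. (1 / real n) *\<^sub>R sandwich n (W n \<omega>) (Dmat n (V \<omega>) se \<rho> s1)) EWDW"
proof -
  let ?F = "\<lambda>G H A. se *\<^sub>R G + (\<rho>\<^sup>2 * s1) *\<^sub>R (H ** matrix_inv A ** transpose H)"
  note m [measurable] = conv_in_prob_measurable[OF conv_Gv] conv_in_prob_measurable[OF conv_Gw] conv_in_prob_measurable[OF conv_H]
  note c = M.conv_in_prob_Pair[OF conv_Gw M.conv_in_prob_Pair[OF conv_H conv_Gv]]
  have "conv_in_prob M (\<lambda>n \<omega>. ?F (Gw_n n \<omega>) (H_n n \<omega>) (Gv_n n \<omega>)) (?F Gw H Gv)"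
  proof (rule M.conv_in_prob_isCont[OF c, of "\<lambda>p. ?F (fst p) (fst (snd p)) (snd (snd p))", simplified fst_conv snd_conv])
    show "isCont (\<lambda>p. ?F (fst p) (fst (snd p)) (snd (snd p))) (Gw, H, Gv)"
      by (intro continuous_intros matrix_mult.continuous
         isCont_o2[OF _ isCont_matrix_inv] bounded_linear.continuous[OF bounded_linear_transpose])
        (simp add: inv_Gv[folded Gv_def])
    show "(\<lambda>\<omega>. ?F (Gw_n n \<omega>) (H_n n \<omega>) (Gv_n n \<omega>)) \<in> borel_measurable M" for n
      by measurable
  qed
  then show ?thesis unfolding EWDW_def
  proof (rule M.conv_in_prob_modify)
    show "whp M (\<lambda>n \<omega>. ?F (Gw_n n \<omega>) (H_n n \<omega>) (Gv_n n \<omega>) = (1 / real n) *\<^sub>R sandwich n (W n \<omega>) (Dmat n (V \<omega>) se \<rho> s1))"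
    proof (rule whp_mono[OF whp_invertible[OF conv_Gv inv_Gv[folded Gv_def]]])
      fix n \<omega> assume n: "n > 0 \<and> invertible (Gv_n n \<omega>)"
      then have "gram n (V \<omega>) = real n *\<^sub>R Gv_n n \<omega>" by (simp add: Gv_n_def)
      \<comment> \<open>One factor 1/n from the inverse and two factors n from the cross moments
        leave a single n, which the outer normalization removes.\<close>
      then have inv: "matrix_inv (gram n (V \<omega>)) = (1 / real n) *\<^sub>R matrix_inv (Gv_n n \<omega>)"
        using n by (simp add: matrix_inv_scaleR)
      have h: "(\<Sum>i<n. outer (W n \<omega> i) (V \<omega> i)) = real n *\<^sub>R H_n n \<omega>" using n by (simp add: H_n_def)
      have g: "gram n (W n \<omega>) = real n *\<^sub>R Gw_n n \<omega>" using n by (simp add: Gw_n_def)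
      show "?F (Gw_n n \<omega>) (H_n n \<omega>) (Gv_n n \<omega>) = (1 / real n) *\<^sub>R sandwich n (W n \<omega>) (Dmat n (V \<omega>) se \<rho> s1)"
        unfolding sandwich_Dmat inv h g using n
        by (simp add: linear_cmul[OF linear_transpose] scaleR_add_right
          matrix_mult.scaleR_left matrix_mult.scaleR_right)
    qed
    show "(\<lambda>\<omega>. (1 / real n) *\<^sub>R sandwich n (W n \<omega>) (Dmat n (V \<omega>) se \<rho> s1)) \<in> borel_measurable M" for n
      unfolding sandwich_Dmat gram_eq_sum_outer by measurable
  qed
qed

definition \<Psi> :: "(((real ^ 'b ^ 'b) \<times> (real ^ 'a ^ 'b)) \<times> ((real ^ 'a ^ 'a) \<times> (real ^ 'a))) \<Rightarrow> (real ^ 'a) \<times> (real ^ 'b) \<Rightarrow> real ^ 'b" where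
  "\<Psi> q p = matrix_inv (fst (fst q)) *v
     (snd p - ((matrix_inv (fst (snd q)) *v fst p) \<bullet> snd (snd q)) *\<^sub>R u + \<rho> *\<^sub>R (snd (fst q) *v (matrix_inv (fst (snd q)) *v fst p)))"

text \<open>Passes the factor sqrt n from the estimation error to the score; with c = 0 it shows
  that \<Psi> vanishes at score 0.\<close>

lemma \<Psi>_scaleR: "\<Psi> q (c *\<^sub>R p) = c *\<^sub>R \<Psi> q p"
  unfolding \<Psi>_def by (simp add: matrix_vector_mult_scaleR scaleR_diff_right scaleR_add_right mult.commute
    matrix_vector_right_distrib matrix_vector_mult_diff_distrib)

definition "q0 = ((Gw, H), (Gv, 0 :: real ^ 'a))"
definition "q_n n \<omega> = ((Gw_n n \<omega>, H_n n \<omega>), (Gv_n n \<omega>, m_n n \<omega>))"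

lemma conv_q: "conv_in_prob M q_n q0"
  unfolding q_n_def[abs_def] q0_def
  by (intro M.conv_in_prob_Pair conv_Gw conv_H conv_Gv conv_m)

lemma isCont_\<Psi>: "isCont (\<lambda>p. \<Psi> (fst p) (snd p)) (q0, x)"
  unfolding \<Psi>_def
  by (intro continuous_intros matrix_vector_mult.continuous isCont_o2[OF _ isCont_matrix_inv])
     (auto simp: q0_def inv_Gv[folded Gv_def] inv_Gw[folded Gw_def])

lemma \<Psi>_measurable [measurable (raw)]:
  assumes [measurable]: "X \<in> borel_measurable M" "Y \<in> borel_measurable M"
  shows "(\<lambda>\<omega>. \<Psi> (X \<omega>) (Y \<omega>)) \<in> borel_measurable M"
  unfolding \<Psi>_def by measurable

lemma second_stage_error: "whp M (\<lambda>n \<omega>. Bhat n \<omega> - B = \<Psi> (q_n n \<omega>) (score_n n \<omega>))"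
proof (rule whp_mono[OF M.whp_conj[OF whp_invertible[OF conv_Gv inv_Gv[folded Gv_def]] whp_invertible[OF conv_Gw inv_Gw[folded Gw_def]]]])
  fix n \<omega> assume sp: "\<omega> \<in> space M" and n: "(n > 0 \<and> invertible (Gv_n n \<omega>)) \<and> (n > 0 \<and> invertible (Gw_n n \<omega>))"
  define D where "D = bhat n \<omega> - b0"
  have D: "D = matrix_inv (Gv_n n \<omega>) *v fst (score_n n \<omega>)" unfolding D_def using first_stage_error n sp by blast
  have W: "W n \<omega> i = w (S i \<omega>) - (V \<omega> i \<bullet> D) *\<^sub>R u" for i by (simp add: W_def D_def)
  \<comment> \<open>Because u \<bullet> B = \<rho>, replacing w by the row actually used leaves
    \<rho> times the error of the estimated control variable in the noise.\<close>
  have resid: "\<eta> (S i \<omega>) + w (S i \<omega>) \<bullet> B = \<eta> (S i \<omega>) + \<rho> * (V \<omega> i \<bullet> D) + W n \<omega> i \<bullet> B" for i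
    unfolding W by (simp add: inner_diff_left \<rho>)
  have "gram n (W n \<omega>) *v Bhat n \<omega> = (\<Sum>i<n. (\<eta> (S i \<omega>) + w (S i \<omega>) \<bullet> B) *\<^sub>R W n \<omega> i)"
    using least_squares_normal_equations[OF second_stage[OF sp, of n]] unfolding W_def[symmetric] .
  also have "\<dots> = (\<Sum>i<n. \<eta> (S i \<omega>) *\<^sub>R W n \<omega> i) + \<rho> *\<^sub>R (\<Sum>i<n. (V \<omega> i \<bullet> D) *\<^sub>R W n \<omega> i) + gram n (W n \<omega>) *v B"
    unfolding resid by (simp add: gram_mult_vec scaleR_add_left sum.distrib scaleR_sum_right)
  also have "(\<Sum>i<n. (V \<omega> i \<bullet> D) *\<^sub>R W n \<omega> i) = (\<Sum>i<n. outer (W n \<omega> i) (V \<omega> i)) *v D"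
    by (simp add: matrix_vector_mult.sum_left outer_mult_vec)
  \<comment> \<open>Here the noise meets the perturbation of the rows. After normalization the extra
    term contains \<open>m_n\<close>, which tends to 0, so it is of smaller order.\<close>
  also have "(\<Sum>i<n. \<eta> (S i \<omega>) *\<^sub>R W n \<omega> i) = (\<Sum>i<n. \<eta> (S i \<omega>) *\<^sub>R w (S i \<omega>)) - (D \<bullet> (\<Sum>i<n. \<eta> (S i \<omega>) *\<^sub>R V \<omega> i)) *\<^sub>R u"
    unfolding W by (simp add: scaleR_diff_right sum_subtractf inner_sum_right scaleR_sum_left inner_commute)
  finally have "gram n (W n \<omega>) *v (Bhat n \<omega> - B) = (\<Sum>i<n. \<eta> (S i \<omega>) *\<^sub>R w (S i \<omega>)) - (D \<bullet> (\<Sum>i<n. \<eta> (S i \<omega>) *\<^sub>R V \<omega> i)) *\<^sub>R u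
     + \<rho> *\<^sub>R ((\<Sum>i<n. outer (W n \<omega> i) (V \<omega> i)) *v D)"
    by (simp add: matrix_vector_mult_diff_distrib)
  then have "(1 / real n) *\<^sub>R (gram n (W n \<omega>) *v (Bhat n \<omega> - B)) = (1 / real n) *\<^sub>R ((\<Sum>i<n. \<eta> (S i \<omega>) *\<^sub>R w (S i \<omega>)) - (D \<bullet> (\<Sum>i<n. \<eta> (S i \<omega>) *\<^sub>R V \<omega> i)) *\<^sub>R u
     + \<rho> *\<^sub>R ((\<Sum>i<n. outer (W n \<omega> i) (V \<omega> i)) *v D))" by simp
  then have "Gw_n n \<omega> *v (Bhat n \<omega> - B) = snd (score_n n \<omega>) - (D \<bullet> m_n n \<omega>) *\<^sub>R u + \<rho> *\<^sub>R (H_n n \<omega> *v D)"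
    by (simp add: Gw_n_def score_n_def score_def snd_sum m_n_def H_n_def scaleR_matrix_vector_assoc[symmetric] scaleR_add_right scaleR_diff_right)
  from matrix_inv_vector[OF _ this] n
  show "Bhat n \<omega> - B = \<Psi> (q_n n \<omega>) (score_n n \<omega>)"
    unfolding \<Psi>_def q_n_def by (simp add: D[symmetric])
qed

theorem consistency: "conv_in_prob M Bhat B"
proof -
  note [measurable] = conv_in_prob_measurable[OF conv_q] conv_in_prob_measurable[OF conv_score]
  have "conv_in_prob M (\<lambda>n \<omega>. B + \<Psi> (q_n n \<omega>) (score_n n \<omega>)) (B + \<Psi> q0 0)"
  proof (rule M.conv_in_prob_isCont[OF M.conv_in_prob_Pair[OF conv_q conv_score], of "\<lambda>p. B + \<Psi> (fst p) (snd p)", simplified fst_conv snd_conv])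
    show "isCont (\<lambda>p. B + \<Psi> (fst p) (snd p)) (q0, 0)" by (intro continuous_intros isCont_\<Psi>)
    show "(\<lambda>\<omega>. B + \<Psi> (q_n n \<omega>) (score_n n \<omega>)) \<in> borel_measurable M" for n by measurable
  qed
  moreover have "\<Psi> q0 0 = 0" using \<Psi>_scaleR[of q0 0 0] by simp
  ultimately have "conv_in_prob M (\<lambda>n \<omega>. B + \<Psi> (q_n n \<omega>) (score_n n \<omega>)) B" by simp
  then show ?thesis
  proof (rule M.conv_in_prob_modify)
    show "whp M (\<lambda>n \<omega>. B + \<Psi> (q_n n \<omega>) (score_n n \<omega>) = Bhat n \<omega>)"
      by (rule whp_mono[OF second_stage_error]) (metis add.commute diff_add_cancel)
  qed measurable
qed

text \<open>The influence function before multiplication by the inverse of \<open>Gw\<close>: what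
  one observation contributes once all moments are at their limits, where the term with m is
  gone.\<close>

definition "\<xi> x = \<eta> x *\<^sub>R w x + (\<rho> *\<^sub>R (H ** matrix_inv Gv)) *v (d x *\<^sub>R v x)"

lemma \<xi>_measurable [measurable]: "\<xi> \<in> borel_measurable borel"
  unfolding \<xi>_def by measurable

lemma \<Psi>_score: "\<Psi> q0 (score x) = matrix_inv Gw *v \<xi> x"
  unfolding \<Psi>_def q0_def score_def \<xi>_def
  by (simp add: matrix_vector_mul_assoc scaleR_matrix_vector_assoc[symmetric])

lemma \<Psi>_score_sum: "\<Psi> q0 (\<Sum>i\<in>I. score (f i)) = (\<Sum>i\<in>I. matrix_inv Gw *v \<xi> (f i))"
proof -
  have add: "\<Psi> q0 (p + p') = \<Psi> q0 p + \<Psi> q0 p'" for p p'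
    unfolding \<Psi>_def q0_def by (simp add: matrix_vector_right_distrib algebra_simps)
  have "linear (\<Psi> q0)" by (rule linearI) (simp_all add: add \<Psi>_scaleR)
  then show ?thesis by (simp add: linear_sum \<Psi>_score)
qed

text \<open>The mixed terms are linear images of the covariance of the two scores, which is 0. In
  the first-stage term one inverse of \<open>Gv\<close> cancels, and the symmetry of
  \<open>Gv\<close> identifies what is left.\<close>

lemma second_moment_\<xi>:
  "integrable P (\<lambda>\<omega>. outer (\<xi> (T \<omega>)) (\<xi> (T \<omega>)))" "(\<integral>\<omega>. outer (\<xi> (T \<omega>)) (\<xi> (T \<omega>)) \<partial>P) = EWDW"
proof -
  define A where "A = \<rho> *\<^sub>R (H ** matrix_inv Gv)"
  let ?x = "\<lambda>\<omega>. d (T \<omega>) *\<^sub>R v (T \<omega>)" and ?y = "\<lambda>\<omega>. \<eta> (T \<omega>) *\<^sub>R w (T \<omega>)"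
  have int: "integrable P (\<lambda>\<omega>. outer (?y \<omega>) (?y \<omega>))" "integrable P (\<lambda>\<omega>. outer (?y \<omega>) (?x \<omega>))"
     "integrable P (\<lambda>\<omega>. outer (?x \<omega>) (?x \<omega>))"
    by (intro integrable_outer sq_dv sq_\<eta>w; measurable)+
  have eq: "outer (\<xi> (T \<omega>)) (\<xi> (T \<omega>)) = outer (?y \<omega>) (?y \<omega>) + outer (?y \<omega>) (?x \<omega>) ** transpose A
      + A ** transpose (outer (?y \<omega>) (?x \<omega>)) + A ** outer (?x \<omega>) (?x \<omega>) ** transpose A" for \<omega>
    unfolding \<xi>_def A_def[symmetric] transpose_outer matrix_mult_outer outer_mult_matrix
    by (simp add: outer.add_left outer.add_right)
  have L1: "bounded_linear (\<lambda>X::real ^ 'a ^ 'b. X ** transpose A)"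
    by (rule matrix_mult.bounded_linear_left)
  have L2: "bounded_linear (\<lambda>X::real ^ 'a ^ 'b. A ** transpose X)"
    by (rule bounded_linear_compose[OF matrix_mult.bounded_linear_right bounded_linear_transpose])
  have L3: "bounded_linear (\<lambda>X::real ^ 'a ^ 'a. A ** X ** transpose A)"
    by (rule bounded_linear_compose[OF matrix_mult.bounded_linear_left matrix_mult.bounded_linear_right])
  note i = int(1) integrable_bounded_linear[OF L1 int(2)] integrable_bounded_linear[OF L2 int(2)] integrable_bounded_linear[OF L3 int(3)]
  show "integrable P (\<lambda>\<omega>. outer (\<xi> (T \<omega>)) (\<xi> (T \<omega>)))"
    unfolding eq by (intro Bochner_Integration.integrable_add i)
  have symGv: "transpose Gv = Gv"
    unfolding Gv_def integral_bounded_linear[OF bounded_linear_transpose integrable_outer_products(1), symmetric] transpose_outer ..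
  have "(\<integral>\<omega>. outer (\<xi> (T \<omega>)) (\<xi> (T \<omega>)) \<partial>P) = se *\<^sub>R Gw + A ** (s1 *\<^sub>R Gv) ** transpose A"
    unfolding eq using i
    by (simp add: integral_bounded_linear[OF L1 int(2)] integral_bounded_linear[OF L2 int(2)] integral_bounded_linear[OF L3 int(3)]
      cov_\<eta>w_dv var_\<eta>w[folded Gw_def] var_dv[folded Gv_def]
      matrix_mult.zero_left matrix_mult.zero_right
      linear_0[OF linear_transpose])
  also have "A ** (s1 *\<^sub>R Gv) ** transpose A = (\<rho>\<^sup>2 * s1) *\<^sub>R (H ** matrix_inv Gv ** Gv ** transpose (H ** matrix_inv Gv))"
    unfolding A_def
    by (simp add: linear_cmul[OF linear_transpose] power2_eq_square
      matrix_mult.scaleR_left matrix_mult.scaleR_right mult_ac)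
  also have "H ** matrix_inv Gv ** Gv = H"
    by (simp add: matrix_mul_assoc[symmetric] matrix_inv_inverse[OF inv_Gv[folded Gv_def]])
  also have "transpose (H ** matrix_inv Gv) = matrix_inv Gv ** transpose H"
    by (simp add: matrix_transpose_mul matrix_inv_symmetric[OF inv_Gv[folded Gv_def] symGv])
  finally show "(\<integral>\<omega>. outer (\<xi> (T \<omega>)) (\<xi> (T \<omega>)) \<partial>P) = EWDW"
    unfolding EWDW_def by (simp add: matrix_mul_assoc)
qed

text \<open>With the moments frozen at \<open>q0\<close>, \<Psi> is linear in the score, so the
  leading term is a normalized i.i.d. sum with the sandwich matrix as covariance.\<close>

theorem asymptotic_normality:
  "\<exists>N. is_mv_normal N 0 (matrix_inv Gw ** EWDW ** matrix_inv Gw) \<and>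
     conv_in_distr M (\<lambda>n \<omega>. sqrt (real n) *\<^sub>R (Bhat n \<omega> - B)) N"
proof -
  define \<psi> where "\<psi> x = matrix_inv Gw *v \<xi> x" for x
  have [measurable]: "\<psi> \<in> borel_measurable borel" unfolding \<psi>_def by measurable
  have symGw: "transpose Gw = Gw"
    unfolding Gw_def integral_bounded_linear[OF bounded_linear_transpose integrable_outer_products(2), symmetric] transpose_outer ..
  define \<Sigma> where "\<Sigma> = matrix_inv Gw ** EWDW ** matrix_inv Gw"
  have eq: "outer (\<psi> x) (\<psi> x) = matrix_inv Gw ** outer (\<xi> x) (\<xi> x) ** matrix_inv Gw" for x
    unfolding \<psi>_def matrix_mult_outer
    using outer_mult_matrix[of "matrix_inv Gw *v \<xi> x" "\<xi> x" "matrix_inv Gw"]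
    by (simp add: matrix_inv_symmetric[OF inv_Gw[folded Gw_def] symGw])
  have L: "bounded_linear (\<lambda>X::real ^ 'b ^ 'b. matrix_inv Gw ** X ** matrix_inv Gw)"
    by (rule bounded_linear_compose[OF matrix_mult.bounded_linear_left matrix_mult.bounded_linear_right])
  have int: "integrable P (\<lambda>\<omega>. outer (\<psi> (T \<omega>)) (\<psi> (T \<omega>)))" and \<Sigma>: "(\<integral>\<omega>. outer (\<psi> (T \<omega>)) (\<psi> (T \<omega>)) \<partial>P) = \<Sigma>"
    unfolding eq \<Sigma>_def second_moment_\<xi>(2)[symmetric]
    using integrable_bounded_linear[OF L second_moment_\<xi>(1)] integral_bounded_linear[OF L second_moment_\<xi>(1)] by auto
  have L': "bounded_linear (\<lambda>X::real ^ 'b ^ 'b. X $ a $ b)" for a b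
    by (rule bounded_linear_compose[OF bounded_linear_vec_nth bounded_linear_vec_nth])
  have \<Sigma>_nth: "integrable P (\<lambda>\<omega>. \<psi> (T \<omega>) $ a * \<psi> (T \<omega>) $ b)" "\<Sigma> $ a $ b = (\<integral>\<omega>. \<psi> (T \<omega>) $ a * \<psi> (T \<omega>) $ b \<partial>P)" for a b
    using integrable_bounded_linear[OF L' int] integral_bounded_linear[OF L' int] by (auto simp: \<Sigma>)
  have sq: "integrable P (\<lambda>\<omega>. (norm (\<psi> (T \<omega>)))\<^sup>2)"
    unfolding power2_norm_eq_inner inner_vec_def using \<Sigma>_nth by simp
  \<comment> \<open>As the second moment matrix of \<open>\<psi>\<close>, \<Sigma> is symmetric and
    positive semidefinite, which is what the existence of the normal law requires.\<close>
  have "\<Sigma> $ a $ b = \<Sigma> $ b $ a" for a b unfolding \<Sigma>_nth by (simp add: mult.commute)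
  moreover have "0 \<le> x \<bullet> (\<Sigma> *v x)" for x
    unfolding \<Sigma>[symmetric] second_moment_quadratic(2)[OF int, symmetric] by simp
  ultimately obtain N where N: "is_mv_normal N 0 \<Sigma>" by (rule is_mv_normal_exists)
  \<comment> \<open>\<open>\<psi>\<close> is the image of the score under this fixed linear map, so
    its mean is 0 as well.\<close>
  have L\<xi>: "bounded_linear (\<lambda>p::(real ^ 'a) \<times> (real ^ 'b). matrix_inv Gw *v (snd p + (\<rho> *\<^sub>R (H ** matrix_inv Gv)) *v fst p))"
    by (intro bounded_linear_compose[OF matrix_vector_mult.bounded_linear_right]
       bounded_linear_add bounded_linear_snd bounded_linear_fst)
  have mean: "(\<integral>\<omega>. \<psi> (T \<omega>) \<partial>P) = 0"
    using integral_bounded_linear[OF L\<xi> integrable_score] unfolding mean_score linear_0[OF bounded_linear.linear[OF L\<xi>]]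
    by (simp add: score_def \<psi>_def \<xi>_def)
  have clt: "conv_in_distr M (\<lambda>n \<omega>. (1 / sqrt (real n)) *\<^sub>R (\<Sum>i<n. \<psi> (S i \<omega>))) N"
    by (rule multivariate_central_limit_theorem[OF M.prob_space_axioms iid P.prob_space_axioms T_measurable _ sq mean \<Sigma>_nth(2) N]) measurable
  have psi: "\<Psi> q0 (sqrt (real n) *\<^sub>R score_n n \<omega>) = (1 / sqrt (real n)) *\<^sub>R (\<Sum>i<n. \<psi> (S i \<omega>))" for n \<omega>
    unfolding score_n_def \<Psi>_scaleR \<Psi>_score_sum \<psi>_def[symmetric] scaleR_scaleR
      sqrt_times_inverse[OF of_nat_0_le_iff] ..
  note [measurable] = conv_in_prob_measurable[OF conv_q] conv_in_prob_measurable[OF conv_score]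
  have "conv_in_distr M (\<lambda>n \<omega>. sqrt (real n) *\<^sub>R (Bhat n \<omega> - B)) N"
  proof (rule M.conv_in_distr_Slutsky[OF conv_q tight_score, of \<Psi>])
    show "isCont (\<lambda>p. \<Psi> (fst p) (snd p)) (q0, x)" for x by (rule isCont_\<Psi>)
    show "(\<lambda>\<omega>. \<Psi> (q_n n \<omega>) (sqrt (real n) *\<^sub>R score_n n \<omega>)) \<in> borel_measurable M" for n by measurable
    show "conv_in_distr M (\<lambda>n \<omega>. \<Psi> q0 (sqrt (real n) *\<^sub>R score_n n \<omega>)) N" unfolding psi by (rule clt)
    show "(\<lambda>\<omega>. sqrt (real n) *\<^sub>R (Bhat n \<omega> - B)) \<in> borel_measurable M" for n by measurable
    show "whp M (\<lambda>n \<omega>. sqrt (real n) *\<^sub>R (Bhat n \<omega> - B) = \<Psi> (q_n n \<omega>) (sqrt (real n) *\<^sub>R score_n n \<omega>))"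
      by (rule whp_mono[OF second_stage_error]) (simp add: \<Psi>_scaleR)
  qed
  with N show ?thesis unfolding \<Sigma>_def by blast
qed

end

section \<open>The control function model\<close>

lemma (in prob_space) indep_rv_integral_scaleR:
  fixes F :: "'b::topological_space \<Rightarrow> 'd::euclidean_space" and G :: "'c::topological_space \<Rightarrow> real"
  assumes ind: "indep_rv M X Y" and F: "F \<in> borel_measurable borel" and G: "G \<in> borel_measurable borel"
    and intF: "integrable M (\<lambda>\<omega>. F (X \<omega>))" and intG: "integrable M (\<lambda>\<omega>. G (Y \<omega>))"
  shows "integrable M (\<lambda>\<omega>. G (Y \<omega>) *\<^sub>R F (X \<omega>))"
    and "(\<integral>\<omega>. G (Y \<omega>) *\<^sub>R F (X \<omega>) \<partial>M) = (\<integral>\<omega>. G (Y \<omega>) \<partial>M) *\<^sub>R (\<integral>\<omega>. F (X \<omega>) \<partial>M)"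
proof -
  have c: "integrable M (\<lambda>\<omega>. (F (X \<omega>) \<bullet> b) * G (Y \<omega>))"
    "(\<integral>\<omega>. (F (X \<omega>) \<bullet> b) * G (Y \<omega>) \<partial>M) = ((\<integral>\<omega>. F (X \<omega>) \<partial>M) \<bullet> b) * (\<integral>\<omega>. G (Y \<omega>) \<partial>M)" for b
    using indep_rv_integral_mult[OF ind _ G _ intG, of "\<lambda>x. F x \<bullet> b"] F intF by auto
  show int: "integrable M (\<lambda>\<omega>. G (Y \<omega>) *\<^sub>R F (X \<omega>))"
    by (rule integrable_euclidean) (use c in \<open>simp add: mult.commute\<close>)
  show "(\<integral>\<omega>. G (Y \<omega>) *\<^sub>R F (X \<omega>) \<partial>M) = (\<integral>\<omega>. G (Y \<omega>) \<partial>M) *\<^sub>R (\<integral>\<omega>. F (X \<omega>) \<partial>M)"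
  proof (rule euclidean_eqI)
    fix b :: 'd
    have "(\<integral>\<omega>. G (Y \<omega>) *\<^sub>R F (X \<omega>) \<partial>M) \<bullet> b = (\<integral>\<omega>. (G (Y \<omega>) *\<^sub>R F (X \<omega>)) \<bullet> b \<partial>M)"
      using int by (rule integral_inner_left[symmetric])
    then show "(\<integral>\<omega>. G (Y \<omega>) *\<^sub>R F (X \<omega>) \<partial>M) \<bullet> b = ((\<integral>\<omega>. G (Y \<omega>) \<partial>M) *\<^sub>R (\<integral>\<omega>. F (X \<omega>) \<partial>M)) \<bullet> b"
      using c(2)[of b] by (simp add: mult.commute)
  qed
qed

section \<open>Regressor rows and their linear independence\<close>

lemma sum_reg1: "(\<Sum>r\<in>UNIV. F r) = F Icpt1 + (\<Sum>j\<in>UNIV. F (Instr j)) + (\<Sum>j\<in>UNIV. F (Covar j))"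
  for F :: "('p::finite, 'q::finite) reg1 \<Rightarrow> real"
proof -
  have "sum F (range Instr \<union> range Covar) = sum F (range Instr) + sum F (range Covar)"
    by (rule sum.union_disjoint) auto
  moreover have "sum F (range Instr) = (\<Sum>j\<in>UNIV. F (Instr j))" "sum F (range Covar) = (\<Sum>j\<in>UNIV. F (Covar j))"
    by (simp_all add: sum.reindex inj_def)
  ultimately show ?thesis unfolding UNIV_reg1 by (subst sum.insert) auto
qed

lemma sum_reg2: "(\<Sum>r\<in>UNIV. F r) = F Icpt2 + (\<Sum>j\<in>UNIV. F (BasisF j)) + (\<Sum>j\<in>UNIV. F (BasisG j)) + F Resid"
  for F :: "('k1::finite, 'k2::finite) reg2 \<Rightarrow> real"
proof -
  have "sum F (range BasisF \<union> range BasisG) = sum F (range BasisF) + sum F (range BasisG)"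
    by (rule sum.union_disjoint) auto
  moreover have "sum F (range BasisF) = (\<Sum>j\<in>UNIV. F (BasisF j))" "sum F (range BasisG) = (\<Sum>j\<in>UNIV. F (BasisG j))"
    by (simp_all add: sum.reindex inj_def)
  ultimately show ?thesis unfolding UNIV_reg2 by (subst sum.insert, simp, force)+ simp
qed

lemma row1_inner: "row1 z c \<bullet> a = a $ Icpt1 + (\<Sum>j\<in>UNIV. z $ j * a $ Instr j) + (\<Sum>j\<in>UNIV. c $ j * a $ Covar j)"
  unfolding row1_def inner_vec_def sum_reg1 by simp

lemma row2_inner: "row2 f g x c d \<bullet> a = a $ Icpt2 + (\<Sum>j\<in>UNIV. f j x * a $ BasisF j) + (\<Sum>j\<in>UNIV. g j c * a $ BasisG j) + d * a $ Resid"
  unfolding row2_def inner_vec_def sum_reg2 by simp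

lemma with_one_inner: "with_one x \<bullet> a = a $ None + (\<Sum>j\<in>UNIV. x $ j * a $ Some j)"
  unfolding with_one_def inner_vec_def UNIV_option_conv by (simp add: sum.reindex)

lemma norm_row1: "(norm (row1 z c))\<^sup>2 = 1 + (norm z)\<^sup>2 + (norm c)\<^sup>2"
  unfolding power2_norm_eq_inner row1_inner by (simp add: row1_def inner_vec_def)

lemma norm_row2: "(norm (row2 f g x c d))\<^sup>2 = 1 + (\<Sum>j\<in>UNIV. (f j x)\<^sup>2) + (\<Sum>j\<in>UNIV. (g j c)\<^sup>2) + d\<^sup>2"
  unfolding power2_norm_eq_inner row2_inner by (simp add: row2_def power2_eq_square)

lemma borel_measurable_row1 [measurable (raw)]:
  assumes [measurable]: "z \<in> borel_measurable M" "c \<in> borel_measurable M"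
  shows "(\<lambda>x. row1 (z x) (c x)) \<in> borel_measurable M"
proof (rule borel_measurable_vec)
  show "(\<lambda>x. row1 (z x) (c x) $ r) \<in> borel_measurable M" for r by (cases r) (simp_all add: row1_def)
qed

lemma borel_measurable_row2:
  assumes [measurable]: "\<And>j. f j \<in> borel_measurable borel" "\<And>j. g j \<in> borel_measurable borel"
    "x \<in> borel_measurable M" "c \<in> borel_measurable M" "d \<in> borel_measurable M"
  shows "(\<lambda>\<omega>. row2 f g (x \<omega>) (c \<omega>) (d \<omega>)) \<in> borel_measurable M"
proof (rule borel_measurable_vec)
  show "(\<lambda>\<omega>. row2 f g (x \<omega>) (c \<omega>) (d \<omega>) $ r) \<in> borel_measurable M" for r by (cases r) (simp_all add: row2_def)
qed

text \<open>If \<open>a \<bullet> Z + b \<bullet> C\<close> is constant and \<open>Z\<close>, \<open>C\<close> are independent, then \<open>Var (a \<bullet> Z) = - Cov (a \<bullet> Z, b \<bullet> C) = 0\<close>.\<close>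

lemma (in prob_space) lin_indep_row1:
  assumes ind: "indep_rv M Z C"
    and sqZ: "integrable M (\<lambda>\<omega>. (norm (Z \<omega>))\<^sup>2)" and sqC: "integrable M (\<lambda>\<omega>. (norm (C \<omega>))\<^sup>2)"
    and Z: "lin_indep_rv M (\<lambda>\<omega>. with_one (Z \<omega>))" and C: "lin_indep_rv M (\<lambda>\<omega>. with_one (C \<omega>))"
  shows "lin_indep_rv M (\<lambda>\<omega>. row1 (Z \<omega>) (C \<omega>))"
  unfolding lin_indep_rv_def
proof (intro allI impI)
  fix a :: "real ^ ('b, 'c) reg1"
  assume ae: "AE \<omega> in M. a \<bullet> row1 (Z \<omega>) (C \<omega>) = 0"
  have [measurable]: "Z \<in> borel_measurable M" "C \<in> borel_measurable M" using ind by (auto simp: indep_rv_def)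
  define aZ where "aZ = (\<chi> j. a $ Instr j)"
  define aC where "aC = (\<chi> j. a $ Covar j)"
  have row: "a \<bullet> row1 z c = a $ Icpt1 + z \<bullet> aZ + c \<bullet> aC" for z c
    by (subst inner_commute, subst row1_inner) (simp add: aZ_def aC_def inner_vec_def)
  have intZ: "integrable M (\<lambda>\<omega>. Z \<omega> \<bullet> aZ)" and intC: "integrable M (\<lambda>\<omega>. C \<omega> \<bullet> aC)"
    by (auto intro!: integrable_inner_left square_norm_integrable_imp_integrable sqZ sqC)
  define z0 where "z0 = (\<integral>\<omega>. Z \<omega> \<bullet> aZ \<partial>M)"
  define c0 where "c0 = (\<integral>\<omega>. C \<omega> \<bullet> aC \<partial>M)"
  have sum0: "a $ Icpt1 + z0 + c0 = 0"
  proof -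
    have "a $ Icpt1 + z0 + c0 = (\<integral>\<omega>. a $ Icpt1 + Z \<omega> \<bullet> aZ + C \<omega> \<bullet> aC \<partial>M)"
      using intZ intC by (simp add: z0_def c0_def prob_space)
    also have "\<dots> = (\<integral>\<omega>. 0 \<partial>M)" by (rule integral_cong_AE) (use ae row in auto)
    finally show ?thesis by simp
  qed
  note prod = indep_rv_integral_mult[OF ind, of "\<lambda>z. z \<bullet> aZ - z0" "\<lambda>c. c \<bullet> aC - c0"]
  have int: "integrable M (\<lambda>\<omega>. (Z \<omega> \<bullet> aZ - z0) * (C \<omega> \<bullet> aC - c0))"
    "(\<integral>\<omega>. (Z \<omega> \<bullet> aZ - z0) * (C \<omega> \<bullet> aC - c0) \<partial>M) = 0"
    using prod intZ intC by (auto simp: z0_def prob_space)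
  \<comment> \<open>By the linear relation the centered covariate part is minus the centered
    instrument part, so the product with mean 0 is minus a square.\<close>
  have eq: "AE \<omega> in M. - ((Z \<omega> \<bullet> aZ - z0) * (C \<omega> \<bullet> aC - c0)) = (Z \<omega> \<bullet> aZ - z0)\<^sup>2"
    using ae
  proof eventually_elim
    case (elim \<omega>)
    then have "C \<omega> \<bullet> aC - c0 = - (Z \<omega> \<bullet> aZ - z0)" using sum0 unfolding row by linarith
    then show ?case by (simp only: power2_eq_square mult_minus_right minus_minus)
  qed
  have sq: "integrable M (\<lambda>\<omega>. (Z \<omega> \<bullet> aZ - z0)\<^sup>2)"
    by (rule integrable_cong_AE_imp[OF Bochner_Integration.integrable_minus[OF int(1)] _ eq]) measurable
  have "(\<integral>\<omega>. - ((Z \<omega> \<bullet> aZ - z0) * (C \<omega> \<bullet> aC - c0)) \<partial>M) = (\<integral>\<omega>. (Z \<omega> \<bullet> aZ - z0)\<^sup>2 \<partial>M)"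
    by (rule integral_cong_AE[OF _ _ eq]) measurable
  then have "(\<integral>\<omega>. (Z \<omega> \<bullet> aZ - z0)\<^sup>2 \<partial>M) = 0" using int by simp
  then have aeZ: "AE \<omega> in M. Z \<omega> \<bullet> aZ = z0"
    using integral_nonneg_eq_0_iff_AE[OF sq] by simp
  \<comment> \<open>A constant combination of the instruments is a relation between 1 and Z, with
    coefficient - z0 at the constant. Once it is trivial, only a relation between 1 and C
    remains.\<close>
  define a1 :: "real ^ 'b option" where "a1 = (\<chi> r. case r of None \<Rightarrow> - z0 | Some j \<Rightarrow> aZ $ j)"
  have "a1 \<bullet> with_one z = - z0 + z \<bullet> aZ" for z
    by (subst inner_commute, subst with_one_inner) (simp add: a1_def inner_vec_def)
  then have "AE \<omega> in M. a1 \<bullet> with_one (Z \<omega>) = 0" using aeZ by auto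
  then have "a1 = 0" using Z unfolding lin_indep_rv_def by blast
  then have "a1 $ Some j = 0" "a1 $ None = 0" for j by simp_all
  then have Z0: "a $ Instr j = 0" "z0 = 0" for j by (simp_all add: a1_def aZ_def)
  define a2 :: "real ^ 'c option" where "a2 = (\<chi> r. case r of None \<Rightarrow> a $ Icpt1 | Some j \<Rightarrow> aC $ j)"
  have a2: "a2 \<bullet> with_one c = a $ Icpt1 + c \<bullet> aC" for c
    by (subst inner_commute, subst with_one_inner) (simp add: a2_def inner_vec_def)
  have "AE \<omega> in M. a2 \<bullet> with_one (C \<omega>) = 0" using ae aeZ
    by eventually_elim (simp add: a2 row Z0)
  then have "a2 = 0" using C unfolding lin_indep_rv_def by blast
  then have "a2 $ Some j = 0" "a2 $ None = 0" for j by simp_all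
  then have C0: "a $ Covar j = 0" "a $ Icpt1 = 0" for j by (simp_all add: a2_def aC_def)
  have "a $ r = 0" for r by (cases r) (simp_all add: Z0 C0)
  then show "a = 0" by (simp add: vec_eq_iff)
qed

text \<open>The intercept absorbs the constant. Needed because independence is assumed with
  \<open>\<delta>1\<close>, whereas the residual estimates its centered version.\<close>

lemma lin_indep_row2_shift:
  assumes "lin_indep_rv M (\<lambda>\<omega>. row2 f g (X \<omega>) (C \<omega>) (d \<omega>))"
  shows "lin_indep_rv M (\<lambda>\<omega>. row2 f g (X \<omega>) (C \<omega>) (d \<omega> - m))"
  unfolding lin_indep_rv_def
proof (intro allI impI)
  fix a assume ae: "AE \<omega> in M. a \<bullet> row2 f g (X \<omega>) (C \<omega>) (d \<omega> - m) = 0"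
  define a' where "a' = (\<chi> r. if r = Icpt2 then a $ Icpt2 - m * a $ Resid else a $ r)"
  have "row2 f g x c t \<bullet> a' = row2 f g x c (t - m) \<bullet> a" for x c t
    by (simp add: row2_inner a'_def algebra_simps)
  then have "a' \<bullet> row2 f g x c t = a \<bullet> row2 f g x c (t - m)" for x c t
    by (simp only: inner_commute)
  then have "a' = 0" using ae assms unfolding lin_indep_rv_def by simp
  then have a': "a' $ r = 0" for r by simp
  have 1: "a $ r = 0" if "r \<noteq> Icpt2" for r using a'[of r] that by (simp add: a'_def)
  then have "a $ Icpt2 = 0" using a'[of Icpt2] 1[of Resid] by (simp add: a'_def)
  with 1 show "a = 0" by (metis vec_eq_iff zero_index)
qed

text \<open>What remains is to write the errors as functions of the observed variables and to derive
  the moment conditions of \<open>control_function_sample\<close> from independence. Limits in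
  probability are unique, so the existential quantifiers determine \<open>EWW\<close> and
  \<open>EWDW\<close>.\<close>

theorem theorem4:
  fixes P :: "'w measure" and M :: "'s measure"
    and Z :: "'w \<Rightarrow> real ^ 'p" and C :: "'w \<Rightarrow> real ^ 'q" and U :: "'w \<Rightarrow> 'u::euclidean_space"
    and X Y \<delta>1 \<delta>2 \<epsilon>X \<epsilon>Y e :: "'w \<Rightarrow> real"
    and \<beta>X0 \<beta>Y0 \<rho> :: real and \<beta>Z :: "real ^ 'p" and \<beta>C :: "real ^ 'q" and \<beta>U :: 'u
    and f :: "'k1::finite \<Rightarrow> real \<Rightarrow> real" and \<theta> :: "'k1 \<Rightarrow> real"
    and g :: "'k2::finite \<Rightarrow> real ^ 'q \<Rightarrow> real" and \<gamma> :: "'k2 \<Rightarrow> real"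
    and h :: "'u \<Rightarrow> real"
    and Zs :: "nat \<Rightarrow> 's \<Rightarrow> real ^ 'p" and Cs :: "nat \<Rightarrow> 's \<Rightarrow> real ^ 'q"
    and Xs Ys :: "nat \<Rightarrow> 's \<Rightarrow> real"
    and bhat :: "nat \<Rightarrow> 's \<Rightarrow> real ^ ('p, 'q) reg1"
    and Bhat :: "nat \<Rightarrow> 's \<Rightarrow> real ^ ('k1, 'k2) reg2"
  assumes "prob_space P" and "prob_space M"
    \<comment> \<open>model\<close>
    and "\<And>j. f j \<in> borel_measurable borel" and "\<And>j. g j \<in> borel_measurable borel"
    and "h \<in> borel_measurable borel"
    and "\<And>\<omega>. \<omega> \<in> space P \<Longrightarrow> X \<omega> = \<beta>X0 + \<beta>Z \<bullet> Z \<omega> + \<beta>C \<bullet> C \<omega> + \<delta>1 \<omega>"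
    and "\<And>\<omega>. \<omega> \<in> space P \<Longrightarrow>
           Y \<omega> = \<beta>Y0 + (\<Sum>j\<in>UNIV. \<theta> j * f j (X \<omega>)) + (\<Sum>j\<in>UNIV. \<gamma> j * g j (C \<omega>)) + \<delta>2 \<omega>"
    and "\<And>\<omega>. \<omega> \<in> space P \<Longrightarrow> \<delta>1 \<omega> = \<beta>U \<bullet> U \<omega> + \<epsilon>X \<omega>"
    and "\<And>\<omega>. \<omega> \<in> space P \<Longrightarrow> \<delta>2 \<omega> = h (U \<omega>) + \<epsilon>Y \<omega>"
    and "\<beta>Z \<noteq> 0"
    \<comment> \<open>independence\<close>
    and "indep_rv P Z U"
    and "indep_rv P C (\<lambda>\<omega>. (Z \<omega>, U \<omega>))"
    and "indep_rv P \<epsilon>X (\<lambda>\<omega>. (Z \<omega>, C \<omega>, U \<omega>))"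
    and "indep_rv P \<epsilon>Y (\<lambda>\<omega>. (\<epsilon>X \<omega>, Z \<omega>, C \<omega>, U \<omega>))"
    \<comment> \<open>means and second moments; \<open>E h(U) = 0\<close> makes \<open>\<beta>Y0\<close> the intercept\<close>
    and "integrable P \<epsilon>X" and "prob_space.expectation P \<epsilon>X = 0"
    and "integrable P \<epsilon>Y" and "prob_space.expectation P \<epsilon>Y = 0"
    and "prob_space.expectation P (\<lambda>\<omega>. h (U \<omega>)) = 0"
    and "integrable P (\<lambda>\<omega>. (norm (Z \<omega>))\<^sup>2)" and "integrable P (\<lambda>\<omega>. (norm (C \<omega>))\<^sup>2)"
    and "\<And>j. integrable P (\<lambda>\<omega>. (f j (X \<omega>))\<^sup>2)" and "\<And>j. integrable P (\<lambda>\<omega>. (g j (C \<omega>))\<^sup>2)"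
    and "integrable P (\<lambda>\<omega>. (\<delta>1 \<omega>)\<^sup>2)" and "integrable P (\<lambda>\<omega>. (\<delta>2 \<omega>)\<^sup>2)"
    \<comment> \<open>linear independence; the last one, not implied by the others, is needed for
      \<open>E(W\<^sup>T W)\<close> to be invertible\<close>
    and "lin_indep_rv P (\<lambda>\<omega>. with_one (\<chi> j. f j (X \<omega>)))"
    and "lin_indep_rv P (\<lambda>\<omega>. with_one (\<chi> j. g j (C \<omega>)))"
    and "lin_indep_rv P (\<lambda>\<omega>. with_one (Z \<omega>))" and "lin_indep_rv P (\<lambda>\<omega>. with_one (C \<omega>))"
    and "lin_indep_rv P (\<lambda>\<omega>. row2 f g (X \<omega>) (C \<omega>) (\<delta>1 \<omega>))"
    \<comment> \<open>decomposition of the outcome error\<close>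
    and "\<And>\<omega>. \<omega> \<in> space P \<Longrightarrow> \<delta>2 \<omega> = \<rho> * \<delta>1 \<omega> + e \<omega>"
    and "prob_space.indep_var P borel \<delta>1 borel e"
    \<comment> \<open>sample and estimator\<close>
    and "iid_copies M (\<lambda>i \<omega>. (Zs i \<omega>, Cs i \<omega>, Xs i \<omega>, Ys i \<omega>)) P (\<lambda>\<omega>. (Z \<omega>, C \<omega>, X \<omega>, Y \<omega>))"
    and "control_function_estimator M f g Zs Cs Xs Ys bhat Bhat"
  defines "B \<equiv> coeffs2 \<beta>Y0 \<theta> \<gamma> \<rho>"
    and "V \<equiv> \<lambda>\<omega>. regressors1 (\<lambda>i. Zs i \<omega>) (\<lambda>i. Cs i \<omega>)"
    and "W \<equiv> \<lambda>n \<omega>. regressors2 f g (\<lambda>i. Zs i \<omega>) (\<lambda>i. Cs i \<omega>) (\<lambda>i. Xs i \<omega>) (bhat n \<omega>)"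
    and "D \<equiv> \<lambda>n \<omega>. Dmat n (regressors1 (\<lambda>i. Zs i \<omega>) (\<lambda>i. Cs i \<omega>))
                       (prob_space.variance P e) \<rho> (prob_space.variance P \<delta>1)"
  shows "conv_in_prob M Bhat B \<and>
    (\<exists>EWW EWDW N.
       conv_in_prob M (\<lambda>n \<omega>. (1 / real n) *\<^sub>R gram n (W n \<omega>)) EWW \<and>
       conv_in_prob M (\<lambda>n \<omega>. (1 / real n) *\<^sub>R sandwich n (W n \<omega>) (D n \<omega>)) EWDW \<and>
       invertible EWW \<and>
       is_mv_normal N 0 (matrix_inv EWW ** EWDW ** matrix_inv EWW) \<and>
       conv_in_distr M (\<lambda>n \<omega>. sqrt (real n) *\<^sub>R (Bhat n \<omega> - B)) N)"
proof -
  interpret P: prob_space P by (rule assms(1))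
  interpret M: prob_space M by (rule assms(2))
  note [measurable] = assms(3-5)
  note X_eq = assms(6) and Y_eq = assms(7) and \<delta>1_eq = assms(8) and \<delta>2_eq = assms(9) and e_eq = assms(31)
  have [measurable]: "Z \<in> borel_measurable P" "C \<in> borel_measurable P" "U \<in> borel_measurable P"
    "\<epsilon>X \<in> borel_measurable P" "\<epsilon>Y \<in> borel_measurable P"
    using assms(11-14) by (auto simp: indep_rv_def)
  have \<delta>1e: "indep_rv P \<delta>1 e" using assms(32) by (simp add: P.indep_rv_real)
  have [measurable]: "\<delta>1 \<in> borel_measurable P" "e \<in> borel_measurable P" using \<delta>1e by (auto simp: indep_rv_def)
  have X_measurable [measurable]: "X \<in> borel_measurable P"
    by (subst measurable_cong[OF X_eq]) simp_all
  have \<delta>2_measurable [measurable]: "\<delta>2 \<in> borel_measurable P"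
    by (subst measurable_cong[OF e_eq]) simp_all
  have Y_measurable [measurable]: "Y \<in> borel_measurable P"
    by (subst measurable_cong[OF Y_eq]) simp_all

  \<comment> \<open>Start of a chain of regroupings that ends with (C, Z) independent of all error
    sources (\<epsilon>Y, \<epsilon>X, U) jointly.\<close>
  have CZ_U: "indep_rv P (\<lambda>\<omega>. (C \<omega>, Z \<omega>)) U" by (rule P.indep_rv_Pair[OF assms(12,11)])
  have "indep_rv P \<epsilon>X (\<lambda>\<omega>. (U \<omega>, (C \<omega>, Z \<omega>)))"
    by (rule P.indep_rv_compose[OF assms(13), of "\<lambda>x. x" "\<lambda>p. (snd (snd p), (fst (snd p), fst p))"]) auto
  from P.indep_rv_Pair[OF this P.indep_rv_sym[OF CZ_U]]
  have \<epsilon>XU_CZ: "indep_rv P (\<lambda>\<omega>. (\<epsilon>X \<omega>, U \<omega>)) (\<lambda>\<omega>. (C \<omega>, Z \<omega>))" .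
  have "indep_rv P \<epsilon>Y (\<lambda>\<omega>. ((\<epsilon>X \<omega>, U \<omega>), (C \<omega>, Z \<omega>)))"
    by (rule P.indep_rv_compose[OF assms(14), of "\<lambda>x. x" "\<lambda>p. ((fst p, snd (snd (snd p))), (fst (snd (snd p)), fst (snd p)))"]) auto
  note errors_regressors = P.indep_rv_sym[OF P.indep_rv_Pair[OF this \<epsilon>XU_CZ]]
  \<comment> \<open>Both errors are functions of (\<epsilon>Y, \<epsilon>X, U), the second through e
    = \<delta>2 - \<rho> \<delta>1.\<close>
  have ZC_\<delta>1e: "indep_rv P (\<lambda>\<omega>. (Z \<omega>, C \<omega>)) (\<lambda>\<omega>. (\<delta>1 \<omega>, e \<omega>))"
    by (rule P.indep_rv_compose[OF errors_regressors, of "\<lambda>p. (snd p, fst p)"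
        "\<lambda>p. (\<beta>U \<bullet> snd (snd p) + fst (snd p),
           h (snd (snd p)) + fst p - \<rho> * (\<beta>U \<bullet> snd (snd p) + fst (snd p)))"])
      (auto simp: \<delta>1_eq[symmetric] \<delta>2_eq[symmetric] e_eq)
  \<comment> \<open>The variables (Z, C, \<delta>1) determine X, so this makes \<open>e\<close>
    independent of all regressors of both stages at once.\<close>
  have K_e: "indep_rv P (\<lambda>\<omega>. ((Z \<omega>, C \<omega>), \<delta>1 \<omega>)) e" by (rule P.indep_rv_Pair[OF ZC_\<delta>1e \<delta>1e])
  have ZC_\<delta>1: "indep_rv P (\<lambda>\<omega>. (Z \<omega>, C \<omega>)) \<delta>1"
    by (rule P.indep_rv_compose[OF ZC_\<delta>1e, of "\<lambda>p. p" fst]) auto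
  have Z_C: "indep_rv P Z C"
    by (rule P.indep_rv_sym, rule P.indep_rv_compose[OF assms(12), of "\<lambda>p. p" fst]) auto

  define \<mu> where "\<mu> = P.expectation \<delta>1"
  have int_\<delta>1: "integrable P \<delta>1" and int_\<delta>2: "integrable P \<delta>2"
    using assms(24,25) by (auto intro: P.square_integrable_imp_integrable)
  have "integrable P (\<lambda>\<omega>. h (U \<omega>))"
  proof -
    have "integrable P (\<lambda>\<omega>. \<delta>2 \<omega> - \<epsilon>Y \<omega>)" using int_\<delta>2 assms(17) by simp
    then show ?thesis by (subst (asm) Bochner_Integration.integrable_cong[OF refl, of _ _ "\<lambda>\<omega>. h (U \<omega>)"]) (auto simp: \<delta>2_eq)
  qed
  moreover have "P.expectation \<delta>2 = P.expectation (\<lambda>\<omega>. h (U \<omega>) + \<epsilon>Y \<omega>)"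
    by (rule Bochner_Integration.integral_cong) (auto simp: \<delta>2_eq)
  ultimately have mean_\<delta>2: "P.expectation \<delta>2 = 0" using assms(17-19) by simp
  have e_eq': "e \<omega> = \<delta>2 \<omega> - \<rho> * \<delta>1 \<omega>" if "\<omega> \<in> space P" for \<omega> using e_eq[OF that] by simp
  have "P.expectation e = P.expectation (\<lambda>\<omega>. \<delta>2 \<omega> - \<rho> * \<delta>1 \<omega>)"
    by (rule Bochner_Integration.integral_cong) (auto simp: e_eq')
  \<comment> \<open>Hence \<open>e + \<rho> * \<mu>\<close>, the second-stage error relative to the
    centered control variable, has mean 0.\<close>
  then have mean_e: "P.expectation e = - \<rho> * \<mu>" using int_\<delta>1 int_\<delta>2 by (simp add: mean_\<delta>2 \<mu>_def)
  have sq_\<delta>: "integrable P (\<lambda>\<omega>. (\<delta>1 \<omega> - \<mu>)\<^sup>2)"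
    using assms(24) int_\<delta>1 by (simp add: power2_diff)
  have "integrable P (\<lambda>\<omega>. (\<delta>2 \<omega> - \<rho> * \<delta>1 \<omega> + \<rho> * \<mu>)\<^sup>2)"
  proof -
    have eq: "(\<delta>2 \<omega> - \<rho> * \<delta>1 \<omega> + \<rho> * \<mu>)\<^sup>2 = (\<delta>2 \<omega>)\<^sup>2 + \<rho>\<^sup>2 * (\<delta>1 \<omega> - \<mu>)\<^sup>2 - 2 * \<rho> * (\<delta>2 \<omega> * (\<delta>1 \<omega> - \<mu>))" for \<omega>
      by (simp add: power2_eq_square algebra_simps)
    show ?thesis unfolding eq
      by (intro Bochner_Integration.integrable_diff Bochner_Integration.integrable_add integrable_mult_right
          assms(25) sq_\<delta> square_integrable_mult) measurable
  qed
  then have sq_e: "integrable P (\<lambda>\<omega>. (e \<omega> + \<rho> * \<mu>)\<^sup>2)"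
    by (subst Bochner_Integration.integrable_cong[OF refl]) (auto simp: e_eq')
  have int_e: "integrable P (\<lambda>\<omega>. e \<omega> + \<rho> * \<mu>)"
    by (rule P.square_integrable_imp_integrable[OF _ sq_e]) measurable
  have mean_e': "P.expectation (\<lambda>\<omega>. e \<omega> + \<rho> * \<mu>) = 0"
  proof -
    have "integrable P (\<lambda>\<omega>. (e \<omega> + \<rho> * \<mu>) - \<rho> * \<mu>)" using int_e by (intro Bochner_Integration.integrable_diff) auto
    then have "integrable P e" by simp
    then show ?thesis using mean_e by (simp add: P.prob_space)
  qed

  \<comment> \<open>The limit of the first-stage coefficients: the intercept takes up \<mu>.\<close>
  define b0 :: "real ^ ('p, 'q) reg1" where
    "b0 = (\<chi> r. case r of Icpt1 \<Rightarrow> \<beta>X0 + \<mu> | Instr j \<Rightarrow> \<beta>Z $ j | Covar j \<Rightarrow> \<beta>C $ j)"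
  define u :: "real ^ ('k1, 'k2) reg2" where "u = axis Resid 1"
  define S where "S i \<omega> = (Zs i \<omega>, Cs i \<omega>, Xs i \<omega>, Ys i \<omega>)" for i \<omega>
  define T where "T \<omega> = (Z \<omega>, C \<omega>, X \<omega>, Y \<omega>)" for \<omega>
  define v :: "(real ^ 'p) \<times> (real ^ 'q) \<times> real \<times> real \<Rightarrow> real ^ ('p, 'q) reg1"
    where "v s = row1 (fst s) (fst (snd s))" for s
  \<comment> \<open>Only the observed quadruple is sampled, so \<open>d\<close> and
    \<open>\<eta>\<close> are defined from it as population residuals; \<open>d_T\<close> and
    \<open>\<eta>_T\<close> identify them with the errors of the model.\<close>
  define d :: "(real ^ 'p) \<times> (real ^ 'q) \<times> real \<times> real \<Rightarrow> real"
    where "d s = fst (snd (snd s)) - v s \<bullet> b0" for s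
  define w :: "(real ^ 'p) \<times> (real ^ 'q) \<times> real \<times> real \<Rightarrow> real ^ ('k1, 'k2) reg2"
    where "w s = row2 f g (fst (snd (snd s))) (fst (snd s)) (d s)" for s
  define \<eta> :: "(real ^ 'p) \<times> (real ^ 'q) \<times> real \<times> real \<Rightarrow> real"
    where "\<eta> s = snd (snd (snd s)) - w s \<bullet> B" for s
  have [measurable]: "T \<in> borel_measurable P" unfolding T_def[abs_def] by measurable
  have v_measurable [measurable]: "v \<in> borel_measurable borel" unfolding v_def[abs_def] by measurable
  have d_measurable [measurable]: "d \<in> borel_measurable borel" unfolding d_def[abs_def] by measurable
  have w_measurable [measurable]: "w \<in> borel_measurable borel"
    unfolding w_def[abs_def] by (intro borel_measurable_row2 assms(3,4)) measurable
  have \<eta>_measurable [measurable]: "\<eta> \<in> borel_measurable borel" unfolding \<eta>_def[abs_def] by measurable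

  have row1_b0: "row1 z c \<bullet> b0 = \<beta>X0 + \<mu> + \<beta>Z \<bullet> z + \<beta>C \<bullet> c" for z c
    unfolding row1_inner by (simp add: b0_def inner_vec_def mult.commute)
  have row2_B: "row2 f g x c t \<bullet> B = \<beta>Y0 + (\<Sum>j\<in>UNIV. \<theta> j * f j x) + (\<Sum>j\<in>UNIV. \<gamma> j * g j c) + \<rho> * t" for x c t
    unfolding row2_inner B_def coeffs2_def by (simp add: mult.commute)
  have d_T: "d (T \<omega>) = \<delta>1 \<omega> - \<mu>" if "\<omega> \<in> space P" for \<omega>
    using X_eq[OF that] by (simp add: d_def T_def v_def row1_b0)
  have \<eta>_T: "\<eta> (T \<omega>) = e \<omega> + \<rho> * \<mu>" if "\<omega> \<in> space P" for \<omega>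
    unfolding \<eta>_def w_def row2_B d_T[OF that]
    using Y_eq[OF that] e_eq[OF that] by (simp add: T_def algebra_simps)
  have v_T: "v (T \<omega>) = row1 (Z \<omega>) (C \<omega>)" for \<omega> by (simp add: v_def T_def)
  have w_T: "w (T \<omega>) = row2 f g (X \<omega>) (C \<omega>) (\<delta>1 \<omega> - \<mu>)" if "\<omega> \<in> space P" for \<omega>
    using d_T[OF that] by (simp add: w_def T_def)
  \<comment> \<open>The row \<open>w\<close> contains functions of X. Substituting the first-stage
    equation for X exhibits it as a function of variables independent of \<open>e\<close>.\<close>
  define K where "K \<omega> = ((Z \<omega>, C \<omega>), \<delta>1 \<omega>)" for \<omega>
  define wK where "wK k = row2 f g (\<beta>X0 + \<beta>Z \<bullet> fst (fst k) + \<beta>C \<bullet> snd (fst k) + snd k) (snd (fst k)) (snd k - \<mu>)" for k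
  have w_K: "w (T \<omega>) = wK (K \<omega>)" if "\<omega> \<in> space P" for \<omega>
    unfolding w_T[OF that] using X_eq[OF that] by (simp add: wK_def K_def)
  have wK_measurable [measurable]: "wK \<in> borel_measurable borel"
    unfolding wK_def[abs_def] by (intro borel_measurable_row2 assms(3,4)) measurable
  define vK where "vK k = row1 (fst (fst k)) (snd (fst k))" for k :: "((real ^ 'p) \<times> (real ^ 'q)) \<times> real"
  have v_K: "v (T \<omega>) = vK (K \<omega>)" for \<omega> by (simp add: v_T vK_def K_def)
  have vK_measurable [measurable]: "vK \<in> borel_measurable borel" unfolding vK_def[abs_def] by measurable

  have sq_v: "integrable P (\<lambda>\<omega>. (norm (v (T \<omega>)))\<^sup>2)"
    unfolding v_T norm_row1 using assms(20,21) by simp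
  have "integrable P (\<lambda>\<omega>. (norm (row2 f g (X \<omega>) (C \<omega>) (\<delta>1 \<omega> - \<mu>)))\<^sup>2)"
    unfolding norm_row2 using assms(22,23) sq_\<delta> by simp
  then have sq_w: "integrable P (\<lambda>\<omega>. (norm (w (T \<omega>)))\<^sup>2)"
    by (subst Bochner_Integration.integrable_cong[OF refl]) (auto simp: w_T)
  have int_v: "integrable P (\<lambda>\<omega>. v (T \<omega>))" and int_w: "integrable P (\<lambda>\<omega>. w (T \<omega>))"
    by (auto intro!: P.square_norm_integrable_imp_integrable sq_v sq_w)
  have int_\<delta>1': "integrable P (\<lambda>\<omega>. \<delta>1 \<omega> - \<mu>)" and mean_\<delta>1: "P.expectation (\<lambda>\<omega>. \<delta>1 \<omega> - \<mu>) = 0"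
    using int_\<delta>1 by (auto simp: \<mu>_def P.prob_space)
  have outer_v: "integrable P (\<lambda>\<omega>. outer (v (T \<omega>)) (v (T \<omega>)))"
    by (intro integrable_outer sq_v) measurable
  have outer_w: "integrable P (\<lambda>\<omega>. outer (w (T \<omega>)) (w (T \<omega>)))"
    by (intro integrable_outer sq_w) measurable

  \<comment> \<open>Independence factors every expectation of this kind, so the scores are square
    integrable although errors and regressors have only second moments. It also gives the
    homoscedastic form of the score covariances.\<close>
  have factor_d: "integrable P (\<lambda>\<omega>. G (d (T \<omega>)) *\<^sub>R F (v (T \<omega>)))"
    "(\<integral>\<omega>. G (d (T \<omega>)) *\<^sub>R F (v (T \<omega>)) \<partial>P) = (\<integral>\<omega>. G (\<delta>1 \<omega> - \<mu>) \<partial>P) *\<^sub>R (\<integral>\<omega>. F (v (T \<omega>)) \<partial>P)"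
    if [measurable]: "F \<in> borel_measurable borel" "G \<in> borel_measurable borel"
      and "integrable P (\<lambda>\<omega>. F (v (T \<omega>)))" "integrable P (\<lambda>\<omega>. G (\<delta>1 \<omega> - \<mu>))"
    for F :: "real ^ ('p, 'q) reg1 \<Rightarrow> 'c::euclidean_space" and G :: "real \<Rightarrow> real"
  proof -
    have F: "(\<lambda>p. F (row1 (fst p) (snd p))) \<in> borel_measurable borel" by measurable
    have G: "(\<lambda>t. G (t - \<mu>)) \<in> borel_measurable borel" by measurable
    note i = P.indep_rv_integral_scaleR[OF ZC_\<delta>1 F G]
    show "integrable P (\<lambda>\<omega>. G (d (T \<omega>)) *\<^sub>R F (v (T \<omega>)))"
      using i(1) that by (subst Bochner_Integration.integrable_cong[OF refl]) (auto simp: d_T v_T)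
    have "(\<integral>\<omega>. G (d (T \<omega>)) *\<^sub>R F (v (T \<omega>)) \<partial>P) = (\<integral>\<omega>. G (\<delta>1 \<omega> - \<mu>) *\<^sub>R F (v (T \<omega>)) \<partial>P)"
      by (rule Bochner_Integration.integral_cong) (auto simp: d_T)
    then show "(\<integral>\<omega>. G (d (T \<omega>)) *\<^sub>R F (v (T \<omega>)) \<partial>P) = (\<integral>\<omega>. G (\<delta>1 \<omega> - \<mu>) \<partial>P) *\<^sub>R (\<integral>\<omega>. F (v (T \<omega>)) \<partial>P)"
      using i(2) that by (simp add: v_T)
  qed
  have factor_\<eta>: "integrable P (\<lambda>\<omega>. G (\<eta> (T \<omega>)) *\<^sub>R F (v (T \<omega>)) (d (T \<omega>)) (w (T \<omega>)))"
    "(\<integral>\<omega>. G (\<eta> (T \<omega>)) *\<^sub>R F (v (T \<omega>)) (d (T \<omega>)) (w (T \<omega>)) \<partial>P) =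
      (\<integral>\<omega>. G (e \<omega> + \<rho> * \<mu>) \<partial>P) *\<^sub>R (\<integral>\<omega>. F (v (T \<omega>)) (d (T \<omega>)) (w (T \<omega>)) \<partial>P)"
    if F: "(\<lambda>k. F (vK k) (snd k - \<mu>) (wK k)) \<in> borel_measurable borel" and [measurable]: "G \<in> borel_measurable borel"
      and int: "integrable P (\<lambda>\<omega>. F (v (T \<omega>)) (d (T \<omega>)) (w (T \<omega>)))" "integrable P (\<lambda>\<omega>. G (e \<omega> + \<rho> * \<mu>))"
    for F :: "real ^ ('p, 'q) reg1 \<Rightarrow> real \<Rightarrow> real ^ ('k1, 'k2) reg2 \<Rightarrow> 'c::euclidean_space" and G :: "real \<Rightarrow> real"
  proof -
    have FK: "F (v (T \<omega>)) (d (T \<omega>)) (w (T \<omega>)) = F (vK (K \<omega>)) (snd (K \<omega>) - \<mu>) (wK (K \<omega>))" if "\<omega> \<in> space P" for \<omega>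
      using that by (simp add: v_K w_K d_T) (simp add: K_def)
    have G: "(\<lambda>t. G (t + \<rho> * \<mu>)) \<in> borel_measurable borel" by measurable
    have intF: "integrable P (\<lambda>\<omega>. F (vK (K \<omega>)) (snd (K \<omega>) - \<mu>) (wK (K \<omega>)))"
      using int(1) by (subst (asm) Bochner_Integration.integrable_cong[OF refl FK]) auto
    note i = P.indep_rv_integral_scaleR[OF K_e[folded K_def] F G intF int(2)]
    show "integrable P (\<lambda>\<omega>. G (\<eta> (T \<omega>)) *\<^sub>R F (v (T \<omega>)) (d (T \<omega>)) (w (T \<omega>)))"
      using i(1) by (subst Bochner_Integration.integrable_cong[OF refl]) (auto simp: \<eta>_T FK)
    have "(\<integral>\<omega>. G (\<eta> (T \<omega>)) *\<^sub>R F (v (T \<omega>)) (d (T \<omega>)) (w (T \<omega>)) \<partial>P)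
        = (\<integral>\<omega>. G (e \<omega> + \<rho> * \<mu>) *\<^sub>R F (vK (K \<omega>)) (snd (K \<omega>) - \<mu>) (wK (K \<omega>)) \<partial>P)"
      by (rule Bochner_Integration.integral_cong) (auto simp: \<eta>_T FK)
    also note i(2)
    also have "(\<integral>\<omega>. F (vK (K \<omega>)) (snd (K \<omega>) - \<mu>) (wK (K \<omega>)) \<partial>P) = (\<integral>\<omega>. F (v (T \<omega>)) (d (T \<omega>)) (w (T \<omega>)) \<partial>P)"
      by (rule Bochner_Integration.integral_cong) (auto simp: FK)
    finally show "(\<integral>\<omega>. G (\<eta> (T \<omega>)) *\<^sub>R F (v (T \<omega>)) (d (T \<omega>)) (w (T \<omega>)) \<partial>P) =
      (\<integral>\<omega>. G (e \<omega> + \<rho> * \<mu>) \<partial>P) *\<^sub>R (\<integral>\<omega>. F (v (T \<omega>)) (d (T \<omega>)) (w (T \<omega>)) \<partial>P)" .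
  qed
  have outer_scaleR: "outer (a *\<^sub>R x) (a *\<^sub>R x) = a\<^sup>2 *\<^sub>R outer x x" for a :: real and x :: "real ^ 'n"
    by (simp add: vec_eq_iff power2_eq_square)
  have sq_dv: "integrable P (\<lambda>\<omega>. (norm (d (T \<omega>) *\<^sub>R v (T \<omega>)))\<^sup>2)"
    using factor_d(1)[of "\<lambda>x. (norm x)\<^sup>2" "\<lambda>t. t\<^sup>2"] sq_v sq_\<delta> by (simp add: power_mult_distrib)
  have outer_\<eta>w_dv: "outer (\<eta> s *\<^sub>R w s) (d s *\<^sub>R v s) = \<eta> s *\<^sub>R outer (w s) (d s *\<^sub>R v s)" for s
    by (simp add: outer.scaleR_left)
  have s1: "(\<integral>\<omega>. (\<delta>1 \<omega> - \<mu>)\<^sup>2 \<partial>P) = P.variance \<delta>1" unfolding \<mu>_def ..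
  have se: "(\<integral>\<omega>. (e \<omega> + \<rho> * \<mu>)\<^sup>2 \<partial>P) = P.variance e" unfolding mean_e by simp

  have reg1: "regressors1 (\<lambda>i. Zs i \<omega>) (\<lambda>i. Cs i \<omega>) = (\<lambda>i. v (S i \<omega>))" for \<omega>
    by (simp add: fun_eq_iff v_def S_def regressors1_def)
  \<comment> \<open>The residual X - v \<bullet> b equals d - v \<bullet> (b - b0), so only the last
    coordinate is perturbed.\<close>
  have reg2: "regressors2 f g (\<lambda>i. Zs i \<omega>) (\<lambda>i. Cs i \<omega>) (\<lambda>i. Xs i \<omega>) b =
      (\<lambda>i. w (S i \<omega>) - (v (S i \<omega>) \<bullet> (b - b0)) *\<^sub>R u)" for \<omega> b
  proof (intro ext vec_eq_iff[THEN iffD2] allI)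
    fix i r
    show "regressors2 f g (\<lambda>i. Zs i \<omega>) (\<lambda>i. Cs i \<omega>) (\<lambda>i. Xs i \<omega>) b i $ r =
        (w (S i \<omega>) - (v (S i \<omega>) \<bullet> (b - b0)) *\<^sub>R u) $ r"
      by (cases r) (simp_all add: regressors2_def reg1 row2_def w_def d_def u_def axis_def inner_diff_right, simp_all add: S_def)
  qed

  interpret cf: control_function_sample M P S T v w d \<eta> u B b0 \<rho> "P.variance e" "P.variance \<delta>1" bhat Bhat
  proof
    show "iid_copies M S P T" using assms(33) unfolding S_def T_def .
    show "bhat n \<in> borel_measurable M" "Bhat n \<in> borel_measurable M" for n
      using assms(34) unfolding control_function_estimator_def by auto
    show "integrable P (\<lambda>\<omega>. (norm (\<eta> (T \<omega>) *\<^sub>R w (T \<omega>)))\<^sup>2)"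
      using factor_\<eta>(1)[of "\<lambda>v d w. (norm w)\<^sup>2" "\<lambda>t. t\<^sup>2"] sq_w sq_e by (simp add: power_mult_distrib)
    show "integrable P (\<lambda>\<omega>. \<eta> (T \<omega>) *\<^sub>R v (T \<omega>))" "(\<integral>\<omega>. \<eta> (T \<omega>) *\<^sub>R v (T \<omega>) \<partial>P) = 0"
      using factor_\<eta>[of "\<lambda>v d w. v" "\<lambda>t. t"] int_v int_e by (auto simp: mean_e')
    show "(\<integral>\<omega>. d (T \<omega>) *\<^sub>R v (T \<omega>) \<partial>P) = 0"
      using factor_d(2)[of "\<lambda>x. x" "\<lambda>t. t"] int_v int_\<delta>1' by (simp add: mean_\<delta>1)
    show "(\<integral>\<omega>. \<eta> (T \<omega>) *\<^sub>R w (T \<omega>) \<partial>P) = 0"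
      using factor_\<eta>(2)[of "\<lambda>v d w. w" "\<lambda>t. t"] int_w int_e by (auto simp: mean_e')
    show "(\<integral>\<omega>. outer (d (T \<omega>) *\<^sub>R v (T \<omega>)) (d (T \<omega>) *\<^sub>R v (T \<omega>)) \<partial>P) =
        P.variance \<delta>1 *\<^sub>R (\<integral>\<omega>. outer (v (T \<omega>)) (v (T \<omega>)) \<partial>P)"
      unfolding outer_scaleR using factor_d(2)[of "\<lambda>x. outer x x" "\<lambda>t. t\<^sup>2"] outer_v sq_\<delta> by (simp add: s1)
    show "(\<integral>\<omega>. outer (\<eta> (T \<omega>) *\<^sub>R w (T \<omega>)) (\<eta> (T \<omega>) *\<^sub>R w (T \<omega>)) \<partial>P) =
        P.variance e *\<^sub>R (\<integral>\<omega>. outer (w (T \<omega>)) (w (T \<omega>)) \<partial>P)"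
      unfolding outer_scaleR using factor_\<eta>(2)[of "\<lambda>v d w. outer w w" "\<lambda>t. t\<^sup>2"] outer_w sq_e by (simp add: se)
    have int: "integrable P (\<lambda>\<omega>. outer (w (T \<omega>)) (d (T \<omega>) *\<^sub>R v (T \<omega>)))"
      by (intro integrable_outer sq_w sq_dv) measurable
    have "(\<lambda>k. outer (wK k) ((snd k - \<mu>) *\<^sub>R vK k)) \<in> borel_measurable borel" by measurable
    \<comment> \<open>\<open>w\<close> itself depends on \<open>d\<close>, but \<eta> is centered
      and independent of (v, d, w) jointly, so its mean factors out and the two scores are
      uncorrelated.\<close>
    note factor = factor_\<eta>(2)[of "\<lambda>v d w. outer w (d *\<^sub>R v)" "\<lambda>t. t", OF this _ int int_e]
    show "(\<integral>\<omega>. outer (\<eta> (T \<omega>) *\<^sub>R w (T \<omega>)) (d (T \<omega>) *\<^sub>R v (T \<omega>)) \<partial>P) = 0"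
      unfolding outer_\<eta>w_dv by (subst factor) (simp_all add: mean_e')
    show "invertible (\<integral>\<omega>. outer (v (T \<omega>)) (v (T \<omega>)) \<partial>P)"
      by (rule invertible_second_moment[OF _ outer_v])
        (unfold v_T, rule P.lin_indep_row1[OF Z_C assms(20,21,28,29)])
    have "lin_indep_rv P (\<lambda>\<omega>. row2 f g (X \<omega>) (C \<omega>) (\<delta>1 \<omega> - \<mu>))"
      by (rule lin_indep_row2_shift[OF assms(30)])
    then have "lin_indep_rv P (\<lambda>\<omega>. w (T \<omega>))"
      unfolding lin_indep_rv_def by (simp add: w_T cong: AE_cong_simp)
    then show "invertible (\<integral>\<omega>. outer (w (T \<omega>)) (w (T \<omega>)) \<partial>P)"
      by (rule invertible_second_moment[OF _ outer_w])
    show "u \<bullet> B = \<rho>" by (simp add: u_def B_def coeffs2_def inner_axis')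
    fix n \<omega> assume sp: "\<omega> \<in> space M"
    have ls: "least_squares n (regressors1 (\<lambda>i. Zs i \<omega>) (\<lambda>i. Cs i \<omega>)) (\<lambda>i. Xs i \<omega>) (bhat n \<omega>)"
      "least_squares n (regressors2 f g (\<lambda>i. Zs i \<omega>) (\<lambda>i. Cs i \<omega>) (\<lambda>i. Xs i \<omega>) (bhat n \<omega>)) (\<lambda>i. Ys i \<omega>) (Bhat n \<omega>)"
      using assms(34) sp unfolding control_function_estimator_def by auto
    show "least_squares n (\<lambda>i. v (S i \<omega>)) (\<lambda>i. d (S i \<omega>) + v (S i \<omega>) \<bullet> b0) (bhat n \<omega>)"
      using ls(1) unfolding reg1 by (simp add: d_def S_def)
    show "least_squares n (\<lambda>i. w (S i \<omega>) - (v (S i \<omega>) \<bullet> (bhat n \<omega> - b0)) *\<^sub>R u)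
        (\<lambda>i. \<eta> (S i \<omega>) + w (S i \<omega>) \<bullet> B) (Bhat n \<omega>)"
      using ls(2) unfolding reg2 by (simp add: \<eta>_def S_def)
  qed (rule sq_v sq_w sq_dv | simp)+
  have W_eq: "W n \<omega> = cf.W n \<omega>" for n \<omega>
    unfolding W_def reg2 by (simp add: fun_eq_iff cf.W_def)
  have D_eq: "D n \<omega> = Dmat n (\<lambda>i. v (S i \<omega>)) (P.variance e) \<rho> (P.variance \<delta>1)" for n \<omega>
    unfolding D_def reg1 ..
  show ?thesis
    unfolding W_eq D_eq
    using cf.consistency cf.conv_Gw cf.conv_sandwich cf.asymptotic_normality cf.inv_Gw
    unfolding cf.Gw_n_def[abs_def] cf.Gw_def by blast
qed

end
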